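(* Let $A=K[a_1,\ldots,a_n]$ be a weighted $\mathbb{N}$-graded solvable polynomial algebra with respect to a positive-degree function $d(\ )$, with admissible system $(\mathscr{B},\prec)$. Let $M$ be a finitely generated $\mathbb{N}$-graded left $A$-module with homogeneous generators of degrees $b_1,\ldots,b_s$, written as $M=L_0/N$, where $L_0=\oplus_{i=1}^sAe_i$ is the $\mathbb{N}$-graded free left $A$-module with $d_{\rm gr}(e_i)=b_i$, $1\le i\le s$, and $N=\sum_{i=1}^mA\xi_i$ is a graded submodule of $L_0$ generated by a finite set $U=\{\xi_1,\ldots,\xi_m\}$ of nonzero homogeneous elements. Then $M$ has a minimal graded free resolution of length $d\le n$, $$0\longrightarrow L_d\stackrel{\varphi_d}{\longrightarrow}\cdots\stackrel{\varphi_2}{\longrightarrow}L_1\stackrel{\varphi_1}{\longrightarrow}L_0\stackrel{\varphi_0}{\longrightarrow}M\longrightarrow 0,$$ which can be constructed by implementing the following procedures. Procedure 1. Run the algorithm MinQuot (see context) with input $E=\{e_1,\ldots,e_s\}$ and $U$ to compute $E'=\{e_{i_1},\ldots,e_{i_{s'}}\}\subset E$ and $V=\{v_1,\ldots,v_t\}\subset N\cap L_0'$ such that $M\cong L_0'/N'$ as graded $A$-modules, where $L_0'=\oplus_{q=1}^{s'}Ae_{i_q}$, $s'\le s$, $N'=\sum_{k=1}^tAv_k$, and such that the cosets $\{\overline{e}_{i_1},\ldots,\overline{e}_{i_{s'}}\}$ form a minimal homogeneous generating set of $M$. Then replace $E,U,N,L_0$ by $E',V,N',L_0'$ (and keep the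 old names), so that there is a short exact sequence $0\to N\to L_0\stackrel{\varphi_0}{\to}M\to 0$ with $\varphi_0(E)$ a minimal homogeneous generating set of $M$. Procedure 2. Choose a left monomial ordering on the $K$-basis $\{a^{\alpha}e_i\}$ of $L_0$ and run the algorithm MinSub (see context) with input $U$ to compute a minimal homogeneous generating set $U_{\min}=\{\xi_{j_1},\ldots,\xi_{j_{s_1}}\}$ and a left Gröbner basis $\mathcal{G}$ of $N$; keeping track of the reductions, record a finite generating set $\mathcal{S}_1,\ldots,\mathcal{S}_r$ (row vectors) of the syzygy module of $\mathcal{G}$ and a matrix $V$ over $A$ expressing the elements of $\mathcal{G}$ in terms of $U_{\min}$. Procedure 3. By division by $\mathcal{G}$ compute a matrix $W$ over $A$ expressing the elements of $U_{\min}$ in terms of $\mathcal{G}$. Then the rows $\mathcal{S}_1V,\ldots,\mathcal{S}_rV$ together with the rows of $WV-I$ ($I$ the identity matrix) give a homogeneous generating set of $N_1=\mathrm{Syz}(U_{\min})$ in the $\mathbb{N}$-graded free $A$-module $L_1=\oplus_{k=1}^{s_1}A\varepsilon_k$ with $d_{\rm gr}(\varepsilon_k)=d_{\rm gr}(\xi_{j_k})$, $1\le k\le s_1$. Procedure 4. Construct the exact sequence $0\to N_1\to L_1\stackrel{\varphi_1}{\to}L_0\stackrel{\varphi_0}{\to}M\to 0$ where $\varphi_1(\varepsilon_k)=\xi_{j_k}$, $1\le k\le s_1$. If $N_1\ne 0$, repeat Procedures 2–4 for $N_1$, and so on.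
   Context: $K$ is a field, $K^*=K\setminus\{0\}$, $\mathbb{N}$ is the set of nonnegative integers; algebras are associative unital $K$-algebras; modules are left unitary modules. Solvable polynomial algebra. $A=K[a_1,\ldots,a_n]$ is a $K$-algebra generated by a minimal generating set $\{a_1,\ldots,a_n\}$ (not necessarily commuting) such that $\mathscr{B}=\{a^{\alpha}=a_1^{\alpha_1}\cdots a_n^{\alpha_n}\mid\alpha\in\mathbb{N}^n\}$ is a $K$-basis of $A$ (PBW basis); elements of $\mathscr{B}$ are monomials. For a total ordering $\prec$ on $\mathscr{B}$ and $0\ne f\in A$, $\mathbf{LM}(f)$ is the largest monomial occurring in $f$, $\mathbf{LC}(f)$ its coefficient. $\prec$ is a monomial ordering if: (1) it is a well-ordering; (2) if $a^{\alpha}\prec a^{\beta}$ and $\mathbf{LM}(a^{\gamma}a^{\alpha}a^{\eta}),\mathbf{LM}(a^{\gamma}a^{\beta}a^{\eta})\notin K$ then $\mathbf{LM}(a^{\gamma}a^{\alpha}a^{\eta})\prec\mathbf{LM}(a^{\gamma}a^{\beta}a^{\eta})$; (3) if $a^{\beta}\ne a^{\gamma}$ and $a^{\gamma}=\mathbf{LM}(a^{\alpha}a^{\beta}a^{\eta})$ then $a^{\beta}\prec a^{\gamma}$. Then $(\mathscr{B},\prec)$ is an admissible system. $A$ is a solvable polynomial algebra if moreover for all $\alpha,\beta$: $a^{\alpha}a^{\beta}=\lambda_{\alpha,\beta}a^{\alpha+\beta}+f_{\alpha,\beta}$ with $\lambda_{\alpha,\beta}\in K^*$ and $f_{\alpha,\beta}=0$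 or $\mathbf{LM}(f_{\alpha,\beta})\prec a^{\alpha+\beta}$. Grading. A positive-degree function $d(\ )$ is given by integers $d(a_i)=m_i>0$, $d(a^{\alpha})=\sum m_i\alpha_i$. Put $A_p=K\text{-span}\{a^{\alpha}\mid d(a^{\alpha})=p\}$; $A$ is weighted $\mathbb{N}$-graded with respect to $d(\ )$ if $A_pA_q\subseteq A_{p+q}$ for all $p,q$. For a free module $L=\oplus_iAe_i$ with chosen $d_{\rm gr}(e_i)=b_i\in\mathbb{N}$, the grading is $L=\oplus_qL_q$, $L_q=K\text{-span}\{a^{\alpha}e_i\mid d(a^{\alpha})+b_i=q\}$; $d_{\rm gr}$ denotes the degree of a nonzero homogeneous element. A graded submodule is one generated by homogeneous elements. A minimal homogeneous generating set is a homogeneous generating set no proper subset of which generates. Minimal graded free resolution of $M$: an exact sequence $\cdots\to L_i\stackrel{\varphi_i}{\to}L_{i-1}\to\cdots\to L_0\stackrel{\varphi_0}{\to}M\to 0$ where each $L_i$ is $\mathbb{N}$-graded free with a finite homogeneous $A$-basis $E_i$, each $\varphi_i$ is a graded homomorphism of degree $0$, $\varphi_0(E_0)$ is a minimal homogeneous generating set of $M$ (with $\mathrm{Ker}\,\varphi_0=N$ when $M=L_0/N$), and for $i\ge1$, $\varphi_i(E_i)$ is a minimal homogeneous generating set of $\mathrm{Ker}\,\varphi_{i-1}$. Orderings and Gröbner bases in $L=\oplus_iAe_i$. A left monomial ordering $\prec_e$ is a total ordering on $\{a^{\alpha}e_i\}$ such that (1) $a^{\alpha}e_i\prec_ea^{\beta}e_j$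 implies $\mathbf{LM}(a^{\gamma}a^{\alpha}e_i)\prec_e\mathbf{LM}(a^{\gamma}a^{\beta}e_j)$ for all $a^\gamma$; (2) $a^{\alpha}\prec a^{\beta}$ implies $a^{\alpha}e_i\prec_ea^{\beta}e_i$. $\mathbf{LM},\mathbf{LC}$ are defined as for $A$. $a^{\alpha}e_i\mid a^{\beta}e_j$ means $i=j$ and $\alpha_k\le\beta_k$ for all $k$. The remainder $\overline{\xi}^{P}$ of $\xi$ on division by a finite set $P\subset L\setminus\{0\}$ is obtained by repeatedly cancelling the leading term by a left multiple $\lambda a^{\gamma}p$, $p\in P$, if $\mathbf{LM}(p)$ divides the leading monomial, and otherwise moving the leading term to the remainder. A left Gröbner basis of a submodule $N$ is a finite $\mathcal{G}\subset N\setminus\{0\}$ such that every nonzero $\xi\in N$ has $\mathbf{LM}(g)\mid\mathbf{LM}(\xi)$ for some $g\in\mathcal{G}$. For $\mathbf{LM}(\xi_i)=a^{\alpha(i)}e_t$, $\mathbf{LM}(\xi_j)=a^{\alpha(j)}e_t$ and $\gamma$ the componentwise maximum of $\alpha(i),\alpha(j)$, $S_{\ell}(\xi_i,\xi_j)=\frac{1}{\mathbf{LC}(a^{\gamma-\alpha(i)}\xi_i)}a^{\gamma-\alpha(i)}\xi_i-\frac{1}{\mathbf{LC}(a^{\gamma-\alpha(j)}\xi_j)}a^{\gamma-\alpha(j)}\xi_j$; for homogeneous elements its degree is $d(a^{\gamma})+d_{\rm gr}(e_t)$. For a finite family $P=\{p_1,\ldots,p_k\}$, $\mathrm{Syz}(P)=\{(h_1,\ldots,h_k)\in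 A^k\mid\sum h_ip_i=0\}$. Algorithm MinQuot. Input: $E=\{e_1,\ldots,e_s\}$, homogeneous $\xi_{\ell}=\sum_kf_{k\ell}e_k$, $1\le\ell\le m$. Start with $V:=U$, $E':=E$. While some $v_j=\sum_kf_{kj}e_k\in V$ has a coefficient in $K^*$, take the first index $i$ with $f_{ij}\in K^*$; replace every other $v_{\ell}\in V$ by $v_{\ell}-\frac{1}{f_{ij}}f_{i\ell}v_j$, discard zeros, remove $v_j$ from $V$ and $e_i$ from $E'$. Output $E'$, $V$. Algorithm MinSub. Input: nonzero homogeneous $\xi_1,\ldots,\xi_m$ of non-decreasing degree. Start with $\mathcal{S}:=\emptyset$ (a set of left S-polynomials), $W:=U$, $\mathcal{G}:=\emptyset$, $U_{\min}:=\emptyset$. Repeat until $\mathcal{S}=\emptyset$ and $W=\emptyset$: let $\nu$ be the least degree of elements of $W$ and $\mathcal{S}$; remove from $\mathcal{S}$ and $W$ their subsets $\mathcal{S}_\nu$, $W_\nu$ of elements of degree $\nu$. First, for each element of $\mathcal{S}_\nu$, compute its remainder $\eta$ on division by the current $\mathcal{G}$; if $\eta\ne 0$, add to $\mathcal{S}$ all $S_{\ell}(g,\eta)$ with $g\in\mathcal{G}$ whose leading monomial involves the same basis element as $\mathbf{LM}(\eta)$, and then append $\eta$ to $\mathcal{G}$. Second, for each $\xi_j\in W_\nu$ compute $\eta=\overline{\xi_j}^{\mathcal{G}}$; if $\eta\ne0$, add $\xi_j$ to $U_{\min}$, enlarge $\mathcal{S}$ as before, and append $\eta$ to $\mathcal{G}$.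 Output $U_{\min}$, $\mathcal{G}$. *)

theory Defs
  imports
    Complex_Main
    "HOL-Algebra.AbelCoset"
    "HOL-Algebra.Module"
    "HOL-Library.Function_Algebras"
    "HOL-Library.Multiset"
begin

text \<open>
  Addition, subtraction and zero of exponent vectors and of free-module elements are the pointwise
  ones of \<^theory>\<open>HOL-Library.Function_Algebras\<close>.  Multiplication of functions is never used.
  Index sets start at 0, so \<open>a\<^sub>1, \<dots>, a\<^sub>n\<close> is \<open>gen P 0, \<dots>, gen P (n - 1)\<close>.
\<close>

type_synonym expo = "nat \<Rightarrow> nat"
type_synonym 'a vec = "nat \<Rightarrow> 'a"


section \<open>Solvable polynomial algebras\<close>

text \<open>
  The algebra is the whole type \<open>'a\<close>, the field is the whole type \<open>'k\<close>.  The ordering of the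
  PBW monomials is given as a relation on exponent vectors.
\<close>

record ('k, 'a) pbw_data =
  smulK :: "'k \<Rightarrow> 'a \<Rightarrow> 'a"
  nvars :: nat
  gen   :: "nat \<Rightarrow> 'a"
  mless :: "expo \<Rightarrow> expo \<Rightarrow> bool"
  wt    :: "nat \<Rightarrow> nat"

definition K_algebra :: "('k::field, 'a::ring_1) pbw_data \<Rightarrow> bool" where
  "K_algebra P \<longleftrightarrow> vector_space (smulK P) \<and>
     (\<forall>c x y. smulK P c (x * y) = smulK P c x * y \<and> smulK P c (x * y) = x * smulK P c y)"

definition subalgebra :: "('k::field, 'a::ring_1) pbw_data \<Rightarrow> 'a set \<Rightarrow> bool" where
  "subalgebra P B \<longleftrightarrow> 1 \<in> B \<and> (\<forall>x\<in>B. \<forall>y\<in>B. x + y \<in> B \<and> x * y \<in> B) \<and>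
     (\<forall>c. \<forall>x\<in>B. smulK P c x \<in> B)"

definition minimally_generated :: "('k::field, 'a::ring_1) pbw_data \<Rightarrow> bool" where
  "minimally_generated P \<longleftrightarrow> subalgebra P hull (gen P ` {..<nvars P}) = UNIV \<and>
     (\<forall>T. T \<subset> gen P ` {..<nvars P} \<longrightarrow> subalgebra P hull T \<noteq> UNIV)"

definition expos :: "('k, 'a) pbw_data \<Rightarrow> expo set" where
  "expos P = {\<alpha>. \<forall>i\<ge>nvars P. \<alpha> i = 0}"

definition pbw :: "('k, 'a::ring_1) pbw_data \<Rightarrow> expo \<Rightarrow> 'a" where
  "pbw P \<alpha> = prod_list (map (\<lambda>i. gen P i ^ \<alpha> i) [0..<nvars P])"

definition PBW_basis :: "('k::field, 'a::ring_1) pbw_data \<Rightarrow> bool" where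
  "PBW_basis P \<longleftrightarrow> inj_on (pbw P) (expos P) \<and>
     \<not> Modules.module.dependent (smulK P) (pbw P ` expos P) \<and>
     Modules.module.span (smulK P) (pbw P ` expos P) = UNIV"

definition coef :: "('k::field, 'a::ring_1) pbw_data \<Rightarrow> 'a \<Rightarrow> expo \<Rightarrow> 'k" where
  "coef P f \<alpha> = Modules.module.representation (smulK P) (pbw P ` expos P) f (pbw P \<alpha>)"

definition strict_total_order_on :: "'b set \<Rightarrow> ('b \<Rightarrow> 'b \<Rightarrow> bool) \<Rightarrow> bool" where
  "strict_total_order_on B r \<longleftrightarrow> irreflp_on B r \<and> transp_on B r \<and> totalp_on B r"

definition greatest_wrt :: "('b \<Rightarrow> 'b \<Rightarrow> bool) \<Rightarrow> 'b set \<Rightarrow> 'b" where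
  "greatest_wrt r S = (THE m. m \<in> S \<and> (\<forall>m'\<in>S. m' \<noteq> m \<longrightarrow> r m' m))"

text \<open>The exponent vector of \<open>LM(f)\<close>; meaningful for \<open>f \<noteq> 0\<close> only.\<close>

definition LMA :: "('k::field, 'a::ring_1) pbw_data \<Rightarrow> 'a \<Rightarrow> expo" where
  "LMA P f = greatest_wrt (mless P) {\<alpha> \<in> expos P. coef P f \<alpha> \<noteq> 0}"

definition constants :: "('k::field, 'a::ring_1) pbw_data \<Rightarrow> 'a set" where
  "constants P = range (\<lambda>c. smulK P c 1)"

definition units_K :: "('k::field, 'a::ring_1) pbw_data \<Rightarrow> 'a set" where
  "units_K P = {smulK P c 1 |c. c \<noteq> 0}"

text \<open>
  The nonvanishing guards are the implicit condition under which \<open>LM\<close> is defined;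
  in a solvable polynomial algebra no product of monomials vanishes.
\<close>

definition monomial_ordering :: "('k::field, 'a::ring_1) pbw_data \<Rightarrow> bool" where
  "monomial_ordering P \<longleftrightarrow>
     strict_total_order_on (expos P) (mless P) \<and> wfp_on (expos P) (mless P) \<and>
     (\<forall>\<alpha>\<in>expos P. \<forall>\<beta>\<in>expos P. \<forall>\<gamma>\<in>expos P. \<forall>\<eta>\<in>expos P.
        let x = pbw P \<gamma> * pbw P \<alpha> * pbw P \<eta>; y = pbw P \<gamma> * pbw P \<beta> * pbw P \<eta> in
        mless P \<alpha> \<beta> \<longrightarrow> x \<noteq> 0 \<longrightarrow> y \<noteq> 0 \<longrightarrow>
        pbw P (LMA P x) \<notin> constants P \<longrightarrow> pbw P (LMA P y) \<notin> constants P \<longrightarrow>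
        mless P (LMA P x) (LMA P y)) \<and>
     (\<forall>\<alpha>\<in>expos P. \<forall>\<beta>\<in>expos P. \<forall>\<gamma>\<in>expos P. \<forall>\<eta>\<in>expos P.
        let x = pbw P \<alpha> * pbw P \<beta> * pbw P \<eta> in
        \<beta> \<noteq> \<gamma> \<longrightarrow> x \<noteq> 0 \<longrightarrow> \<gamma> = LMA P x \<longrightarrow> mless P \<beta> \<gamma>)"

definition solvable_polynomial_algebra :: "('k::field, 'a::ring_1) pbw_data \<Rightarrow> bool" where
  "solvable_polynomial_algebra P \<longleftrightarrow>
     K_algebra P \<and> minimally_generated P \<and> PBW_basis P \<and> monomial_ordering P \<and>
     (\<forall>\<alpha>\<in>expos P. \<forall>\<beta>\<in>expos P. \<exists>l f. l \<noteq> 0 \<and>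
        pbw P \<alpha> * pbw P \<beta> = smulK P l (pbw P (\<alpha> + \<beta>)) + f \<and>
        (f = 0 \<or> mless P (LMA P f) (\<alpha> + \<beta>)))"

definition deg :: "('k, 'a) pbw_data \<Rightarrow> expo \<Rightarrow> nat" where
  "deg P \<alpha> = (\<Sum>i<nvars P. wt P i * \<alpha> i)"

definition gradeA :: "('k::field, 'a::ring_1) pbw_data \<Rightarrow> nat \<Rightarrow> 'a set" where
  "gradeA P p = Modules.module.span (smulK P) {pbw P \<alpha> |\<alpha>. \<alpha> \<in> expos P \<and> deg P \<alpha> = p}"

definition weighted_graded_solvable_algebra :: "('k::field, 'a::ring_1) pbw_data \<Rightarrow> bool" where
  "weighted_graded_solvable_algebra P \<longleftrightarrow> solvable_polynomial_algebra P \<and>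
     (\<forall>i<nvars P. wt P i > 0) \<and>
     (\<forall>p q. \<forall>x\<in>gradeA P p. \<forall>y\<in>gradeA P q. x * y \<in> gradeA P (p + q))"


section \<open>Graded left modules\<close>

text \<open>
  \<open>HOL-Algebra\<close> supplies the record of module operations and additive groups with carriers, but its
  locale of modules requires a commutative base ring.  The multiplicative fields \<open>mult\<close>
  and \<open>one\<close> inherited by the record play no role.
\<close>

record ('a, 'm) graded_module = "('a, 'm) module" +
  grade :: "nat \<Rightarrow> 'm set"

definition left_module :: "('a::ring_1, 'm, 'z) module_scheme \<Rightarrow> bool" where
  "left_module M \<longleftrightarrow> abelian_group M \<and>
     (\<forall>r. \<forall>x\<in>carrier M. r \<odot>\<^bsub>M\<^esub> x \<in> carrier M) \<and>
     (\<forall>r. \<forall>x\<in>carrier M. \<forall>y\<in>carrier M. r \<odot>\<^bsub>M\<^esub> (x \<oplus>\<^bsub>M\<^esub> y) = r \<odot>\<^bsub>M\<^esub> x \<oplus>\<^bsub>M\<^esub> r \<odot>\<^bsub>M\<^esub> y) \<and>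
     (\<forall>r s. \<forall>x\<in>carrier M. (r + s) \<odot>\<^bsub>M\<^esub> x = r \<odot>\<^bsub>M\<^esub> x \<oplus>\<^bsub>M\<^esub> s \<odot>\<^bsub>M\<^esub> x) \<and>
     (\<forall>r s. \<forall>x\<in>carrier M. (r * s) \<odot>\<^bsub>M\<^esub> x = r \<odot>\<^bsub>M\<^esub> (s \<odot>\<^bsub>M\<^esub> x)) \<and>
     (\<forall>x\<in>carrier M. 1 \<odot>\<^bsub>M\<^esub> x = x)"

definition graded_left_module ::
    "('k::field, 'a::ring_1) pbw_data \<Rightarrow> ('a, 'm) graded_module \<Rightarrow> bool" where
  "graded_left_module P M \<longleftrightarrow> left_module M \<and>
     (\<forall>q. additive_subgroup (grade M q) M) \<and>
     (\<forall>p q. \<forall>r\<in>gradeA P p. \<forall>x\<in>grade M q. r \<odot>\<^bsub>M\<^esub> x \<in> grade M (p + q)) \<and>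
     (\<forall>x\<in>carrier M. \<exists>!c. (\<forall>q. c q \<in> grade M q) \<and> finite {q. c q \<noteq> \<zero>\<^bsub>M\<^esub>} \<and>
        x = finsum M c {q. c q \<noteq> \<zero>\<^bsub>M\<^esub>})"

definition left_submodule :: "('a, 'm, 'z) module_scheme \<Rightarrow> 'm set \<Rightarrow> bool" where
  "left_submodule M H \<longleftrightarrow> additive_subgroup H M \<and> (\<forall>r. \<forall>x\<in>H. r \<odot>\<^bsub>M\<^esub> x \<in> H)"

abbreviation lspan :: "('a, 'm, 'z) module_scheme \<Rightarrow> 'm set \<Rightarrow> 'm set" where
  "lspan M S \<equiv> left_submodule M hull S"

definition homogeneous :: "('a, 'm) graded_module \<Rightarrow> 'm \<Rightarrow> bool" where
  "homogeneous M x \<longleftrightarrow> (\<exists>q. x \<in> grade M q)"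

text \<open>The degree of a nonzero homogeneous element.\<close>

definition hdeg :: "('a, 'm) graded_module \<Rightarrow> 'm \<Rightarrow> nat" where
  "hdeg M x = (THE q. x \<in> grade M q)"

definition min_hom_gens :: "('a, 'm) graded_module \<Rightarrow> 'm set \<Rightarrow> 'm set \<Rightarrow> bool" where
  "min_hom_gens M H S \<longleftrightarrow> (\<forall>x\<in>S. homogeneous M x) \<and> lspan M S = H \<and>
     (\<forall>T. T \<subset> S \<longrightarrow> lspan M T \<noteq> H)"

text \<open>Graded homomorphisms of degree 0.\<close>

definition graded_hom ::
    "('a, 'm) graded_module \<Rightarrow> ('a, 'l) graded_module \<Rightarrow> ('m \<Rightarrow> 'l) \<Rightarrow> bool" where
  "graded_hom M L f \<longleftrightarrow>
     (\<forall>x\<in>carrier M. f x \<in> carrier L) \<and>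
     (\<forall>x\<in>carrier M. \<forall>y\<in>carrier M. f (x \<oplus>\<^bsub>M\<^esub> y) = f x \<oplus>\<^bsub>L\<^esub> f y) \<and>
     (\<forall>r. \<forall>x\<in>carrier M. f (r \<odot>\<^bsub>M\<^esub> x) = r \<odot>\<^bsub>L\<^esub> f x) \<and>
     (\<forall>q. \<forall>x\<in>grade M q. f x \<in> grade L q)"

definition graded_iso ::
    "('a, 'm) graded_module \<Rightarrow> ('a, 'l) graded_module \<Rightarrow> ('m \<Rightarrow> 'l) \<Rightarrow> bool" where
  "graded_iso M L f \<longleftrightarrow> graded_hom M L f \<and> bij_betw f (carrier M) (carrier L) \<and>
     (\<forall>q. f ` grade M q = grade L q)"

definition quot_mod ::
    "('a, 'm) graded_module \<Rightarrow> 'm set \<Rightarrow> ('a, 'm set) graded_module" where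
  "quot_mod L N = \<lparr>carrier = a_rcosets\<^bsub>L\<^esub> N, monoid.mult = undefined, one = undefined,
     zero = N, add = set_add L,
     smult = (\<lambda>r C. \<Union>x\<in>C. N +>\<^bsub>L\<^esub> (r \<odot>\<^bsub>L\<^esub> x)),
     grade = (\<lambda>q. (\<lambda>x. N +>\<^bsub>L\<^esub> x) ` grade L q)\<rparr>"


section \<open>Graded free modules\<close>

definition single :: "nat \<Rightarrow> 'a::zero \<Rightarrow> 'a vec" where
  "single i r = (\<lambda>j. if j = i then r else 0)"

definition lmul :: "'a::times \<Rightarrow> 'a vec \<Rightarrow> 'a vec" where
  "lmul r x = (\<lambda>i. r * x i)"

text \<open>
  The free module on basis elements \<open>e\<^sub>i = single i 1\<close> (\<open>i \<in> E\<close>) of degrees \<open>b i\<close>.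
\<close>

definition free_mod :: "('k::field, 'a::ring_1) pbw_data \<Rightarrow> nat set \<Rightarrow> (nat \<Rightarrow> nat) \<Rightarrow>
    ('a, 'a vec) graded_module" where
  "free_mod P E b = \<lparr>carrier = {x. \<forall>i. i \<notin> E \<longrightarrow> x i = 0}, monoid.mult = undefined, one = undefined,
     zero = 0, add = (+), smult = lmul,
     grade = (\<lambda>q. Modules.module.span (\<lambda>c x i. smulK P c (x i))
        {single i (pbw P \<alpha>) |\<alpha> i. \<alpha> \<in> expos P \<and> i \<in> E \<and> deg P \<alpha> + b i = q})\<rparr>"

text \<open>Row vector times matrix, the matrix being given as the list of its rows.\<close>

definition row_mult :: "'a::ring_1 vec \<Rightarrow> 'a vec list \<Rightarrow> 'a vec" where
  "row_mult h V = (\<Sum>k<length V. lmul (h k) (V ! k))"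

definition syz :: "'a::ring_1 vec list \<Rightarrow> 'a vec set" where
  "syz ps = {h. (\<forall>k\<ge>length ps. h k = 0) \<and> row_mult h ps = 0}"

text \<open>
  A minimal graded free resolution
  \<open>0 \<rightarrow> L\<^sub>d \<rightarrow> \<dots> \<rightarrow> L\<^sub>0 \<rightarrow> M \<rightarrow> 0\<close> with \<open>L\<^sub>i = free_mod P (E i) (b i)\<close>.
  That \<open>\<phi>\<^sub>i(E\<^sub>i)\<close> is a minimal generating set is understood for the family
  \<open>\<phi>\<^sub>i(e)\<close>, \<open>e \<in> E\<^sub>i\<close>, i.e. without repetitions.  \<open>\<phi> 0\<close> is not used.
\<close>

definition basis_images :: "nat set \<Rightarrow> ('a::ring_1 vec \<Rightarrow> 'm) \<Rightarrow> 'm set" where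
  "basis_images E f = (\<lambda>i. f (single i 1)) ` E"

definition min_graded_free_resolution ::
    "('k::field, 'a::ring_1) pbw_data \<Rightarrow> ('a, 'm) graded_module \<Rightarrow> nat \<Rightarrow>
     (nat \<Rightarrow> nat set) \<Rightarrow> (nat \<Rightarrow> nat \<Rightarrow> nat) \<Rightarrow>
     ('a vec \<Rightarrow> 'm) \<Rightarrow> (nat \<Rightarrow> 'a vec \<Rightarrow> 'a vec) \<Rightarrow> bool" where
  "min_graded_free_resolution P M d E b \<phi>\<^sub>0 \<phi> \<longleftrightarrow>
    (let L = (\<lambda>i. free_mod P (E i) (b i));
         Ker = (\<lambda>i. if i = 0 then {x \<in> carrier (L 0). \<phi>\<^sub>0 x = \<zero>\<^bsub>M\<^esub>}
                    else {x \<in> carrier (L i). \<phi> i x = 0})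
     in (\<forall>i\<le>d. finite (E i)) \<and> (0 < d \<longrightarrow> E d \<noteq> {}) \<and>
        graded_hom (L 0) M \<phi>\<^sub>0 \<and> \<phi>\<^sub>0 ` carrier (L 0) = carrier M \<and>
        inj_on (\<lambda>i. \<phi>\<^sub>0 (single i 1)) (E 0) \<and>
        min_hom_gens M (carrier M) (basis_images (E 0) \<phi>\<^sub>0) \<and>
        (\<forall>i\<in>{1..d}. graded_hom (L i) (L (i - 1)) (\<phi> i) \<and>
           \<phi> i ` carrier (L i) = Ker (i - 1) \<and>
           inj_on (\<lambda>k. \<phi> i (single k 1)) (E i) \<and>
           min_hom_gens (L (i - 1)) (Ker (i - 1)) (basis_images (E i) (\<phi> i))) \<and>
        Ker d = {0})"


section \<open>Leading monomials, division and Groebner bases in free modules\<close>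

text \<open>The pair \<open>(\<alpha>, i)\<close> stands for the monomial \<open>a\<^sup>\<alpha> e\<^sub>i\<close>.\<close>

type_synonym fmon = "expo \<times> nat"

definition LM :: "('k::field, 'a::ring_1) pbw_data \<Rightarrow> (fmon \<Rightarrow> fmon \<Rightarrow> bool) \<Rightarrow> 'a vec \<Rightarrow> fmon" where
  "LM P r x = greatest_wrt r {(\<alpha>, i). \<alpha> \<in> expos P \<and> coef P (x i) \<alpha> \<noteq> 0}"

definition LC :: "('k::field, 'a::ring_1) pbw_data \<Rightarrow> (fmon \<Rightarrow> fmon \<Rightarrow> bool) \<Rightarrow> 'a vec \<Rightarrow> 'k" where
  "LC P r x = (case LM P r x of (\<alpha>, i) \<Rightarrow> coef P (x i) \<alpha>)"

definition left_monomial_ordering ::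
    "('k::field, 'a::ring_1) pbw_data \<Rightarrow> nat set \<Rightarrow> (fmon \<Rightarrow> fmon \<Rightarrow> bool) \<Rightarrow> bool" where
  "left_monomial_ordering P E r \<longleftrightarrow>
     strict_total_order_on (expos P \<times> E) r \<and>
     (\<forall>\<alpha>\<in>expos P. \<forall>\<beta>\<in>expos P. \<forall>i\<in>E. \<forall>j\<in>E. r (\<alpha>, i) (\<beta>, j) \<longrightarrow>
        (\<forall>\<gamma>\<in>expos P. r (LM P r (single i (pbw P \<gamma> * pbw P \<alpha>)))
                         (LM P r (single j (pbw P \<gamma> * pbw P \<beta>))))) \<and>
     (\<forall>\<alpha>\<in>expos P. \<forall>\<beta>\<in>expos P. \<forall>i\<in>E. mless P \<alpha> \<beta> \<longrightarrow> r (\<alpha>, i) (\<beta>, i))"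

definition mon_dvd :: "fmon \<Rightarrow> fmon \<Rightarrow> bool" where
  "mon_dvd m m' \<longleftrightarrow> snd m = snd m' \<and> (\<forall>k. fst m k \<le> fst m' k)"

definition left_groebner_basis ::
    "('k::field, 'a::ring_1) pbw_data \<Rightarrow> (fmon \<Rightarrow> fmon \<Rightarrow> bool) \<Rightarrow> 'a vec set \<Rightarrow> 'a vec set \<Rightarrow> bool" where
  "left_groebner_basis P r N G \<longleftrightarrow> finite G \<and> G \<subseteq> N - {0} \<and>
     (\<forall>x\<in>N. x \<noteq> 0 \<longrightarrow> (\<exists>g\<in>G. mon_dvd (LM P r g) (LM P r x)))"

text \<open>
  \<open>S\<^sub>\<ell>(x, y) = lmul (S_mult x y) x - lmul (S_mult y x) y\<close>.
\<close>

definition S_mult ::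
    "('k::field, 'a::ring_1) pbw_data \<Rightarrow> (fmon \<Rightarrow> fmon \<Rightarrow> bool) \<Rightarrow> 'a vec \<Rightarrow> 'a vec \<Rightarrow> 'a" where
  "S_mult P r x y =
     (let \<alpha> = fst (LM P r x); \<beta> = fst (LM P r y); \<gamma> = (\<lambda>k. max (\<alpha> k) (\<beta> k));
          h = pbw P (\<gamma> - \<alpha>)
      in smulK P (1 / LC P r (lmul h x)) h)"

definition S_poly ::
    "('k::field, 'a::ring_1) pbw_data \<Rightarrow> (fmon \<Rightarrow> fmon \<Rightarrow> bool) \<Rightarrow> 'a vec \<Rightarrow> 'a vec \<Rightarrow> 'a vec" where
  "S_poly P r x y = lmul (S_mult P r x y) x - lmul (S_mult P r y x) y"

definition S_deg ::
    "('k::field, 'a::ring_1) pbw_data \<Rightarrow> (nat \<Rightarrow> nat) \<Rightarrow> (fmon \<Rightarrow> fmon \<Rightarrow> bool) \<Rightarrow> 'a vec \<Rightarrow> 'a vec \<Rightarrow> nat" where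
  "S_deg P b r x y =
     deg P (\<lambda>k. max (fst (LM P r x) k) (fst (LM P r y) k)) + b (snd (LM P r x))"

text \<open>
  Algorithms are nondeterministic transition relations; every choice left open by the
  description is left open here.
\<close>

definition halts :: "('s \<Rightarrow> 's \<Rightarrow> bool) \<Rightarrow> ('s \<Rightarrow> bool) \<Rightarrow> 's \<Rightarrow> bool" where
  "halts step final s \<longleftrightarrow>
     \<not> (\<exists>f. f 0 = s \<and> (\<forall>k. step (f k) (f (Suc k)))) \<and>
     (\<forall>t. step\<^sup>*\<^sup>* s t \<longrightarrow> final t \<or> (\<exists>u. step t u))"

text \<open>
  Division of \<open>x\<close> by the list \<open>G\<close>.  A state \<open>(x, q, \<rho>)\<close> consists of what is left to be divided,
  the quotients \<open>q k\<close> collected for \<open>G ! k\<close>, and the partial remainder; the start is \<open>(x, 0, 0)\<close>.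
\<close>

definition div_step ::
    "('k::field, 'a::ring_1) pbw_data \<Rightarrow> (fmon \<Rightarrow> fmon \<Rightarrow> bool) \<Rightarrow> 'a vec list \<Rightarrow>
     'a vec \<times> 'a vec \<times> 'a vec \<Rightarrow> 'a vec \<times> 'a vec \<times> 'a vec \<Rightarrow> bool" where
  "div_step P r G = (\<lambda>(x, q, \<rho>) (x', q', \<rho>'). x \<noteq> 0 \<and>
     ((\<exists>k<length G. mon_dvd (LM P r (G ! k)) (LM P r x) \<and>
         (let a = pbw P (fst (LM P r x) - fst (LM P r (G ! k)));
              h = smulK P (LC P r x / LC P r (lmul a (G ! k))) a
          in x' = x - lmul h (G ! k) \<and> q' = q(k := q k + h) \<and> \<rho>' = \<rho>)) \<or>
      (\<not> (\<exists>k<length G. mon_dvd (LM P r (G ! k)) (LM P r x)) \<and>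
         (let t = single (snd (LM P r x)) (smulK P (LC P r x) (pbw P (fst (LM P r x))))
          in x' = x - t \<and> q' = q \<and> \<rho>' = \<rho> + t))))"

definition div_final :: "'a::zero vec \<times> 'a vec \<times> 'a vec \<Rightarrow> bool" where
  "div_final = (\<lambda>(x, q, \<rho>). x = 0)"

definition division ::
    "('k::field, 'a::ring_1) pbw_data \<Rightarrow> (fmon \<Rightarrow> fmon \<Rightarrow> bool) \<Rightarrow> 'a vec list \<Rightarrow>
     'a vec \<Rightarrow> 'a vec \<Rightarrow> 'a vec \<Rightarrow> bool" where
  "division P r G x q \<rho> \<longleftrightarrow> (div_step P r G)\<^sup>*\<^sup>* (x, 0, 0) (0, q, \<rho>)"


section \<open>Algorithm MinQuot\<close>

text \<open>
  States are pairs \<open>(E', V)\<close>.  The least index \<open>i\<close> automatically lies in \<open>E'\<close>, as the elements of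
  \<open>V\<close> are supported there.
\<close>

definition minquot_step ::
    "('k::field, 'a::ring_1) pbw_data \<Rightarrow> nat set \<times> 'a vec list \<Rightarrow> nat set \<times> 'a vec list \<Rightarrow> bool" where
  "minquot_step P = (\<lambda>(E, V) (E', V'). \<exists>j c. j < length V \<and> (\<exists>i. (V ! j) i \<in> units_K P) \<and>
     (let v = V ! j; i = (LEAST i. v i \<in> units_K P)
      in c \<noteq> 0 \<and> v i = smulK P c 1 \<and> E' = E - {i} \<and>
         V' = filter (\<lambda>x. x \<noteq> 0)
                (map (\<lambda>x. x - lmul (smulK P (1 / c) (x i)) v) (take j V @ drop (Suc j) V))))"

definition minquot_final ::
    "('k::field, 'a::ring_1) pbw_data \<Rightarrow> nat set \<times> 'a vec list \<Rightarrow> bool" where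
  "minquot_final P = (\<lambda>(E, V). \<forall>v\<in>set V. \<forall>i. v i \<notin> units_K P)"

definition minquot_output ::
    "('k::field, 'a::ring_1) pbw_data \<Rightarrow> nat set \<Rightarrow> 'a vec list \<Rightarrow> nat set \<Rightarrow> 'a vec list \<Rightarrow> bool" where
  "minquot_output P E U E' V \<longleftrightarrow>
     (minquot_step P)\<^sup>*\<^sup>* (E, U) (E', V) \<and> minquot_final P (E', V)"


section \<open>Algorithm MinSub, keeping track of the reductions\<close>

text \<open>
  \<open>spairs\<close> is the set \<open>\<S>\<close>, an S-polynomial \<open>S\<^sub>\<ell>(g\<^sub>i, g\<^sub>j)\<close> being stored as the pair \<open>(i, j)\<close> of
  positions in \<open>gb\<close>; \<open>waiting\<close> is \<open>W\<close>, as a set of positions in the input list; \<open>spairs_now\<close> and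
  \<open>waiting_now\<close> are what remains of \<open>\<S>\<^sub>\<nu>\<close> and \<open>W\<^sub>\<nu>\<close> in the current round; \<open>gb\<close> and \<open>umin\<close> are
  \<open>\<G>\<close> and \<open>U\<^sub>m\<^sub>i\<^sub>n\<close>.  The last two fields record the reductions: the \<open>k\<close>-th entry of \<open>vrows\<close>
  expresses \<open>gb ! k\<close> in terms of \<open>umin\<close>, and every S-polynomial processed contributes to
  \<open>syzs\<close> the syzygy of \<open>\<G>\<close> given by its reduction.
\<close>

record 'a minsub_state =
  spairs :: "(nat \<times> nat) set"
  waiting :: "nat set"
  spairs_now :: "(nat \<times> nat) set"
  waiting_now :: "nat set"
  gb :: "'a vec list"
  umin :: "'a vec list"
  vrows :: "'a vec list"
  syzs :: "'a vec list"

definition minsub_init :: "'a vec list \<Rightarrow> 'a minsub_state" where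
  "minsub_init U = \<lparr>spairs = {}, waiting = {..<length U}, spairs_now = {}, waiting_now = {},
     gb = [], umin = [], vrows = [], syzs = []\<rparr>"

definition minsub_final :: "'a minsub_state \<Rightarrow> bool" where
  "minsub_final s \<longleftrightarrow> spairs s = {} \<and> waiting s = {} \<and> spairs_now s = {} \<and> waiting_now s = {}"

definition new_pairs ::
    "('k::field, 'a::ring_1) pbw_data \<Rightarrow> (fmon \<Rightarrow> fmon \<Rightarrow> bool) \<Rightarrow> 'a vec list \<Rightarrow> 'a vec \<Rightarrow> (nat \<times> nat) set" where
  "new_pairs P r G y = {(k, length G) |k. k < length G \<and> snd (LM P r (G ! k)) = snd (LM P r y)}"

inductive minsub_step ::
    "('k::field, 'a::ring_1) pbw_data \<Rightarrow> nat set \<Rightarrow> (nat \<Rightarrow> nat) \<Rightarrow> (fmon \<Rightarrow> fmon \<Rightarrow> bool) \<Rightarrow>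
     'a vec list \<Rightarrow> 'a minsub_state \<Rightarrow> 'a minsub_state \<Rightarrow> bool"
  for P E b r U where
  new_round:
    "minsub_step P E b r U s
       (s\<lparr>spairs := {p \<in> spairs s. sd p \<noteq> \<nu>}, waiting := {j \<in> waiting s. wd j \<noteq> \<nu>},
          spairs_now := {p \<in> spairs s. sd p = \<nu>}, waiting_now := {j \<in> waiting s. wd j = \<nu>}\<rparr>)"
  if "spairs_now s = {}" and "waiting_now s = {}" and "spairs s \<noteq> {} \<or> waiting s \<noteq> {}"
    and "sd = (\<lambda>(i, j). S_deg P b r (gb s ! i) (gb s ! j))"
    and "wd = (\<lambda>j. hdeg (free_mod P E b) (U ! j))"
    and "\<nu> = Min (sd ` spairs s \<union> wd ` waiting s)"
| S_poly_zero:
    "minsub_step P E b r U s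
       (s\<lparr>spairs_now := spairs_now s - {(i, j)}, syzs := syzs s @ [z]\<rparr>)"
  if "(i, j) \<in> spairs_now s"
    and "division P r (gb s) (S_poly P r (gb s ! i) (gb s ! j)) q 0"
    and "z = single i (S_mult P r (gb s ! i) (gb s ! j))
             - single j (S_mult P r (gb s ! j) (gb s ! i)) - q"
| S_poly_nonzero:
    "minsub_step P E b r U s
       (s\<lparr>spairs_now := spairs_now s - {(i, j)},
          spairs := spairs s \<union> new_pairs P r (gb s) \<eta>,
          gb := gb s @ [\<eta>],
          vrows := vrows s @ [row_mult z (vrows s)],
          syzs := syzs s @ [z - single (length (gb s)) 1]\<rparr>)"
  if "(i, j) \<in> spairs_now s"
    and "division P r (gb s) (S_poly P r (gb s ! i) (gb s ! j)) q \<eta>" and "\<eta> \<noteq> 0"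
    and "z = single i (S_mult P r (gb s ! i) (gb s ! j))
             - single j (S_mult P r (gb s ! j) (gb s ! i)) - q"
| input_zero:
    "minsub_step P E b r U s (s\<lparr>waiting_now := waiting_now s - {j}\<rparr>)"
  if "spairs_now s = {}" and "j \<in> waiting_now s" and "division P r (gb s) (U ! j) q 0"
| input_nonzero:
    "minsub_step P E b r U s
       (s\<lparr>waiting_now := waiting_now s - {j},
          spairs := spairs s \<union> new_pairs P r (gb s) \<eta>,
          gb := gb s @ [\<eta>],
          umin := umin s @ [U ! j],
          vrows := vrows s @ [single (length (umin s)) 1 - row_mult q (vrows s)]\<rparr>)"
  if "spairs_now s = {}" and "j \<in> waiting_now s"
    and "division P r (gb s) (U ! j) q \<eta>" and "\<eta> \<noteq> 0"


section \<open>The procedures\<close>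

text \<open>
  A stage of the construction: a graded free module with basis \<open>e\<^sub>i\<close>, \<open>i \<in> idx X\<close>, of degrees
  \<open>bdeg X i\<close>, and a list of homogeneous generators of the submodule to be treated next.
\<close>

record 'a stage =
  idx :: "nat set"
  bdeg :: "nat \<Rightarrow> nat"
  gens :: "'a vec list"

definition stageL :: "('k::field, 'a::ring_1) pbw_data \<Rightarrow> 'a stage \<Rightarrow> ('a, 'a vec) graded_module" where
  "stageL P X = free_mod P (idx X) (bdeg X)"

definition stageN :: "('k::field, 'a::ring_1) pbw_data \<Rightarrow> 'a stage \<Rightarrow> 'a vec set" where
  "stageN P X = lspan (stageL P X) (set (gens X))"

text \<open>The input of MinSub lists the generators by non-decreasing degree.\<close>

definition minsub_input :: "('k::field, 'a::ring_1) pbw_data \<Rightarrow> 'a stage \<Rightarrow> 'a vec list \<Rightarrow> bool" where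
  "minsub_input P X U \<longleftrightarrow> mset U = mset (gens X) \<and> sorted (map (hdeg (stageL P X)) U)"

abbreviation minsub_stage_step ::
    "('k::field, 'a::ring_1) pbw_data \<Rightarrow> 'a stage \<Rightarrow> (fmon \<Rightarrow> fmon \<Rightarrow> bool) \<Rightarrow> 'a vec list \<Rightarrow>
     'a minsub_state \<Rightarrow> 'a minsub_state \<Rightarrow> bool" where
  "minsub_stage_step P X \<equiv> minsub_step P (idx X) (bdeg X)"

definition minsub_output ::
    "('k::field, 'a::ring_1) pbw_data \<Rightarrow> 'a stage \<Rightarrow> (fmon \<Rightarrow> fmon \<Rightarrow> bool) \<Rightarrow> 'a vec list \<Rightarrow>
     'a minsub_state \<Rightarrow> bool" where
  "minsub_output P X r U s \<longleftrightarrow>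
     (minsub_stage_step P X r U)\<^sup>*\<^sup>* (minsub_init U) s \<and> minsub_final s"

text \<open>The rows of \<open>W\<close> are the quotients obtained on dividing the elements of \<open>umin\<close> by \<open>gb\<close>.\<close>

definition division_matrix ::
    "('k::field, 'a::ring_1) pbw_data \<Rightarrow> (fmon \<Rightarrow> fmon \<Rightarrow> bool) \<Rightarrow> 'a minsub_state \<Rightarrow> 'a vec list \<Rightarrow> bool" where
  "division_matrix P r s W \<longleftrightarrow> length W = length (umin s) \<and>
     (\<forall>k<length W. \<exists>\<rho>. division P r (gb s) (umin s ! k) (W ! k) \<rho>)"

text \<open>The rows \<open>\<S>\<^sub>i V\<close> and those of \<open>W V - I\<close>.\<close>

definition syzygy_rows :: "'a::ring_1 minsub_state \<Rightarrow> 'a vec list \<Rightarrow> 'a vec list" where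
  "syzygy_rows s W = map (\<lambda>z. row_mult z (vrows s)) (syzs s) @
     map (\<lambda>k. row_mult (W ! k) (vrows s) - single k 1) [0..<length (umin s)]"

text \<open>
  \<open>L\<^sub>1\<close> and \<open>N\<^sub>1\<close>.  Zero rows are dropped, as MinSub takes nonzero elements as input.
\<close>

definition next_stage ::
    "('k::field, 'a::ring_1) pbw_data \<Rightarrow> 'a stage \<Rightarrow> 'a minsub_state \<Rightarrow> 'a vec list \<Rightarrow> 'a stage" where
  "next_stage P X s W = \<lparr>idx = {..<length (umin s)},
     bdeg = (\<lambda>k. hdeg (stageL P X) (umin s ! k)),
     gens = filter (\<lambda>x. x \<noteq> 0) (syzygy_rows s W)\<rparr>"

text \<open>
  \<open>d\<close> rounds (MinSub, then the syzygies of its output) starting from stage \<open>X\<^sub>0\<close>, each performed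
  because the submodule reached so far is nonzero; \<open>r\<close>, \<open>U\<close>, \<open>s\<close>, \<open>W\<close> are the ordering, the input and the output of
  MinSub and the matrix chosen or computed in each round.
\<close>

definition procedures_run ::
    "('k::field, 'a::ring_1) pbw_data \<Rightarrow> 'a stage \<Rightarrow> nat \<Rightarrow> (nat \<Rightarrow> 'a stage) \<Rightarrow>
     (nat \<Rightarrow> fmon \<Rightarrow> fmon \<Rightarrow> bool) \<Rightarrow> (nat \<Rightarrow> 'a vec list) \<Rightarrow> (nat \<Rightarrow> 'a minsub_state) \<Rightarrow>
     (nat \<Rightarrow> 'a vec list) \<Rightarrow> bool" where
  "procedures_run P X\<^sub>0 d X r U s W \<longleftrightarrow> X 0 = X\<^sub>0 \<and>
     (\<forall>i<d. stageN P (X i) \<noteq> {0} \<and>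
        left_monomial_ordering P (idx (X i)) (r i) \<and> minsub_input P (X i) (U i) \<and>
        minsub_output P (X i) (r i) (U i) (s i) \<and> division_matrix P (r i) (s i) (W i) \<and>
        X (Suc i) = next_stage P (X i) (s i) (W i))"

definition stage_map :: "(nat \<Rightarrow> 'a::ring_1 minsub_state) \<Rightarrow> nat \<Rightarrow> 'a vec \<Rightarrow> 'a vec" where
  "stage_map s i h = row_mult h (umin (s (i - 1)))"

end

theory Submission
  imports Defs
begin

text \<open>
  Everything rests on one reduction argument and one comparison of resolutions.

  A list \<open>G\<close> of elements of a free module \<open>L\<close> maps the free module \<open>A\<^sup>G\<close> to \<open>L\<close>.  Schreyer's ordering
  compares monomials of \<open>A\<^sup>G\<close> by the leading monomials of their images, and ties by position.  If the
  leading monomial of the image of \<open>h\<close> is smaller than the largest one occurring among the summands,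
  then that largest one is attained at two positions, and the syzygy of the corresponding pair lowers
  \<open>h\<close>.  As soon as the pairs up to a degree \<open>d\<close> have such syzygies, every element of degree at most
  \<open>d\<close> of the submodule generated by \<open>G\<close> therefore has a representation without cancellation of
  leading terms (\<open>standard_representation\<close>).  This gives Buchberger's criterion; its version truncated
  at a degree; and, applied to the representations of \<open>0\<close>, the fact that the recorded syzygies
  generate the syzygy module.  Up to lower terms of the same degree, monomials multiply as in the
  commutative case (\<open>supp_mult\<close>), which is why the commutative argument applies.

  MinSub works degree by degree.  When the inputs of degree \<open>\<nu>\<close> are tested, the current list is a
  Groebner basis up to that degree of the module generated so far, so an input with nonzero remainder
  is a new generator: no generator kept lies in the span of the earlier ones (\<open>minsub_inv_step\<close>).  A homogeneous
  syzygy of these generators has no constant entry (\<open>homogeneous_syzygy_posv\<close>).  Hence the syzygy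
  module has its entries in the ideal \<open>A\<^sub>+\<close> spanned by the monomials of positive degree, and this is
  what minimality means here.  In the same way MinQuot stops when the relations have entries in
  \<open>A\<^sub>+\<close>.  MinSub terminates by Dickson's lemma, which also makes every left monomial ordering a
  well-ordering, so that division terminates too.

  That no run has more than \<open>n\<close> rounds is the syzygy theorem.  Let the leading monomials of a
  submodule \<open>N\<close> of \<open>L\<close> be generated by monomials without \<open>a\<^sub>1, \<dots>, a\<^sub>k\<close>, and sort a Groebner basis by the exponents
  of \<open>a\<^bsub>k+1\<^esub>\<close>.  Then the leading monomials of its syzygies are generated by monomials without
  \<open>a\<^sub>1, \<dots>, a\<^bsub>k+1\<^esub>\<close> (\<open>syz_avoids\<close>).  Thus, for \<open>n > 0\<close>, \<open>L/N\<close> has some free resolution of length at most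
  \<open>n\<close> (\<open>short_res_nvars\<close>), neither graded nor minimal in general.  It is compared with the chain built
  by the procedures: lifting the identity of \<open>N\<close> back and forth gives a composite homotopic to the identity, and
  where the short resolution has ended the identity itself is null-homotopic
  (\<open>identity_null_homotopic\<close>).  But the maps of the chain have entries in \<open>A\<^sub>+\<close>, so a basis element in
  a position beyond \<open>n\<close> would lie in \<open>A\<^sub>+\<close> times the module (\<open>minimal_chain_length\<close>).
\<close>

section \<open>Coefficients in a solvable polynomial algebra\<close>

locale weighted_solvable =
  fixes P :: "('k::field, 'a::ring_1) pbw_data"
  assumes weighted: "weighted_graded_solvable_algebra P"
begin

lemma solvable: "solvable_polynomial_algebra P"
  using weighted by (simp add: weighted_graded_solvable_algebra_def)

lemma vector_space_smulK: "vector_space (smulK P)"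
  using solvable by (simp add: solvable_polynomial_algebra_def K_algebra_def)

sublocale vs: vector_space "smulK P"
  by (rule vector_space_smulK)

lemma smulK_mult_left: "smulK P c x * y = smulK P c (x * y)"
  and mult_smulK_right: "x * smulK P c y = smulK P c (x * y)"
  using solvable unfolding solvable_polynomial_algebra_def K_algebra_def by metis+

lemma basis_independent: "vs.independent (pbw P ` expos P)"
  and basis_span: "vs.span (pbw P ` expos P) = UNIV"
  and inj_pbw: "inj_on (pbw P) (expos P)"
  using solvable by (simp_all add: solvable_polynomial_algebra_def PBW_basis_def)

lemma coef_add [simp]: "coef P (f + g) \<alpha> = coef P f \<alpha> + coef P g \<alpha>"
  unfolding coef_def by (subst vs.representation_add) (simp_all add: basis_independent basis_span)

lemma coef_diff [simp]: "coef P (f - g) \<alpha> = coef P f \<alpha> - coef P g \<alpha>"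
  unfolding coef_def by (subst vs.representation_diff) (simp_all add: basis_independent basis_span)

lemma coef_uminus [simp]: "coef P (- f) \<alpha> = - coef P f \<alpha>"
  unfolding coef_def by (subst vs.representation_neg) (simp_all add: basis_independent basis_span)

lemma coef_0 [simp]: "coef P 0 \<alpha> = 0"
  unfolding coef_def by (simp add: vs.representation_zero)

lemma coef_smulK [simp]: "coef P (smulK P c f) \<alpha> = c * coef P f \<alpha>"
  unfolding coef_def by (subst vs.representation_scale) (simp_all add: basis_independent basis_span)

lemma coef_sum: "coef P (sum f I) \<alpha> = (\<Sum>i\<in>I. coef P (f i) \<alpha>)"
  by (induction I rule: infinite_finite_induct) auto

lemma coef_pbw: "\<alpha> \<in> expos P \<Longrightarrow> \<beta> \<in> expos P \<Longrightarrow> coef P (pbw P \<alpha>) \<beta> = (if \<alpha> = \<beta> then 1 else 0)"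
  unfolding coef_def
  by (subst vs.representation_basis) (auto simp: basis_independent inj_on_eq_iff[OF inj_pbw])

definition supp :: "'a \<Rightarrow> expo set" where
  "supp f = {\<alpha> \<in> expos P. coef P f \<alpha> \<noteq> 0}"

lemma suppD: "\<alpha> \<in> supp f \<Longrightarrow> \<alpha> \<in> expos P" "\<alpha> \<in> supp f \<Longrightarrow> coef P f \<alpha> \<noteq> 0"
  by (simp_all add: supp_def)

lemma finite_supp: "finite (supp f)"
proof -
  have "pbw P ` supp f \<subseteq> {b. vs.representation (pbw P ` expos P) f b \<noteq> 0}"
    by (auto simp: supp_def coef_def)
  then have "finite (pbw P ` supp f)"
    using vs.finite_representation finite_subset by blast
  moreover have "inj_on (pbw P) (supp f)"
    using inj_pbw by (rule inj_on_subset) (auto simp: supp_def)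
  ultimately show ?thesis
    by (rule finite_imageD)
qed

lemma expansion: "f = (\<Sum>\<alpha>\<in>supp f. smulK P (coef P f \<alpha>) (pbw P \<alpha>))"
proof -
  have "{b. vs.representation (pbw P ` expos P) f b \<noteq> 0} = pbw P ` supp f"
    using vs.representation_ne_zero[of "pbw P ` expos P" f]
    by (fastforce simp: supp_def coef_def)
  then have "f = (\<Sum>b\<in>pbw P ` supp f. smulK P (vs.representation (pbw P ` expos P) f b) b)"
    using vs.sum_nonzero_representation_eq[OF basis_independent, of f] by (simp add: basis_span)
  also have "\<dots> = (\<Sum>\<alpha>\<in>supp f. smulK P (coef P f \<alpha>) (pbw P \<alpha>))"
    by (subst sum.reindex)
      (auto simp: coef_def intro: inj_on_subset[OF inj_pbw] dest: suppD)
  finally show ?thesis .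
qed

lemma supp_empty_iff: "supp f = {} \<longleftrightarrow> f = 0"
proof
  assume "supp f = {}"
  then show "f = 0" using expansion[of f] by simp
qed (simp add: supp_def)

lemma supp_0 [simp]: "supp 0 = {}"
  by (simp add: supp_def)

lemma coef_eqI: "(\<And>\<alpha>. \<alpha> \<in> expos P \<Longrightarrow> coef P f \<alpha> = coef P g \<alpha>) \<Longrightarrow> f = g"
  using supp_empty_iff[of "f - g"] by (auto simp: supp_def)

lemma supp_add: "supp (f + g) \<subseteq> supp f \<union> supp g"
  by (auto simp: supp_def)

lemma supp_smulK_subset: "supp (smulK P c f) \<subseteq> supp f"
  by (auto simp: supp_def)

lemma supp_smulK: "c \<noteq> 0 \<Longrightarrow> supp (smulK P c f) = supp f"
  by (auto simp: supp_def)

lemma supp_pbw: "\<alpha> \<in> expos P \<Longrightarrow> supp (pbw P \<alpha>) = {\<alpha>}"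
  by (auto simp: supp_def coef_pbw split: if_splits)

lemma zero_expos [simp]: "0 \<in> expos P"
  and plus_expos: "\<alpha> \<in> expos P \<Longrightarrow> \<beta> \<in> expos P \<Longrightarrow> \<alpha> + \<beta> \<in> expos P"
  and minus_expos: "\<alpha> \<in> expos P \<Longrightarrow> \<alpha> - \<beta> \<in> expos P"
  by (auto simp: expos_def)

lemma max_expos: "\<alpha> \<in> expos P \<Longrightarrow> \<beta> \<in> expos P \<Longrightarrow> (\<lambda>k. max (\<alpha> k) (\<beta> k)) \<in> expos P"
  by (auto simp: expos_def)

lemma pbw_0 [simp]: "pbw P 0 = 1"
proof -
  have "prod_list (map (\<lambda>i. gen P i ^ (0::expo) i) xs) = 1" for xs
    by (induction xs) auto
  then show ?thesis unfolding pbw_def .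
qed

lemma coef_1: "\<alpha> \<in> expos P \<Longrightarrow> coef P 1 \<alpha> = (if \<alpha> = 0 then 1 else 0)"
  using coef_pbw[of 0 \<alpha>] by auto

lemma supp_1: "supp 1 = {0}"
  using supp_pbw[of 0] by simp


subsection \<open>The monomial ordering and the degree\<close>

lemma order_props: "strict_total_order_on (expos P) (mless P)" "wfp_on (expos P) (mless P)"
  using solvable by (simp_all add: solvable_polynomial_algebra_def monomial_ordering_def)

lemma mless_irrefl: "\<alpha> \<in> expos P \<Longrightarrow> \<not> mless P \<alpha> \<alpha>"
  using order_props(1) by (auto simp: strict_total_order_on_def irreflp_on_def)

lemma mless_trans:
  "mless P \<alpha> \<beta> \<Longrightarrow> mless P \<beta> \<gamma> \<Longrightarrow> \<alpha> \<in> expos P \<Longrightarrow> \<beta> \<in> expos P \<Longrightarrow> \<gamma> \<in> expos P \<Longrightarrow> mless P \<alpha> \<gamma>"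
  using order_props(1) unfolding strict_total_order_on_def transp_on_def by blast

lemma mless_total: "\<alpha> \<in> expos P \<Longrightarrow> \<beta> \<in> expos P \<Longrightarrow> \<alpha> = \<beta> \<or> mless P \<alpha> \<beta> \<or> mless P \<beta> \<alpha>"
  using order_props(1) unfolding strict_total_order_on_def totalp_on_def by blast

end

text \<open>The definite description of the greatest element denotes, as the set is finite and nonempty.\<close>

lemma greatest_wrt_props:
  assumes "strict_total_order_on B r" "S \<subseteq> B" "finite S" "S \<noteq> {}"
  shows "greatest_wrt r S \<in> S" "\<And>m. m \<in> S \<Longrightarrow> m \<noteq> greatest_wrt r S \<Longrightarrow> r m (greatest_wrt r S)"
proof -
  have tr: "\<And>x y z. x \<in> B \<Longrightarrow> y \<in> B \<Longrightarrow> z \<in> B \<Longrightarrow> r x y \<Longrightarrow> r y z \<Longrightarrow> r x z"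
    and ir: "\<And>x. x \<in> B \<Longrightarrow> \<not> r x x"
    and tot: "\<And>x y. x \<in> B \<Longrightarrow> y \<in> B \<Longrightarrow> x \<noteq> y \<Longrightarrow> r x y \<or> r y x"
    using assms(1) unfolding strict_total_order_on_def transp_on_def irreflp_on_def totalp_on_def
    by blast+
  have "\<exists>m\<in>S. \<forall>m'\<in>S. m' \<noteq> m \<longrightarrow> r m' m"
    using assms(3,4,2)
  proof (induction S rule: finite_ne_induct)
    case (insert x F)
    then obtain m where m: "m \<in> F" "\<forall>m'\<in>F. m' \<noteq> m \<longrightarrow> r m' m" by auto
    show ?case
    proof (cases "r m x")
      case True
      then have "\<forall>m'\<in>insert x F. m' \<noteq> x \<longrightarrow> r m' x"
        using m insert.prems tr by (metis insert_iff subset_iff)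
      then show ?thesis by blast
    next
      case False
      then have "r x m" using tot[of x m] m insert by auto
      then show ?thesis using m by auto
    qed
  qed auto
  then obtain m where m: "m \<in> S" "\<forall>m'\<in>S. m' \<noteq> m \<longrightarrow> r m' m" by auto
  have uniq: "x = m" if "x \<in> S" "\<forall>m'\<in>S. m' \<noteq> x \<longrightarrow> r m' x" for x
    using that m assms(2) tr[of m x m] ir[of m] by (metis subsetD)
  have "greatest_wrt r S = m"
    unfolding greatest_wrt_def
  proof (rule the_equality)
    show "m \<in> S \<and> (\<forall>m'\<in>S. m' \<noteq> m \<longrightarrow> r m' m)" using m by blast
  qed (use uniq in blast)
  then show "greatest_wrt r S \<in> S" "\<And>m. m \<in> S \<Longrightarrow> m \<noteq> greatest_wrt r S \<Longrightarrow> r m (greatest_wrt r S)"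
    using m by auto
qed

lemma greatest_wrt_eqI:
  assumes "strict_total_order_on B r" "S \<subseteq> B" "finite S"
    "m \<in> S" "\<And>m'. m' \<in> S \<Longrightarrow> m' \<noteq> m \<Longrightarrow> r m' m"
  shows "greatest_wrt r S = m"
proof (rule ccontr)
  assume ne: "greatest_wrt r S \<noteq> m"
  have *: "greatest_wrt r S \<in> S" "r m (greatest_wrt r S)"
    using greatest_wrt_props[OF assms(1-3)] assms(4) ne by auto
  then have "r (greatest_wrt r S) m" using assms(5) ne by blast
  then have "r m m"
    using * assms(1,2,4) unfolding strict_total_order_on_def transp_on_def by blast
  then show False
    using assms(1,2,4) unfolding strict_total_order_on_def irreflp_on_def by blast
qed

context weighted_solvable
begin

lemma LMA_eqI:
  "\<alpha> \<in> supp f \<Longrightarrow> (\<And>\<beta>. \<beta> \<in> supp f \<Longrightarrow> \<beta> \<noteq> \<alpha> \<Longrightarrow> mless P \<beta> \<alpha>) \<Longrightarrow> LMA P f = \<alpha>"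
  unfolding LMA_def
  by (rule greatest_wrt_eqI[OF order_props(1)]) (auto simp: supp_def[symmetric] finite_supp dest: suppD)

lemma LMA_props:
  assumes "f \<noteq> 0"
  shows "LMA P f \<in> supp f" "\<And>\<beta>. \<beta> \<in> supp f \<Longrightarrow> \<beta> \<noteq> LMA P f \<Longrightarrow> mless P \<beta> (LMA P f)"
  unfolding LMA_def supp_def[symmetric]
  using greatest_wrt_props[OF order_props(1), of "supp f"] assms
  by (auto simp: finite_supp supp_empty_iff dest: suppD)

lemma deg_add [simp]: "deg P (\<alpha> + \<beta>) = deg P \<alpha> + deg P \<beta>"
  by (simp add: deg_def sum.distrib algebra_simps)

lemma deg_0 [simp]: "deg P 0 = 0"
  by (simp add: deg_def)

lemma deg_eq_0: "\<alpha> \<in> expos P \<Longrightarrow> deg P \<alpha> = 0 \<Longrightarrow> \<alpha> = 0"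
proof
  fix k assume *: "\<alpha> \<in> expos P" "deg P \<alpha> = 0"
  have "\<forall>i<nvars P. wt P i > 0"
    using weighted by (simp add: weighted_graded_solvable_algebra_def)
  with * show "\<alpha> k = 0 k"
    by (cases "k < nvars P") (force simp: deg_def expos_def)+
qed

lemma gradeA_iff: "f \<in> gradeA P p \<longleftrightarrow> (\<forall>\<alpha>\<in>supp f. deg P \<alpha> = p)"
proof
  assume "f \<in> gradeA P p"
  then show "\<forall>\<alpha>\<in>supp f. deg P \<alpha> = p"
    unfolding gradeA_def
  proof (induction rule: vs.span_induct_alt)
    case (step c x y)
    then obtain \<alpha> where "x = pbw P \<alpha>" "\<alpha> \<in> expos P" "deg P \<alpha> = p" by blast
    then show ?case
      using step supp_add[of "smulK P c x" y] supp_smulK_subset[of c x] supp_pbw[of \<alpha>] by auto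
  qed simp
next
  assume *: "\<forall>\<alpha>\<in>supp f. deg P \<alpha> = p"
  have "(\<Sum>\<alpha>\<in>supp f. smulK P (coef P f \<alpha>) (pbw P \<alpha>)) \<in> gradeA P p"
    unfolding gradeA_def
    by (intro vs.span_sum vs.span_scale vs.span_base) (use * in \<open>auto dest: suppD\<close>)
  then show "f \<in> gradeA P p" using expansion[of f] by simp
qed

lemma monomial_product:
  assumes "\<alpha> \<in> expos P" "\<beta> \<in> expos P"
  shows "\<alpha> + \<beta> \<in> supp (pbw P \<alpha> * pbw P \<beta>)"
    and "\<gamma> \<in> supp (pbw P \<alpha> * pbw P \<beta>) \<Longrightarrow> \<gamma> = \<alpha> + \<beta> \<or> mless P \<gamma> (\<alpha> + \<beta>)"
    and "\<gamma> \<in> supp (pbw P \<alpha> * pbw P \<beta>) \<Longrightarrow> deg P \<gamma> = deg P \<alpha> + deg P \<beta>"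
proof -
  from solvable assms obtain l f where lf: "l \<noteq> 0"
      "pbw P \<alpha> * pbw P \<beta> = smulK P l (pbw P (\<alpha> + \<beta>)) + f"
      "f = 0 \<or> mless P (LMA P f) (\<alpha> + \<beta>)"
    unfolding solvable_polynomial_algebra_def by blast
  have ab: "\<alpha> + \<beta> \<in> expos P" using assms by (rule plus_expos)
  have f: "mless P \<gamma> (\<alpha> + \<beta>)" if "\<gamma> \<in> supp f" for \<gamma>
  proof -
    have "f \<noteq> 0" using that by auto
    then show ?thesis
      using lf(3) LMA_props[of f] that ab mless_trans suppD by metis
  qed
  have "\<alpha> + \<beta> \<notin> supp f" using f mless_irrefl ab by blast
  then have "coef P (pbw P \<alpha> * pbw P \<beta>) (\<alpha> + \<beta>) = l"
    using lf ab by (simp add: coef_pbw supp_def)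
  then show "\<alpha> + \<beta> \<in> supp (pbw P \<alpha> * pbw P \<beta>)"
    using lf(1) ab by (simp add: supp_def)
  show "\<gamma> \<in> supp (pbw P \<alpha> * pbw P \<beta>) \<Longrightarrow> \<gamma> = \<alpha> + \<beta> \<or> mless P \<gamma> (\<alpha> + \<beta>)"
    using f[of \<gamma>] lf(2) supp_add[of "smulK P l (pbw P (\<alpha> + \<beta>))" f]
      supp_smulK_subset[of l "pbw P (\<alpha> + \<beta>)"] supp_pbw[OF ab]
    by auto
  have "pbw P \<alpha> * pbw P \<beta> \<in> gradeA P (deg P \<alpha> + deg P \<beta>)"
    using weighted assms unfolding weighted_graded_solvable_algebra_def
    by (metis (no_types, lifting) gradeA_iff supp_pbw singletonD)
  then show "\<gamma> \<in> supp (pbw P \<alpha> * pbw P \<beta>) \<Longrightarrow> deg P \<gamma> = deg P \<alpha> + deg P \<beta>"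
    by (auto simp: gradeA_iff)
qed

lemma LMA_monomial_product:
  "\<alpha> \<in> expos P \<Longrightarrow> \<beta> \<in> expos P \<Longrightarrow> LMA P (pbw P \<alpha> * pbw P \<beta>) = \<alpha> + \<beta>"
  using monomial_product[of \<alpha> \<beta>] by (intro LMA_eqI) blast+

lemma monomial_product_nz:
  "\<alpha> \<in> expos P \<Longrightarrow> \<beta> \<in> expos P \<Longrightarrow> pbw P \<alpha> * pbw P \<beta> \<noteq> 0"
  using monomial_product(1) by force

text \<open>The axiom that a product is larger than its middle factor, with middle factor \<open>1\<close>.\<close>

lemma mless_0: assumes "\<alpha> \<in> expos P" "\<alpha> \<noteq> 0" shows "mless P 0 \<alpha>"
proof -
  have "\<forall>\<alpha>\<in>expos P. \<forall>\<beta>\<in>expos P. \<forall>\<gamma>\<in>expos P. \<forall>\<eta>\<in>expos P.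
        let x = pbw P \<alpha> * pbw P \<beta> * pbw P \<eta> in
        \<beta> \<noteq> \<gamma> \<longrightarrow> x \<noteq> 0 \<longrightarrow> \<gamma> = LMA P x \<longrightarrow> mless P \<beta> \<gamma>"
    using solvable by (simp add: solvable_polynomial_algebra_def monomial_ordering_def)
  from this[rule_format, of \<alpha> 0 \<alpha> 0] show ?thesis
    using assms monomial_product_nz[of \<alpha> 0] LMA_monomial_product[of \<alpha> 0] by (simp add: Let_def)
qed

lemma pbw_constant_iff: assumes "\<alpha> \<in> expos P" shows "pbw P \<alpha> \<in> constants P \<longleftrightarrow> \<alpha> = 0"
proof
  assume "pbw P \<alpha> \<in> constants P"
  then obtain c where "pbw P \<alpha> = smulK P c 1" by (auto simp: constants_def)
  then have "{\<alpha>} \<subseteq> {0}" using supp_pbw[OF assms] supp_smulK_subset[of c 1] supp_1 by simp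
  then show "\<alpha> = 0" by simp
qed (auto simp: constants_def intro: range_eqI[of _ _ 1])

text \<open>The ordering axiom excludes products with a constant leading monomial; those cases are
  settled by the minimality of \<open>0\<close>.\<close>

lemma mless_add_left:
  assumes "mless P \<alpha> \<beta>" "\<alpha> \<in> expos P" "\<beta> \<in> expos P" "\<gamma> \<in> expos P"
  shows "mless P (\<gamma> + \<alpha>) (\<gamma> + \<beta>)"
proof -
  have b0: "\<beta> \<noteq> 0"
    using assms mless_0[of \<alpha>] mless_irrefl[of \<alpha>] mless_trans[of \<alpha> 0 \<alpha>] by force
  then have gb0: "\<gamma> + \<beta> \<noteq> 0" by (auto simp: fun_eq_iff)
  show ?thesis
  proof (cases "\<gamma> + \<alpha> = 0")
    case True
    then show ?thesis using mless_0[OF _ gb0] assms plus_expos by simp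
  next
    case False
    have "\<forall>\<alpha>\<in>expos P. \<forall>\<beta>\<in>expos P. \<forall>\<gamma>\<in>expos P. \<forall>\<eta>\<in>expos P.
        let x = pbw P \<gamma> * pbw P \<alpha> * pbw P \<eta>; y = pbw P \<gamma> * pbw P \<beta> * pbw P \<eta> in
        mless P \<alpha> \<beta> \<longrightarrow> x \<noteq> 0 \<longrightarrow> y \<noteq> 0 \<longrightarrow>
        pbw P (LMA P x) \<notin> constants P \<longrightarrow> pbw P (LMA P y) \<notin> constants P \<longrightarrow>
        mless P (LMA P x) (LMA P y)"
      using solvable by (simp add: solvable_polynomial_algebra_def monomial_ordering_def)
    from this[rule_format, of \<alpha> \<beta> \<gamma> 0] show ?thesis
      using assms gb0 False monomial_product_nz LMA_monomial_product pbw_constant_iff plus_expos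
      by (simp add: Let_def)
  qed
qed

lemma coef_mult:
  "coef P (f * g) \<gamma> = (\<Sum>\<alpha>\<in>supp f. \<Sum>\<beta>\<in>supp g. coef P f \<alpha> * (coef P g \<beta> * coef P (pbw P \<alpha> * pbw P \<beta>) \<gamma>))"
proof -
  have "f * g = (\<Sum>\<alpha>\<in>supp f. smulK P (coef P f \<alpha>) (pbw P \<alpha>)) * (\<Sum>\<beta>\<in>supp g. smulK P (coef P g \<beta>) (pbw P \<beta>))"
    using expansion[of f] expansion[of g] by simp
  also have "\<dots> = (\<Sum>\<alpha>\<in>supp f. \<Sum>\<beta>\<in>supp g. smulK P (coef P f \<alpha>) (smulK P (coef P g \<beta>) (pbw P \<alpha> * pbw P \<beta>)))"
    unfolding sum_product by (simp add: smulK_mult_left mult_smulK_right mult.commute)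
  finally show ?thesis by (simp add: coef_sum mult.assoc)
qed

text \<open>Every monomial of a product is, up to lower terms of the same degree, a product of monomials of
  the factors: this one fact gives both the estimates of leading monomials and the degrees.\<close>

lemma supp_mult:
  assumes "\<gamma> \<in> supp (f * g)"
  obtains \<alpha> \<beta> where "\<alpha> \<in> supp f" "\<beta> \<in> supp g" "deg P \<gamma> = deg P \<alpha> + deg P \<beta>"
    "\<gamma> = \<alpha> + \<beta> \<or> mless P \<gamma> (\<alpha> + \<beta>)"
proof -
  have "coef P (f * g) \<gamma> \<noteq> 0" "\<gamma> \<in> expos P" using assms suppD by auto
  then obtain \<alpha> \<beta> where *: "\<alpha> \<in> supp f" "\<beta> \<in> supp g" "coef P (pbw P \<alpha> * pbw P \<beta>) \<gamma> \<noteq> 0"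
    using coef_mult[of f g \<gamma>] by (metis (no_types, lifting) sum.neutral mult_zero_right)
  then have "\<gamma> \<in> supp (pbw P \<alpha> * pbw P \<beta>)" using \<open>\<gamma> \<in> expos P\<close> by (simp add: supp_def)
  with * show ?thesis using that monomial_product suppD by metis
qed

text \<open>By compatibility of the ordering, the products of \<open>a\<^sup>\<gamma>\<close> with the lower monomials of \<open>g\<close> stay
  strictly below \<open>a\<^bsup>\<gamma> + \<alpha>\<^esup>\<close>.\<close>

lemma coef_monomial_mult_top:
  assumes "\<gamma> \<in> expos P" "\<alpha> \<in> expos P" "\<And>\<beta>. \<beta> \<in> supp g \<Longrightarrow> \<beta> \<noteq> \<alpha> \<Longrightarrow> mless P \<beta> \<alpha>"
  shows "coef P (pbw P \<gamma> * g) (\<gamma> + \<alpha>) = coef P g \<alpha> * coef P (pbw P \<gamma> * pbw P \<alpha>) (\<gamma> + \<alpha>)"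
proof -
  have ga: "\<gamma> + \<alpha> \<in> expos P" using assms plus_expos by simp
  have z: "coef P (pbw P \<gamma> * pbw P \<beta>) (\<gamma> + \<alpha>) = 0" if "\<beta> \<in> supp g" "\<beta> \<noteq> \<alpha>" for \<beta>
  proof (rule ccontr)
    assume "\<not> ?thesis"
    then have "\<gamma> + \<alpha> \<in> supp (pbw P \<gamma> * pbw P \<beta>)" using ga by (simp add: supp_def)
    moreover have lt: "mless P (\<gamma> + \<beta>) (\<gamma> + \<alpha>)" "\<gamma> + \<beta> \<in> expos P"
      using mless_add_left[OF assms(3)[OF that]] plus_expos assms(1,2) suppD(1)[OF that(1)]
      by blast+
    ultimately have "\<gamma> + \<alpha> = \<gamma> + \<beta> \<or> mless P (\<gamma> + \<alpha>) (\<gamma> + \<beta>)"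
      using monomial_product(2)[of \<gamma> \<beta> "\<gamma> + \<alpha>"] assms(1) suppD(1)[OF that(1)] by blast
    then show False
      using lt(1) mless_irrefl[OF ga] mless_trans[OF _ lt(1) ga lt(2) ga] by metis
  qed
  have "coef P (pbw P \<gamma> * g) (\<gamma> + \<alpha>)
      = (\<Sum>\<beta>\<in>supp g. coef P g \<beta> * coef P (pbw P \<gamma> * pbw P \<beta>) (\<gamma> + \<alpha>))"
    using coef_mult[of "pbw P \<gamma>" g] assms(1) by (simp add: supp_pbw coef_pbw)
  also have "\<dots> = (\<Sum>\<beta>\<in>supp g. if \<beta> = \<alpha> then coef P g \<alpha> * coef P (pbw P \<gamma> * pbw P \<alpha>) (\<gamma> + \<alpha>) else 0)"
    by (rule sum.cong) (auto simp: z)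
  also have "\<dots> = coef P g \<alpha> * coef P (pbw P \<gamma> * pbw P \<alpha>) (\<gamma> + \<alpha>)"
    using finite_supp[of g] assms(2) by (auto simp: supp_def)
  finally show ?thesis .
qed

text \<open>The constant coefficient is multiplicative, so \<open>{f. coef P f 0 = 0}\<close> is the two-sided ideal
  \<open>A\<^sub>+\<close> of elements of positive degree.\<close>

lemma coef_mult_0: "coef P (f * g) 0 = coef P f 0 * coef P g 0"
proof -
  define f' where "f' = f - smulK P (coef P f 0) 1"
  have "0 \<notin> supp (f' * g)"
  proof
    assume "0 \<in> supp (f' * g)"
    then obtain \<alpha> where "\<alpha> \<in> supp f'" "deg P \<alpha> = 0" by (rule supp_mult) auto
    then have "0 \<in> supp f'" using deg_eq_0 suppD by metis
    then show False by (simp add: supp_def f'_def coef_1)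
  qed
  then have "coef P (f' * g) 0 = 0" by (simp add: supp_def)
  moreover have "f' * g = f * g - smulK P (coef P f 0) g"
    by (simp add: f'_def left_diff_distrib smulK_mult_left)
  ultimately show ?thesis by simp
qed

lemma constant_eq: "supp f \<subseteq> {0} \<Longrightarrow> f = smulK P (coef P f 0) 1"
  by (rule coef_eqI) (auto simp: supp_def coef_1)

lemma in_units_K_iff: "f \<in> units_K P \<longleftrightarrow> supp f = {0}"
proof
  assume "f \<in> units_K P"
  then show "supp f = {0}" by (auto simp: units_K_def supp_smulK supp_1)
next
  assume "supp f = {0}"
  then have "coef P f 0 \<noteq> 0" by (auto simp: supp_def)
  moreover have "f = smulK P (coef P f 0) 1"
    by (rule constant_eq) (use \<open>supp f = {0}\<close> in simp)
  ultimately show "f \<in> units_K P"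
    unfolding units_K_def by blast
qed

end

section \<open>Rows, matrices and free modules\<close>

text \<open>Vectors are handled as elements of modules; their entries are exposed on demand only.\<close>

declare plus_fun_apply [simp del] zero_fun_apply [simp del]

lemmas vec_apply = plus_fun_apply zero_fun_apply

lemma sum_fun_apply: "(sum f I) i = (\<Sum>k\<in>I. f k i)"
  by (induction I rule: infinite_finite_induct) (auto simp: vec_apply)


lemma single_same [simp]: "single i r i = r"
  by (simp add: single_def)

lemma single_0 [simp]: "single i 0 = 0"
  by (simp add: single_def fun_eq_iff vec_apply)

lemma lmul_apply: "lmul r x i = r * x i"
  by (simp add: lmul_def)

lemma lmul_simps:
  fixes r s :: "'a::ring_1"
  shows "lmul r (x + y) = lmul r x + lmul r y" "lmul r (x - y) = lmul r x - lmul r y"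
    "lmul (r + s) x = lmul r x + lmul s x" "lmul (r - s) x = lmul r x - lmul s x"
    "lmul r (lmul s x) = lmul (r * s) x" "lmul r 0 = 0" "lmul 0 x = 0" "lmul 1 x = x"
    "lmul (- 1) x = - x" "lmul r (single i s) = single i (r * s)"
  by (auto simp: fun_eq_iff lmul_def single_def algebra_simps vec_apply)

lemma lmul_sum: "lmul (r::'a::ring_1) (sum f I) = (\<Sum>k\<in>I. lmul r (f k))"
  by (induction I rule: infinite_finite_induct) (simp_all add: lmul_simps)

lemma row_mult_apply: "row_mult h V i = (\<Sum>k<length V. h k * (V ! k) i)"
  by (simp add: row_mult_def sum_fun_apply lmul_apply)

lemma row_mult_cong: "(\<And>k. k < length V \<Longrightarrow> h k = h' k) \<Longrightarrow> row_mult h V = row_mult h' V"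
  by (simp add: row_mult_def)

lemma row_mult_add: "row_mult (h + h') V = row_mult h V + row_mult h' V"
  and row_mult_diff: "row_mult (h - h') V = row_mult h V - row_mult h' V"
  and row_mult_lmul: "row_mult (lmul r h) V = lmul r (row_mult h V)"
  and row_mult_0 [simp]: "row_mult 0 V = 0"
  by (simp_all add: row_mult_def lmul_simps lmul_sum sum.distrib sum_subtractf vec_apply lmul_apply)

lemma row_mult_Nil [simp]: "row_mult h [] = 0"
  by (simp add: row_mult_def)

lemma row_mult_single:
  "row_mult (single k c) V = (if k < length V then lmul c (V ! k) else (0 :: 'a::ring_1 vec))"
proof -
  have "row_mult (single k c) V = (\<Sum>l<length V. if l = k then lmul c (V ! k) else 0)"
    unfolding row_mult_def by (rule sum.cong) (auto simp: single_def lmul_simps)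
  then show ?thesis by simp
qed

lemma row_mult_append1: "row_mult h (V @ [w]) = row_mult h V + lmul (h (length V)) w"
  by (simp add: row_mult_def nth_append)

lemma row_mult_append: "row_mult h (V @ W) = row_mult h V + row_mult (\<lambda>k. h (length V + k)) W"
proof (induction W rule: rev_induct)
  case (snoc w W)
  have "row_mult h (V @ W @ [w]) = row_mult h (V @ W) + lmul (h (length (V @ W))) w"
    using row_mult_append1[of h "V @ W" w] by simp
  then show ?case using snoc by (simp add: row_mult_append1 add.assoc)
qed simp

lemma row_mult_assoc:
  fixes h :: "'a::ring_1 vec"
  shows "row_mult (row_mult h W) V = row_mult h (map (\<lambda>w. row_mult w V) W)"
proof
  fix i
  have "row_mult (row_mult h W) V i = (\<Sum>k<length V. \<Sum>l<length W. h l * (W ! l) k * (V ! k) i)"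
    by (simp add: row_mult_apply sum_distrib_right)
  also have "\<dots> = (\<Sum>l<length W. \<Sum>k<length V. h l * (W ! l) k * (V ! k) i)"
    by (rule sum.swap)
  also have "\<dots> = row_mult h (map (\<lambda>w. row_mult w V) W) i"
    by (simp add: row_mult_apply sum_distrib_left mult.assoc)
  finally show "row_mult (row_mult h W) V i = row_mult h (map (\<lambda>w. row_mult w V) W) i" .
qed

definition fcar :: "nat set \<Rightarrow> 'a::zero vec set" where
  "fcar E = {x. \<forall>i. i \<notin> E \<longrightarrow> x i = 0}"

lemma fcarD: "x \<in> fcar E \<Longrightarrow> i \<notin> E \<Longrightarrow> x i = 0"
  by (simp add: fcar_def)

lemma fcar_closed [simp]:
  fixes x y :: "'a::ring_1 vec"
  shows "0 \<in> fcar E" "x \<in> fcar E \<Longrightarrow> y \<in> fcar E \<Longrightarrow> x + y \<in> fcar E"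
    "x \<in> fcar E \<Longrightarrow> y \<in> fcar E \<Longrightarrow> x - y \<in> fcar E" "x \<in> fcar E \<Longrightarrow> - x \<in> fcar E"
    "x \<in> fcar E \<Longrightarrow> lmul r x \<in> fcar E"
  by (auto simp: fcar_def vec_apply lmul_apply)

lemma fcar_single: "i \<in> E \<Longrightarrow> single i r \<in> fcar E"
  by (auto simp: fcar_def single_def)

lemma fcar_mono: "E \<subseteq> E' \<Longrightarrow> fcar E \<subseteq> fcar E'"
  by (auto simp: fcar_def)

lemma fcar_row_mult: "set V \<subseteq> fcar E \<Longrightarrow> row_mult h V \<in> fcar E"
  by (auto simp: fcar_def row_mult_apply intro!: sum.neutral dest!: nth_mem)

text \<open>\<open>row_mult h V\<close> reads the first \<open>length V\<close> entries of \<open>h\<close>; cutting off the others turns any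
  \<open>h\<close> into an element of the free module on the rows of \<open>V\<close>.\<close>

definition trunc :: "nat \<Rightarrow> 'a::zero vec \<Rightarrow> 'a vec" where
  "trunc m h = (\<lambda>k. if k < m then h k else 0)"

lemma trunc_fcar [simp]: "trunc m h \<in> fcar {..<m}"
  by (simp add: trunc_def fcar_def)

lemma row_mult_trunc [simp]: "row_mult (trunc (length V) h) V = row_mult h V"
  by (rule row_mult_cong) (simp add: trunc_def)

lemma fcar_expansion:
  fixes x :: "'a::ring_1 vec"
  assumes "finite E" "x \<in> fcar E"
  shows "x = (\<Sum>i\<in>E. single i (x i))"
proof
  fix j
  have "(\<Sum>i\<in>E. single i (x i)) j = (\<Sum>i\<in>E. if i = j then x j else 0)"
    unfolding sum_fun_apply by (rule sum.cong) (auto simp: single_def)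
  then show "x j = (\<Sum>i\<in>E. single i (x i)) j"
    using assms by (auto simp: fcarD)
qed

lemma syz_iff: "h \<in> syz V \<longleftrightarrow> h \<in> fcar {..<length V} \<and> row_mult h V = 0"
  by (auto simp: syz_def fcar_def not_less)

definition closed_submodule :: "'a::ring_1 vec set \<Rightarrow> bool" where
  "closed_submodule H \<longleftrightarrow> 0 \<in> H \<and> (\<forall>x\<in>H. \<forall>y\<in>H. x + y \<in> H) \<and> (\<forall>r. \<forall>x\<in>H. lmul r x \<in> H)"

lemma closed_submoduleD:
  assumes "closed_submodule H"
  shows "0 \<in> H" "x \<in> H \<Longrightarrow> y \<in> H \<Longrightarrow> x + y \<in> H" "x \<in> H \<Longrightarrow> lmul r x \<in> H"
    "x \<in> H \<Longrightarrow> y \<in> H \<Longrightarrow> x - y \<in> H"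
proof -
  show *: "0 \<in> H" "\<And>x y. x \<in> H \<Longrightarrow> y \<in> H \<Longrightarrow> x + y \<in> H" "\<And>r x. x \<in> H \<Longrightarrow> lmul r x \<in> H"
    using assms by (auto simp: closed_submodule_def)
  show "x - y \<in> H" if "x \<in> H" "y \<in> H"
    using *(2)[OF that(1) *(3)[OF that(2), of "- 1"]] by (simp add: lmul_simps)
qed

lemma closed_submodule_sum:
  "closed_submodule H \<Longrightarrow> (\<And>i. i \<in> I \<Longrightarrow> f i \<in> H) \<Longrightarrow> sum f I \<in> H"
  by (induction I rule: infinite_finite_induct) (auto simp: closed_submoduleD)

lemma closed_submodule_row_mult:
  "closed_submodule H \<Longrightarrow> set V \<subseteq> H \<Longrightarrow> row_mult h V \<in> H"
  unfolding row_mult_def by (rule closed_submodule_sum) (auto intro!: closed_submoduleD(3))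

abbreviation row_space :: "'a::ring_1 vec list \<Rightarrow> 'a vec set" where
  "row_space V \<equiv> range (\<lambda>h. row_mult h V)"

lemma closed_submodule_row_space: "closed_submodule (row_space V)"
  unfolding closed_submodule_def
proof (intro conjI ballI allI)
  show "0 \<in> row_space V" by (rule range_eqI[of _ _ 0]) simp
qed (auto simp: row_mult_add[symmetric] row_mult_lmul[symmetric])

lemma row_space_member: "v \<in> set V \<Longrightarrow> v \<in> row_space V"
proof -
  assume "v \<in> set V"
  then obtain k where "k < length V" "v = V ! k" by (metis in_set_conv_nth)
  then have "v = row_mult (single k 1) V" by (simp add: row_mult_single lmul_simps)
  then show ?thesis by blast
qed

lemma row_space_subset:
  "set W \<subseteq> row_space V \<Longrightarrow> row_space W \<subseteq> row_space V"
  using closed_submodule_row_mult[OF closed_submodule_row_space] by blast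

lemma closed_submodule_syz: "closed_submodule (syz V)"
  by (auto simp: closed_submodule_def syz_iff row_mult_add row_mult_lmul lmul_simps)

lemma closed_submodule_fcar: "closed_submodule (fcar E)"
  by (simp add: closed_submodule_def)

subsection \<open>The record of a free module\<close>

lemma carrier_free_mod [simp]: "carrier (free_mod P E b) = fcar E"
  and add_free_mod [simp]: "x \<oplus>\<^bsub>free_mod P E b\<^esub> y = x + y"
  and zero_free_mod [simp]: "\<zero>\<^bsub>free_mod P E b\<^esub> = 0"
  and smult_free_mod [simp]: "r \<odot>\<^bsub>free_mod P E b\<^esub> x = lmul r x"
  by (simp_all add: free_mod_def fcar_def)

lemma a_inv_free_mod:
  fixes x :: "'a::ring_1 vec"
  assumes "x \<in> fcar E"
  shows "inv\<^bsub>add_monoid (free_mod P E b)\<^esub> x = - x"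
  unfolding m_inv_def
proof (rule the_equality)
  fix y assume "y \<in> carrier (add_monoid (free_mod P E b)) \<and>
    x \<otimes>\<^bsub>add_monoid (free_mod P E b)\<^esub> y = \<one>\<^bsub>add_monoid (free_mod P E b)\<^esub> \<and>
    y \<otimes>\<^bsub>add_monoid (free_mod P E b)\<^esub> x = \<one>\<^bsub>add_monoid (free_mod P E b)\<^esub>"
  then have "x + y = 0" by simp
  then show "y = - x" by (metis minus_unique)
qed (use assms in simp)

lemma left_submodule_free_mod_iff:
  "left_submodule (free_mod P E b) H \<longleftrightarrow> H \<subseteq> fcar E \<and> closed_submodule H"
proof
  assume "left_submodule (free_mod P E b) H"
  then have "subgroup H (add_monoid (free_mod P E b))" "\<forall>r. \<forall>x\<in>H. lmul r x \<in> H"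
    by (auto simp: left_submodule_def additive_subgroup_def)
  then show "H \<subseteq> fcar E \<and> closed_submodule H"
    unfolding subgroup_def closed_submodule_def by simp
next
  assume *: "H \<subseteq> fcar E \<and> closed_submodule H"
  have "subgroup H (add_monoid (free_mod P E b))"
  proof
    fix x assume "x \<in> H"
    then have "- x \<in> H" using * closed_submoduleD(4)[of H 0 x] closed_submoduleD(1)[of H] by simp
    then show "inv\<^bsub>add_monoid (free_mod P E b)\<^esub> x \<in> H"
      using * \<open>x \<in> H\<close> by (subst a_inv_free_mod[of x E]) auto
  qed (use * in \<open>auto simp: closed_submoduleD\<close>)
  then show "left_submodule (free_mod P E b) H"
    using * by (simp add: left_submodule_def additive_subgroup_def closed_submoduleD)
qed

lemma lspan_free_mod:
  assumes "set V \<subseteq> fcar E"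
  shows "lspan (free_mod P E b) (set V) = row_space V"
proof (rule hull_unique)
  show "set V \<subseteq> row_space V" using row_space_member by blast
  show "left_submodule (free_mod P E b) (row_space V)"
    using assms by (auto simp: left_submodule_free_mod_iff closed_submodule_row_space fcar_row_mult)
  fix H assume "set V \<subseteq> H" "left_submodule (free_mod P E b) H"
  then show "row_space V \<subseteq> H"
    by (auto simp: left_submodule_free_mod_iff closed_submodule_row_mult)
qed


subsection \<open>Linear maps between vectors\<close>

text \<open>Linear maps are defined on all vectors, so that they compose without side conditions; only their
  values on the submodule in question matter.\<close>

definition alin :: "('a::ring_1 vec \<Rightarrow> 'a vec) \<Rightarrow> bool" where
  "alin f \<longleftrightarrow> (\<forall>x y. f (x + y) = f x + f y) \<and> (\<forall>r x. f (lmul r x) = lmul r (f x))"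

lemma alinD:
  assumes "alin f"
  shows "f (x + y) = f x + f y" "f (lmul r x) = lmul r (f x)" "f 0 = 0" "f (x - y) = f x - f y"
    "f (sum g I) = (\<Sum>i\<in>I. f (g i))"
proof -
  show 1: "\<And>x y. f (x + y) = f x + f y" "\<And>r x. f (lmul r x) = lmul r (f x)"
    using assms by (auto simp: alin_def)
  show 0: "f 0 = 0" using 1(2)[of 0 0] by (simp add: lmul_simps)
  show "f (x - y) = f x - f y" using 1(1)[of "x - y" y] by simp
  show "f (sum g I) = (\<Sum>i\<in>I. f (g i))"
    by (induction I rule: infinite_finite_induct) (auto simp: 0 1)
qed

lemma alin_row_mult: "alin (\<lambda>h. row_mult h V)"
  by (simp add: alin_def row_mult_add row_mult_lmul)

lemma alin_row_mult_eq:
  assumes "alin f" shows "f (row_mult h V) = row_mult h (map f V)"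
  unfolding row_mult_def by (simp add: alinD[OF assms])

lemma alin_expansion:
  assumes "alin f" "finite E" "x \<in> fcar E"
  shows "f x = (\<Sum>i\<in>E. lmul (x i) (f (single i 1)))"
proof -
  have "x = (\<Sum>i\<in>E. lmul (x i) (single i 1))"
    using fcar_expansion[OF assms(2,3)] by (simp add: lmul_simps)
  then have "f x = f (\<Sum>i\<in>E. lmul (x i) (single i 1))" by (rule arg_cong)
  then show ?thesis by (simp add: alinD[OF assms(1)])
qed

lemma alin_comp: "alin f \<Longrightarrow> alin g \<Longrightarrow> alin (\<lambda>x. f (g x))"
  by (simp add: alin_def)


section \<open>Supports and degrees of vectors\<close>

context weighted_solvable
begin

definition vsupp :: "'a vec \<Rightarrow> fmon set" where
  "vsupp x = {(\<alpha>, i). \<alpha> \<in> expos P \<and> coef P (x i) \<alpha> \<noteq> 0}"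

lemma vsupp_iff: "(\<alpha>, i) \<in> vsupp x \<longleftrightarrow> \<alpha> \<in> supp (x i)"
  by (simp add: vsupp_def supp_def)

lemma vsupp_empty_iff: "vsupp x = {} \<longleftrightarrow> x = 0"
proof -
  have "vsupp x = {} \<longleftrightarrow> (\<forall>i. supp (x i) = {})"
    using vsupp_iff[of _ _ x] by fastforce
  then show ?thesis by (simp add: supp_empty_iff fun_eq_iff vec_apply)
qed

lemma vsupp_0 [simp]: "vsupp 0 = {}"
  by (simp add: vsupp_empty_iff)

lemma vsupp_subset: "x \<in> fcar E \<Longrightarrow> vsupp x \<subseteq> expos P \<times> E"
  by (auto simp: vsupp_def fcar_def)

lemma finite_vsupp: "finite E \<Longrightarrow> x \<in> fcar E \<Longrightarrow> finite (vsupp x)"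
proof -
  assume "finite E" "x \<in> fcar E"
  then have "vsupp x \<subseteq> (\<Union>i\<in>E. (\<lambda>\<alpha>. (\<alpha>, i)) ` supp (x i))"
    using vsupp_subset[of x E] by (auto simp: vsupp_iff)
  moreover have "finite \<dots>" using \<open>finite E\<close> finite_supp by blast
  ultimately show ?thesis by (rule finite_subset)
qed

lemma vsupp_add: "vsupp (x + y) \<subseteq> vsupp x \<union> vsupp y"
  and vsupp_diff: "vsupp (x - y) \<subseteq> vsupp x \<union> vsupp y"
  by (auto simp: vsupp_def vec_apply)


lemma vsupp_single: "vsupp (single i f) = (\<lambda>\<alpha>. (\<alpha>, i)) ` supp f"
  by (auto simp: vsupp_iff single_def image_iff split: if_splits)

lemma vsupp_lmul:
  assumes "(\<delta>, i) \<in> vsupp (lmul r x)"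
  obtains \<alpha> \<beta> where "\<alpha> \<in> supp r" "(\<beta>, i) \<in> vsupp x" "deg P \<delta> = deg P \<alpha> + deg P \<beta>"
    "\<delta> = \<alpha> + \<beta> \<or> mless P \<delta> (\<alpha> + \<beta>)"
  using assms supp_mult[of \<delta> r "x i"] by (auto simp: vsupp_iff lmul_apply)

lemma vsupp_sum: "m \<in> vsupp (sum f I) \<Longrightarrow> \<exists>k\<in>I. m \<in> vsupp (f k)"
proof (induction I rule: infinite_finite_induct)
  case (insert k I)
  then have "m \<in> vsupp (f k) \<union> vsupp (sum f I)"
    using vsupp_add[of "f k" "sum f I"] by auto
  then show ?case using insert by blast
qed auto

lemma vsupp_row_mult:
  assumes "(\<delta>, i) \<in> vsupp (row_mult h V)"
  obtains k \<alpha> \<beta> where "k < length V" "(\<alpha>, k) \<in> vsupp h" "(\<beta>, i) \<in> vsupp (V ! k)"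
    "deg P \<delta> = deg P \<alpha> + deg P \<beta>" "\<delta> = \<alpha> + \<beta> \<or> mless P \<delta> (\<alpha> + \<beta>)"
proof -
  obtain k where k: "k < length V" "(\<delta>, i) \<in> vsupp (lmul (h k) (V ! k))"
    using vsupp_sum assms unfolding row_mult_def by blast
  from k(2) show ?thesis
    by (rule vsupp_lmul) (use that k(1) in \<open>auto simp: vsupp_iff\<close>)
qed

text \<open>Homogeneity of degree \<open>q\<close> of a vector when the \<open>i\<close>-th basis element has degree \<open>b i\<close>;
  \<open>0\<close> is homogeneous of every degree.\<close>

definition homv :: "(nat \<Rightarrow> nat) \<Rightarrow> nat \<Rightarrow> 'a vec \<Rightarrow> bool" where
  "homv b q x \<longleftrightarrow> (\<forall>(\<alpha>, i)\<in>vsupp x. deg P \<alpha> + b i = q)"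

lemma homvD: "homv b q x \<Longrightarrow> (\<alpha>, i) \<in> vsupp x \<Longrightarrow> deg P \<alpha> + b i = q"
  by (auto simp: homv_def)

lemma homv_0 [simp]: "homv b q 0"
  by (simp add: homv_def)

lemma homv_add: "homv b q x \<Longrightarrow> homv b q y \<Longrightarrow> homv b q (x + y)"
  and homv_diff: "homv b q x \<Longrightarrow> homv b q y \<Longrightarrow> homv b q (x - y)"
  unfolding homv_def using vsupp_add[of x y] vsupp_diff[of x y] by blast+


lemma homv_lmul:
  assumes "\<And>\<alpha>. \<alpha> \<in> supp r \<Longrightarrow> deg P \<alpha> + d = q" "homv b d x"
  shows "homv b q (lmul r x)"
  unfolding homv_def
proof clarify
  fix \<delta> i assume "(\<delta>, i) \<in> vsupp (lmul r x)"
  then show "deg P \<delta> + b i = q"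
    by (rule vsupp_lmul) (use assms homvD[OF assms(2)] in force)
qed

lemma homv_single: "homv b q (single i f) \<longleftrightarrow> (\<forall>\<alpha>\<in>supp f. deg P \<alpha> + b i = q)"
  by (auto simp: homv_def vsupp_single)

lemma homv_row_mult:
  assumes "homv dv q h" "\<And>k. k < length V \<Longrightarrow> homv b (dv k) (V ! k)"
  shows "homv b q (row_mult h V)"
  unfolding homv_def
proof clarify
  fix \<delta> i assume "(\<delta>, i) \<in> vsupp (row_mult h V)"
  then show "deg P \<delta> + b i = q"
  proof (rule vsupp_row_mult)
    fix k \<alpha> \<beta> assume *: "k < length V" "(\<alpha>, k) \<in> vsupp h" "(\<beta>, i) \<in> vsupp (V ! k)"
      "deg P \<delta> = deg P \<alpha> + deg P \<beta>"
    then show ?thesis using homvD[OF assms(1) *(2)] homvD[OF assms(2)[OF *(1)] *(3)] by simp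
  qed
qed

lemma homv_unique: "homv b q x \<Longrightarrow> homv b q' x \<Longrightarrow> x \<noteq> 0 \<Longrightarrow> q = q'"
  using vsupp_empty_iff[of x] by (auto simp: homv_def)


text \<open>The homogeneous component of degree \<open>q\<close>.\<close>

definition hcomp :: "(nat \<Rightarrow> nat) \<Rightarrow> nat \<Rightarrow> 'a vec \<Rightarrow> 'a vec" where
  "hcomp b q x = (\<lambda>i. \<Sum>\<alpha>\<in>{\<alpha> \<in> supp (x i). deg P \<alpha> + b i = q}. smulK P (coef P (x i) \<alpha>) (pbw P \<alpha>))"

lemma coef_hcomp:
  assumes "\<alpha> \<in> expos P"
  shows "coef P (hcomp b q x i) \<alpha> = (if deg P \<alpha> + b i = q then coef P (x i) \<alpha> else 0)"
proof -
  have "coef P (hcomp b q x i) \<alpha>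
     = (\<Sum>\<beta>\<in>{\<beta> \<in> supp (x i). deg P \<beta> + b i = q}. if \<beta> = \<alpha> then coef P (x i) \<alpha> else 0)"
    unfolding hcomp_def coef_sum
    by (rule sum.cong) (use assms in \<open>auto simp: coef_pbw dest: suppD\<close>)
  then show ?thesis
    using finite_subset[OF _ finite_supp[of "x i"], of "{\<beta> \<in> supp (x i). deg P \<beta> + b i = q}"] assms
    by (subst (asm) sum.delta) (auto simp: supp_def)
qed

lemma homv_hcomp: "homv b q (hcomp b q x)"
  by (auto simp: homv_def vsupp_def coef_hcomp split: if_splits)

lemma hcomp_fcar: "x \<in> fcar E \<Longrightarrow> hcomp b q x \<in> fcar E"
  by (auto simp: fcar_def hcomp_def)

lemma vsupp_minus_hcomp: "(\<alpha>, i) \<in> vsupp (x - hcomp b q x) \<Longrightarrow> deg P \<alpha> + b i \<noteq> q"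
  by (auto simp: vsupp_def coef_hcomp vec_apply split: if_splits)

text \<open>The other components of \<open>h\<close> contribute to \<open>row_mult h V\<close> in other degrees only, hence nothing
  at all when that vector is homogeneous.\<close>

lemma hcomp_row_mult:
  assumes "\<And>k. k < length V \<Longrightarrow> homv b (dv k) (V ! k)" "homv b q (row_mult h V)"
  shows "row_mult (hcomp dv q h) V = row_mult h V"
proof -
  let ?y = "row_mult (h - hcomp dv q h) V"
  have "?y = row_mult h V - row_mult (hcomp dv q h) V" by (simp add: row_mult_diff)
  moreover from this have "homv b q ?y"
    using assms homv_diff homv_row_mult[OF homv_hcomp assms(1)] by simp
  moreover have "?y = 0"
  proof (rule ccontr)
    assume "?y \<noteq> 0"
    then obtain \<delta> i where di: "(\<delta>, i) \<in> vsupp ?y" using vsupp_empty_iff by fast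
    then have "deg P \<delta> + b i = q" using \<open>homv b q ?y\<close> homvD by blast
    from di show False
    proof (rule vsupp_row_mult)
      fix k \<alpha> \<beta> assume *: "k < length V" "(\<alpha>, k) \<in> vsupp (h - hcomp dv q h)"
        "(\<beta>, i) \<in> vsupp (V ! k)" "deg P \<delta> = deg P \<alpha> + deg P \<beta>"
      show False using vsupp_minus_hcomp[OF *(2)] homvD[OF assms(1)[OF *(1)] *(3)] *(4)
          \<open>deg P \<delta> + b i = q\<close> by simp
    qed
  qed
  ultimately show ?thesis by simp
qed

lemma vector_space_vec: "vector_space (\<lambda>c (x::'a vec) i. smulK P c (x i))"
  by unfold_locales (auto simp: fun_eq_iff algebra_simps vec_apply)

lemma grade_free_mod:
  assumes "finite E"
  shows "grade (free_mod P E b) q = {x \<in> fcar E. homv b q x}"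
proof -
  interpret vv: vector_space "\<lambda>c (x::'a vec) i. smulK P c (x i)" by (rule vector_space_vec)
  let ?B = "{single i (pbw P \<alpha>) |\<alpha> i. \<alpha> \<in> expos P \<and> i \<in> E \<and> deg P \<alpha> + b i = q}"
  have eq: "grade (free_mod P E b) q = vv.span ?B" by (simp add: free_mod_def)
  show ?thesis
  proof
    have "x \<in> fcar E \<and> homv b q x" if "x \<in> vv.span ?B" for x
      using that
    proof (induction rule: vv.span_induct_alt)
      case (step c x y)
      then obtain \<alpha> i where x: "x = single i (pbw P \<alpha>)" "\<alpha> \<in> expos P" "i \<in> E" "deg P \<alpha> + b i = q"
        by blast
      have cx: "(\<lambda>i. smulK P c (x i)) = single i (smulK P c (pbw P \<alpha>))"
        using x by (auto simp: fun_eq_iff single_def)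
      have "homv b q (single i (smulK P c (pbw P \<alpha>)))"
        using x supp_smulK_subset[of c "pbw P \<alpha>"] supp_pbw[of \<alpha>] by (auto simp: homv_single)
      then show ?case unfolding cx
        using x(3) step.IH by (simp add: homv_add fcar_single)
    qed simp
    then show "grade (free_mod P E b) q \<subseteq> {x \<in> fcar E. homv b q x}" using eq by auto
  next
    have "x \<in> vv.span ?B" if x: "x \<in> fcar E" "homv b q x" for x
    proof -
      have "x = (\<Sum>i\<in>E. \<Sum>\<alpha>\<in>supp (x i). single i (smulK P (coef P (x i) \<alpha>) (pbw P \<alpha>)))"
      proof
        fix j
        have "(\<Sum>i\<in>E. \<Sum>\<alpha>\<in>supp (x i). single i (smulK P (coef P (x i) \<alpha>) (pbw P \<alpha>))) j
            = (\<Sum>i\<in>E. if i = j then x j else 0)"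
          unfolding sum_fun_apply
        proof (rule sum.cong)
          fix i assume "i \<in> E"
          show "(\<Sum>\<alpha>\<in>supp (x i). single i (smulK P (coef P (x i) \<alpha>) (pbw P \<alpha>)) j) = (if i = j then x j else 0)"
            using expansion[of "x j"] by (auto simp: single_def)
        qed simp
        then show "x j = (\<Sum>i\<in>E. \<Sum>\<alpha>\<in>supp (x i). single i (smulK P (coef P (x i) \<alpha>) (pbw P \<alpha>))) j"
          using assms x by (auto simp: fcarD)
      qed
      also have "\<dots> \<in> vv.span ?B"
      proof (intro vv.span_sum)
        fix i \<alpha> assume "i \<in> E" "\<alpha> \<in> supp (x i)"
        then have "single i (pbw P \<alpha>) \<in> ?B"
          using homvD[OF x(2)] by (auto simp: vsupp_iff dest: suppD)
        moreover have "single i (smulK P (coef P (x i) \<alpha>) (pbw P \<alpha>))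
           = (\<lambda>j. smulK P (coef P (x i) \<alpha>) (single i (pbw P \<alpha>) j))"
          by (auto simp: fun_eq_iff single_def)
        ultimately show "single i (smulK P (coef P (x i) \<alpha>) (pbw P \<alpha>)) \<in> vv.span ?B"
          by (auto intro: vv.span_scale vv.span_base)
      qed
      finally show ?thesis .
    qed
    then show "{x \<in> fcar E. homv b q x} \<subseteq> grade (free_mod P E b) q" using eq by auto
  qed
qed

lemma homogeneous_free_mod:
  "finite E \<Longrightarrow> homogeneous (free_mod P E b) x \<longleftrightarrow> x \<in> fcar E \<and> (\<exists>q. homv b q x)"
  by (auto simp: homogeneous_def grade_free_mod)

lemma hdeg_free_mod:
  assumes "finite E" "x \<in> fcar E" "homv b q x" "x \<noteq> 0"
  shows "hdeg (free_mod P E b) x = q"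
  unfolding hdeg_def using assms homv_unique by (intro the_equality) (auto simp: grade_free_mod)


subsection \<open>Vectors over the ideal of positive degree\<close>

definition posv :: "'a vec set" where
  "posv = {x. \<forall>i. coef P (x i) 0 = 0}"

lemma closed_submodule_posv: "closed_submodule posv"
  by (auto simp: closed_submodule_def posv_def coef_mult_0 vec_apply lmul_apply)


text \<open>A vector is a combination of basis elements with its own entries as coefficients, and \<open>A\<^sub>+\<close> is a
  two-sided ideal.\<close>

lemma alin_posv:
  assumes "alin f" "x \<in> posv" "finite E" "x \<in> fcar E"
  shows "f x \<in> posv"
  unfolding alin_expansion[OF assms(1,3,4)] using assms(2)
  by (simp add: posv_def sum_fun_apply coef_sum coef_mult_0 lmul_apply)

end

section \<open>Dickson's lemma\<close>

text \<open>From any position on the sequence attains a minimum; picking such positions one after the other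
  gives a nondecreasing subsequence.\<close>

lemma nat_seq_mono_subseq:
  fixes f :: "nat \<Rightarrow> nat"
  obtains \<phi> :: "nat \<Rightarrow> nat" where "strict_mono \<phi>" "mono (\<lambda>n. f (\<phi> n))"
proof -
  have ex: "\<exists>x\<ge>m. \<forall>z\<ge>x. f x \<le> f z" for m
  proof -
    obtain x where "x \<ge> m" "\<forall>z\<ge>m. f x \<le> f z"
      using ex_has_least_nat[of "\<lambda>x. x \<ge> m" m f] by auto
    then show ?thesis by (meson order_trans)
  qed
  have "\<exists>\<phi>. \<forall>n. (\<forall>z\<ge>\<phi> n. f (\<phi> n) \<le> f z) \<and> \<phi> n < \<phi> (Suc n)"
  proof (rule dependent_nat_choice)
    show "\<exists>x. \<forall>z\<ge>x. f x \<le> f z" using ex by blast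
    show "\<exists>y. (\<forall>z\<ge>y. f y \<le> f z) \<and> x < y" for x
      using ex[of "Suc x"] Suc_le_lessD by blast
  qed
  then obtain \<phi> where \<phi>: "\<forall>n. (\<forall>z\<ge>\<phi> n. f (\<phi> n) \<le> f z) \<and> \<phi> n < \<phi> (Suc n)" by blast
  have "strict_mono \<phi>" using \<phi> by (simp add: strict_mono_Suc_iff)
  moreover have "mono (\<lambda>n. f (\<phi> n))" using \<phi> by (simp add: mono_iff_le_Suc less_imp_le)
  ultimately show ?thesis using that by blast
qed

lemma vec_seq_mono_subseq:
  fixes f :: "nat \<Rightarrow> nat \<Rightarrow> nat"
  shows "\<exists>\<phi>::nat \<Rightarrow> nat. strict_mono \<phi> \<and> (\<forall>k<K. mono (\<lambda>n. f (\<phi> n) k))"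
proof (induction K)
  case 0
  show ?case by (rule exI[of _ id]) (simp add: strict_mono_def)
next
  case (Suc K)
  then obtain \<phi> :: "nat \<Rightarrow> nat" where \<phi>: "strict_mono \<phi>" "\<forall>k<K. mono (\<lambda>n. f (\<phi> n) k)" by blast
  obtain \<psi> :: "nat \<Rightarrow> nat" where \<psi>: "strict_mono \<psi>" "mono (\<lambda>n. f (\<phi> (\<psi> n)) K)"
    by (rule nat_seq_mono_subseq[of "\<lambda>n. f (\<phi> n) K"])
  have "mono (\<lambda>n. f (\<phi> (\<psi> n)) k)" if "k < Suc K" for k
  proof (cases "k = K")
    case False
    then have "mono (\<lambda>n. f (\<phi> n) k)" using \<phi>(2) that by simp
    then show ?thesis using strict_mono_mono[OF \<psi>(1)] unfolding mono_def by blast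
  qed (use \<psi> in simp)
  moreover have "strict_mono (\<lambda>n. \<phi> (\<psi> n))"
    using \<phi>(1) \<psi>(1) by (simp add: strict_mono_def)
  ultimately show ?case by blast
qed

lemma mon_dvd_refl [simp]: "mon_dvd m m"
  by (simp add: mon_dvd_def)

lemma mon_dvd_trans: "mon_dvd m m' \<Longrightarrow> mon_dvd m' m'' \<Longrightarrow> mon_dvd m m''"
  unfolding mon_dvd_def by (metis order_trans)


context weighted_solvable
begin

text \<open>The index \<open>i\<close> of \<open>a\<^sup>\<alpha> e\<^sub>i\<close> joins the exponents as two further coordinates \<open>i\<close> and \<open>B - i\<close>:
  a subsequence monotone in both has constant index.\<close>

lemma dickson_sequence:
  assumes "finite E" "\<And>n. f n \<in> expos P \<times> E"
  obtains i j :: nat where "i < j" "mon_dvd (f i) (f j)"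
proof -
  obtain B where B: "\<And>i. i \<in> E \<Longrightarrow> i \<le> B" using assms(1) finite_nat_set_iff_bounded_le by auto
  define h where "h = (\<lambda>n k. if k < nvars P then fst (f n) k
    else if k = nvars P then snd (f n) else B - snd (f n))"
  obtain \<phi> :: "nat \<Rightarrow> nat" where \<phi>: "strict_mono \<phi>" "\<forall>k<nvars P + 2. mono (\<lambda>n. h (\<phi> n) k)"
    using vec_seq_mono_subseq by blast
  have le: "h (\<phi> 0) k \<le> h (\<phi> 1) k" if "k < nvars P + 2" for k
    using \<phi>(2) that unfolding mono_def by (meson zero_le_one)
  have "\<phi> 0 < \<phi> 1" using \<phi>(1) by (simp add: strict_mono_def)
  moreover have "mon_dvd (f (\<phi> 0)) (f (\<phi> 1))"
    unfolding mon_dvd_def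
  proof (intro conjI allI)
    have "snd (f n) \<le> B" for n using assms(2)[of n] B by (auto simp: mem_Times_iff)
    from this[of "\<phi> 0"] this[of "\<phi> 1"] show "snd (f (\<phi> 0)) = snd (f (\<phi> 1))"
      using le[of "nvars P"] le[of "Suc (nvars P)"] by (simp add: h_def)
    fix k
    show "fst (f (\<phi> 0)) k \<le> fst (f (\<phi> 1)) k"
    proof (cases "k < nvars P")
      case True
      then show ?thesis using le[of k] by (simp add: h_def)
    next
      case False
      then show ?thesis using assms(2)[of "\<phi> 0"] by (auto simp: expos_def mem_Times_iff)
    qed
  qed
  ultimately show ?thesis using that by blast
qed

text \<open>Distinct minimal elements do not divide one another, so an infinity of them would contradict the
  preceding lemma.\<close>

lemma dickson_basis:
  assumes "finite E" "S \<subseteq> expos P \<times> E"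
  obtains B where "finite B" "B \<subseteq> S" "\<And>m. m \<in> S \<Longrightarrow> \<exists>b\<in>B. mon_dvd b m"
proof -
  define B where "B = {m \<in> S. \<forall>m'\<in>S. mon_dvd m' m \<longrightarrow> m' = m}"
  have "finite B"
  proof (rule ccontr)
    assume "infinite B"
    then obtain f :: "nat \<Rightarrow> fmon" where f: "inj f" "range f \<subseteq> B"
      using infinite_countable_subset by blast
    have "f n \<in> expos P \<times> E" for n using f(2) assms(2) by (auto simp: B_def)
    then obtain i j where "i < j" "mon_dvd (f i) (f j)"
      using dickson_sequence[OF assms(1)] by blast
    moreover have "f i \<in> B" "f j \<in> B" using f(2) by auto
    ultimately have "f i = f j" by (simp add: B_def)
    then show False using f(1) \<open>i < j\<close> by (simp add: inj_eq)
  qed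
  moreover have "\<exists>b\<in>B. mon_dvd b m" if "m \<in> S" for m
    using that
  proof (induction "\<Sum>k<nvars P. fst m k" arbitrary: m rule: less_induct)
    case less
    show ?case
    proof (cases "m \<in> B")
      case False
      then obtain m' where m': "m' \<in> S" "mon_dvd m' m" "m' \<noteq> m" using less by (auto simp: B_def)
      then have "\<exists>k. fst m' k < fst m k"
        unfolding mon_dvd_def by (metis fun_eq_iff order_le_imp_less_or_eq prod_eqI)
      then obtain k where k: "fst m' k < fst m k" by blast
      moreover have "m \<in> expos P \<times> E" using less assms by auto
      ultimately have "k < nvars P" by (cases "k < nvars P") (auto simp: expos_def mem_Times_iff)
      then have "(\<Sum>k<nvars P. fst m' k) < (\<Sum>k<nvars P. fst m k)"
        using m'(2) k by (intro sum_strict_mono_ex1) (auto simp: mon_dvd_def)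
      then show ?thesis using less.hyps[OF _ m'(1)] m'(2) mon_dvd_trans by blast
    qed (use mon_dvd_refl in blast)
  qed
  ultimately show ?thesis using that[of B] by (auto simp: B_def)
qed

end


section \<open>Leading monomials in free modules\<close>

definition shift :: "expo \<Rightarrow> fmon \<Rightarrow> fmon" where
  "shift \<gamma> m = (\<gamma> + fst m, snd m)"

lemma shift_Pair [simp]: "shift \<gamma> (\<alpha>, i) = (\<gamma> + \<alpha>, i)"
  and fst_shift [simp]: "fst (shift \<gamma> m) = \<gamma> + fst m"
  and snd_shift [simp]: "snd (shift \<gamma> m) = snd m"
  by (simp_all add: shift_def)

lemma shift_shift: "shift \<gamma> (shift \<delta> m) = shift (\<gamma> + \<delta>) m"
  by (simp add: shift_def add.assoc)

lemma mon_dvd_shift: "mon_dvd m (shift \<gamma> m)"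
  by (simp add: mon_dvd_def vec_apply)

lemma mon_dvd_imp_shift: "mon_dvd m m' \<Longrightarrow> m' = shift (fst m' - fst m) m"
  by (auto simp: mon_dvd_def prod_eq_iff fun_eq_iff vec_apply)

locale module_order = weighted_solvable P
  for P :: "('k::field, 'a::ring_1) pbw_data" +
  fixes E :: "nat set" and r :: "fmon \<Rightarrow> fmon \<Rightarrow> bool"
  assumes finite_E: "finite E"
    and ordering: "left_monomial_ordering P E r"
begin

abbreviation "mons \<equiv> expos P \<times> E"

lemma total_order_r: "strict_total_order_on mons r"
  using ordering by (simp add: left_monomial_ordering_def)

lemma r_irrefl: "m \<in> mons \<Longrightarrow> \<not> r m m"
  using total_order_r unfolding strict_total_order_on_def irreflp_on_def by blast

lemma r_trans: "r m m' \<Longrightarrow> r m' m'' \<Longrightarrow> m \<in> mons \<Longrightarrow> m' \<in> mons \<Longrightarrow> m'' \<in> mons \<Longrightarrow> r m m''"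
  using total_order_r unfolding strict_total_order_on_def transp_on_def by blast

lemma r_total: "m \<in> mons \<Longrightarrow> m' \<in> mons \<Longrightarrow> m = m' \<or> r m m' \<or> r m' m"
  using total_order_r unfolding strict_total_order_on_def totalp_on_def by blast

lemma r_asym: "r m m' \<Longrightarrow> r m' m \<Longrightarrow> m \<in> mons \<Longrightarrow> m' \<in> mons \<Longrightarrow> False"
  using r_trans r_irrefl by blast

lemma r_mless: "mless P \<alpha> \<beta> \<Longrightarrow> \<alpha> \<in> expos P \<Longrightarrow> \<beta> \<in> expos P \<Longrightarrow> i \<in> E \<Longrightarrow> r (\<alpha>, i) (\<beta>, i)"
  using ordering by (simp add: left_monomial_ordering_def)

lemma shift_mons: "\<gamma> \<in> expos P \<Longrightarrow> m \<in> mons \<Longrightarrow> shift \<gamma> m \<in> mons"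
  by (auto simp: shift_def plus_expos)

lemma LM_eqI:
  assumes "x \<in> fcar E" "m \<in> vsupp x" "\<And>m'. m' \<in> vsupp x \<Longrightarrow> m' \<noteq> m \<Longrightarrow> r m' m"
  shows "LM P r x = m"
  unfolding LM_def vsupp_def[symmetric]
  by (rule greatest_wrt_eqI[OF total_order_r])
    (use assms vsupp_subset finite_vsupp[OF finite_E] in auto)

lemma LM_props:
  assumes "x \<in> fcar E" "x \<noteq> 0"
  shows "LM P r x \<in> vsupp x" "\<And>m. m \<in> vsupp x \<Longrightarrow> m = LM P r x \<or> r m (LM P r x)"
    "LM P r x \<in> mons"
proof -
  note * = greatest_wrt_props[OF total_order_r vsupp_subset[OF assms(1)]
      finite_vsupp[OF finite_E assms(1)]]
  show "LM P r x \<in> vsupp x" "\<And>m. m \<in> vsupp x \<Longrightarrow> m = LM P r x \<or> r m (LM P r x)"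
    unfolding LM_def vsupp_def[symmetric] using * assms(2) vsupp_empty_iff by auto
  then show "LM P r x \<in> mons" using vsupp_subset[OF assms(1)] by blast
qed

lemma LM_components:
  assumes "x \<in> fcar E" "x \<noteq> 0"
  shows "fst (LM P r x) \<in> expos P" "snd (LM P r x) \<in> E"
  using LM_props(3)[OF assms] by (auto simp: mem_Times_iff)

lemma LC_nz: "x \<in> fcar E \<Longrightarrow> x \<noteq> 0 \<Longrightarrow> LC P r x \<noteq> 0"
  using LM_props(1)[of x] by (auto simp: LC_def vsupp_def split: prod.splits)

lemma LC_eq: "LM P r x = (\<alpha>, i) \<Longrightarrow> LC P r x = coef P (x i) \<alpha>"
  by (simp add: LC_def)

lemma r_shift: assumes "r m m'" "m \<in> mons" "m' \<in> mons" "\<gamma> \<in> expos P"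
  shows "r (shift \<gamma> m) (shift \<gamma> m')"
proof -
  have LM1: "LM P r (single i (pbw P \<gamma> * pbw P \<alpha>)) = (\<gamma> + \<alpha>, i)" if "\<alpha> \<in> expos P" "i \<in> E" for \<alpha> i
  proof (rule LM_eqI)
    show "(\<gamma> + \<alpha>, i) \<in> vsupp (single i (pbw P \<gamma> * pbw P \<alpha>))"
      using that assms monomial_product(1) by (auto simp: vsupp_single)
    fix m' assume "m' \<in> vsupp (single i (pbw P \<gamma> * pbw P \<alpha>))" "m' \<noteq> (\<gamma> + \<alpha>, i)"
    then show "r m' (\<gamma> + \<alpha>, i)"
      using that assms monomial_product(2)[of \<gamma> \<alpha>]
      by (auto simp: vsupp_single plus_expos intro!: r_mless dest: suppD)
  qed (use that fcar_single in blast)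
  have "r (LM P r (single (snd m) (pbw P \<gamma> * pbw P (fst m)))) (LM P r (single (snd m') (pbw P \<gamma> * pbw P (fst m'))))"
    using ordering assms unfolding left_monomial_ordering_def
    by (auto simp: mem_Times_iff)
  then show ?thesis using assms by (simp add: LM1 mem_Times_iff shift_def)
qed

lemma r_shift_less: assumes "mless P \<alpha> \<beta>" "\<alpha> \<in> expos P" "\<beta> \<in> expos P" "m \<in> mons"
  shows "r (shift \<alpha> m) (shift \<beta> m)"
  using assms mless_add_left[of \<alpha> \<beta> "fst m"] r_mless[of "\<alpha> + fst m" "\<beta> + fst m" "snd m"]
  by (auto simp: shift_def plus_expos mem_Times_iff add.commute)

lemma mon_dvd_le: assumes "mon_dvd m m'" "m \<in> mons" "m' \<in> mons" shows "m = m' \<or> r m m'"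
proof -
  let ?\<gamma> = "fst m' - fst m"
  have e: "?\<gamma> \<in> expos P" using assms minus_expos by (auto simp: mem_Times_iff)
  have s: "m' = shift ?\<gamma> m" by (rule mon_dvd_imp_shift[OF assms(1)])
  show ?thesis
  proof (cases "?\<gamma> = 0")
    case True
    then show ?thesis using s by (simp add: shift_def)
  next
    case False
    then have "r (shift 0 m) (shift ?\<gamma> m)"
      using e assms mless_0 by (intro r_shift_less) auto
    then show ?thesis using s by (simp add: shift_def)
  qed
qed

text \<open>Left monomial orderings are well-orderings: a strictly descending sequence would contain,
  by Dickson's lemma, a monomial dividing a later, hence smaller one.\<close>

lemma wf_r: "wf {(m', m). m' \<in> mons \<and> m \<in> mons \<and> r m' m}"
proof (rule ccontr)
  assume "\<not> ?thesis"
  then obtain f where "\<forall>i. (f (Suc i), f i) \<in> {(m', m). m' \<in> mons \<and> m \<in> mons \<and> r m' m}"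
    unfolding wf_iff_no_infinite_down_chain by blast
  then have f: "f (Suc i) \<in> mons \<and> f i \<in> mons \<and> r (f (Suc i)) (f i)" for i
    by simp
  have desc: "r (f j) (f i)" if "i < j" for i j
    using that
  proof (induction j)
    case (Suc j)
    then consider "i < j" | "i = j" by linarith
    then show ?case
    proof cases
      case 1
      have m: "f i \<in> mons" "f j \<in> mons" "f (Suc j) \<in> mons" using f by blast+
      show ?thesis by (rule r_trans[OF _ Suc.IH[OF 1] m(3,2,1)]) (use f in blast)
    qed (use f in blast)
  qed simp
  obtain i j where "i < j" "mon_dvd (f i) (f j)"
    using dickson_sequence[OF finite_E, of f] f by blast
  moreover have "f i \<in> mons" "f j \<in> mons" using f by blast+
  ultimately show False
    using desc[of i j] mon_dvd_le[of "f i" "f j"] r_asym[of "f i" "f j"] r_irrefl[of "f i"] by auto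
qed

definition below :: "'a vec \<Rightarrow> fmon \<Rightarrow> bool" where
  "below x m \<longleftrightarrow> (\<forall>m'\<in>vsupp x. r m' m)"

lemma below_0 [simp]: "below 0 m"
  by (simp add: below_def)

lemma below_add: "below x m \<Longrightarrow> below y m \<Longrightarrow> below (x + y) m"
  and below_diff: "below x m \<Longrightarrow> below y m \<Longrightarrow> below (x - y) m"
  using vsupp_add[of x y] vsupp_diff[of x y] unfolding below_def by blast+

lemma below_mono: "below x m \<Longrightarrow> r m m' \<Longrightarrow> x \<in> fcar E \<Longrightarrow> m \<in> mons \<Longrightarrow> m' \<in> mons \<Longrightarrow> below x m'"
  unfolding below_def using r_trans vsupp_subset by blast

lemma below_iff_LM:
  assumes "x \<in> fcar E" "m \<in> mons"
  shows "below x m \<longleftrightarrow> x = 0 \<or> r (LM P r x) m"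
proof (cases "x = 0")
  case False
  note LM = LM_props[OF assms(1) False]
  have "r m' m" if "r (LM P r x) m" "m' \<in> vsupp x" for m'
    using LM(2)[OF that(2)] that(1) r_trans[OF _ that(1) _ LM(3) assms(2), of m']
      vsupp_subset[OF assms(1)] that(2) by auto
  then show ?thesis using LM(1) False unfolding below_def by blast
qed simp

text \<open>Upper bounds for the leading monomials of the summands \<open>a\<^sup>\<alpha> g\<^sub>k\<close> of \<open>row_mult h G\<close> bound the sum; this
  is all that is needed of products with general elements of the algebra.\<close>

lemma below_row_mult:
  assumes "set G \<subseteq> fcar E - {0}" "m \<in> mons"
    "\<And>\<alpha> k. (\<alpha>, k) \<in> vsupp h \<Longrightarrow> k < length G \<Longrightarrow> r (shift \<alpha> (LM P r (G ! k))) m"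
  shows "below (row_mult h G) m"
  unfolding below_def
proof clarify
  fix \<delta> i assume "(\<delta>, i) \<in> vsupp (row_mult h G)"
  then show "r (\<delta>, i) m"
  proof (rule vsupp_row_mult)
    fix k \<alpha> \<beta>
    assume k: "k < length G" "(\<alpha>, k) \<in> vsupp h" "(\<beta>, i) \<in> vsupp (G ! k)"
      and \<delta>: "\<delta> = \<alpha> + \<beta> \<or> mless P \<delta> (\<alpha> + \<beta>)"
    have G: "G ! k \<in> fcar E" "G ! k \<noteq> 0" using assms(1) k(1) nth_mem by auto
    have \<alpha>: "\<alpha> \<in> expos P" using k(2) by (auto simp: vsupp_def)
    have \<beta>: "(\<beta>, i) \<in> mons" using vsupp_subset[OF G(1)] k(3) by blast
    have \<delta>m: "(\<delta>, i) \<in> mons"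
      using \<open>(\<delta>, i) \<in> vsupp (row_mult h G)\<close> \<beta> by (auto simp: vsupp_def)
    have L: "LM P r (G ! k) \<in> mons" by (rule LM_props(3)[OF G])
    have 1: "(\<delta>, i) = shift \<alpha> (\<beta>, i) \<or> r (\<delta>, i) (shift \<alpha> (\<beta>, i))"
      using \<delta> \<alpha> \<beta> \<delta>m r_mless plus_expos by auto
    have 2: "shift \<alpha> (\<beta>, i) = shift \<alpha> (LM P r (G ! k)) \<or> r (shift \<alpha> (\<beta>, i)) (shift \<alpha> (LM P r (G ! k)))"
      using LM_props(2)[OF G k(3)] r_shift[OF _ \<beta> L \<alpha>] by (elim disjE) (simp_all del: shift_Pair)
    have 3: "r (shift \<alpha> (LM P r (G ! k))) m" using assms(3) k by blast
    show ?thesis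
      using 1 2 3 r_trans \<delta>m assms(2) shift_mons[OF \<alpha> \<beta>] shift_mons[OF \<alpha> L] by metis
  qed
qed

text \<open>Left multiplication by \<open>a\<^sup>\<gamma>\<close> preserves the order of the monomials of \<open>x\<close>, up to lower terms, so
  that nothing cancels the shifted leading term.\<close>

lemma LM_lmul_pbw:
  assumes x: "x \<in> fcar E" "x \<noteq> 0" and \<gamma>: "\<gamma> \<in> expos P"
  shows "LM P r (lmul (pbw P \<gamma>) x) = shift \<gamma> (LM P r x)" "lmul (pbw P \<gamma>) x \<noteq> 0"
proof -
  obtain \<alpha> i where LM: "LM P r x = (\<alpha>, i)" by fastforce
  have ai: "(\<alpha>, i) \<in> vsupp x" "(\<alpha>, i) \<in> mons" using LM_props(1,3)[OF x] LM by simp_all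
  have top: "mless P \<beta> \<alpha>" if "\<beta> \<in> supp (x i)" "\<beta> \<noteq> \<alpha>" for \<beta>
  proof -
    have "r (\<beta>, i) (\<alpha>, i)" using LM_props(2)[OF x, of "(\<beta>, i)"] that LM by (auto simp: vsupp_iff)
    then show ?thesis
      using that mless_total[of \<beta> \<alpha>] r_mless[of \<alpha> \<beta> i] r_asym ai(2) suppD(1)[OF that(1)]
      by (meson SigmaD1 SigmaD2 SigmaI)
  qed
  have "coef P (pbw P \<gamma> * x i) (\<gamma> + \<alpha>) \<noteq> 0"
    using coef_monomial_mult_top[OF \<gamma> _ top] monomial_product(1)[OF \<gamma>] ai
    by (auto simp: vsupp_iff supp_def)
  then have in_supp: "(\<gamma> + \<alpha>, i) \<in> vsupp (lmul (pbw P \<gamma>) x)"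
    using ai \<gamma> plus_expos by (auto simp: vsupp_def lmul_apply)
  then show "lmul (pbw P \<gamma>) x \<noteq> 0" by auto
  show "LM P r (lmul (pbw P \<gamma>) x) = shift \<gamma> (LM P r x)"
    unfolding LM shift_Pair
  proof (rule LM_eqI)
    fix m' assume m': "m' \<in> vsupp (lmul (pbw P \<gamma>) x)" "m' \<noteq> (\<gamma> + \<alpha>, i)"
    obtain \<delta> j where dj: "m' = (\<delta>, j)" by fastforce
    from m'(1) show "r m' (\<gamma> + \<alpha>, i)"
      unfolding dj
    proof (rule vsupp_lmul)
      fix \<gamma>' \<beta> assume *: "\<gamma>' \<in> supp (pbw P \<gamma>)" "(\<beta>, j) \<in> vsupp x" "\<delta> = \<gamma>' + \<beta> \<or> mless P \<delta> (\<gamma>' + \<beta>)"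
      have g: "\<gamma>' = \<gamma>" using *(1) \<gamma> by (simp add: supp_pbw)
      have \<beta>: "(\<beta>, j) \<in> mons" using vsupp_subset[OF x(1)] *(2) by blast
      have \<delta>: "(\<delta>, j) \<in> mons" using m'(1) dj \<beta> by (auto simp: vsupp_def)
      have 1: "(\<delta>, j) = shift \<gamma> (\<beta>, j) \<or> r (\<delta>, j) (shift \<gamma> (\<beta>, j))"
        using *(3) g \<gamma> \<beta> \<delta> r_mless plus_expos by auto
      have 2: "shift \<gamma> (\<beta>, j) = shift \<gamma> (\<alpha>, i) \<or> r (shift \<gamma> (\<beta>, j)) (shift \<gamma> (\<alpha>, i))"
        using LM_props(2)[OF x *(2)] r_shift[OF _ \<beta> ai(2) \<gamma>] LM by auto
      show "r (\<delta>, j) (\<gamma> + \<alpha>, i)"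
        using 1 2 r_trans \<delta> shift_mons[OF \<gamma> \<beta>] shift_mons[OF \<gamma> ai(2)] m'(2) dj
        by (metis shift_Pair)
    qed
  qed (use in_supp x in auto)
qed

lemma LM_lmul_term:
  assumes x: "x \<in> fcar E" "x \<noteq> 0" and \<gamma>: "\<gamma> \<in> expos P" and c: "c \<noteq> 0"
  shows "LM P r (lmul (smulK P c (pbw P \<gamma>)) x) = shift \<gamma> (LM P r x)"
    "LC P r (lmul (smulK P c (pbw P \<gamma>)) x) = c * LC P r (lmul (pbw P \<gamma>) x)"
    "lmul (smulK P c (pbw P \<gamma>)) x \<noteq> 0"
proof -
  have "vsupp (lmul (smulK P c (pbw P \<gamma>)) x) = vsupp (lmul (pbw P \<gamma>) x)"
    using c by (auto simp: vsupp_def lmul_apply smulK_mult_left)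
  then have LM: "LM P r (lmul (smulK P c (pbw P \<gamma>)) x) = LM P r (lmul (pbw P \<gamma>) x)"
    by (simp add: LM_def vsupp_def)
  then show "LM P r (lmul (smulK P c (pbw P \<gamma>)) x) = shift \<gamma> (LM P r x)"
    using LM_lmul_pbw[OF x \<gamma>] by simp
  show "LC P r (lmul (smulK P c (pbw P \<gamma>)) x) = c * LC P r (lmul (pbw P \<gamma>) x)"
    unfolding LC_def LM by (auto simp: lmul_apply smulK_mult_left split: prod.splits)
  show "lmul (smulK P c (pbw P \<gamma>)) x \<noteq> 0"
    using LM_lmul_pbw(2)[OF x \<gamma>] \<open>vsupp _ = _\<close> vsupp_empty_iff by metis
qed

lemma below_cancel:
  assumes "x \<in> fcar E" "y \<in> fcar E" "x \<noteq> 0" "y \<noteq> 0" "LM P r x = LM P r y" "LC P r x = LC P r y"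
  shows "below (x - y) (LM P r x)"
  unfolding below_def
proof
  fix m assume m: "m \<in> vsupp (x - y)"
  have "m \<noteq> LM P r x"
    using m assms(5,6) by (auto simp: vsupp_def LC_def split: prod.splits)
  then show "r m (LM P r x)"
    using m vsupp_diff[of x y] LM_props(2)[of x m] LM_props(2)[of y m] assms by auto
qed

text \<open>The reduction step of the division algorithm, for an arbitrary divisor.\<close>

lemma leading_term_cancel:
  assumes x: "x \<in> fcar E" "x \<noteq> 0" and g: "g \<in> fcar E" "g \<noteq> 0"
    and "mon_dvd (LM P r g) (LM P r x)"
  defines "\<gamma> \<equiv> fst (LM P r x) - fst (LM P r g)"
  defines "h \<equiv> smulK P (LC P r x / LC P r (lmul (pbw P \<gamma>) g)) (pbw P \<gamma>)"
  shows "below (x - lmul h g) (LM P r x)" "supp h = {\<gamma>}" "shift \<gamma> (LM P r g) = LM P r x"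
    "\<gamma> \<in> expos P"
proof -
  show \<gamma>: "\<gamma> \<in> expos P" unfolding \<gamma>_def using LM_components[OF x] minus_expos by blast
  show sh: "shift \<gamma> (LM P r g) = LM P r x"
    using mon_dvd_imp_shift[OF assms(5)] by (simp add: \<gamma>_def)
  have nz: "LC P r (lmul (pbw P \<gamma>) g) \<noteq> 0"
    using LM_lmul_pbw[OF g \<gamma>] g by (intro LC_nz) auto
  have c: "LC P r x / LC P r (lmul (pbw P \<gamma>) g) \<noteq> 0" using nz LC_nz[OF x] by simp
  then show "supp h = {\<gamma>}" using \<gamma> by (simp add: h_def supp_smulK supp_pbw)
  show "below (x - lmul h g) (LM P r x)"
    using LM_lmul_term[OF g \<gamma> c] nz sh x g unfolding h_def[symmetric]
    by (intro below_cancel) auto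
qed

end

section \<open>Division with remainder\<close>

text \<open>Otherwise every reachable state has a successor, and dependent choice gives an infinite run.\<close>

lemma halts_reaches_final:
  assumes "halts step final s"
  shows "\<exists>t. step\<^sup>*\<^sup>* s t \<and> final t"
proof (rule ccontr)
  assume "\<not> ?thesis"
  then have nf: "\<not> final t" if "step\<^sup>*\<^sup>* s t" for t using that by blast
  have "\<exists>f. \<forall>n. (step\<^sup>*\<^sup>* s (f n) \<and> (n = 0 \<longrightarrow> f n = s)) \<and> step (f n) (f (Suc n))"
  proof (rule dependent_nat_choice)
    show "\<exists>x. step\<^sup>*\<^sup>* s x \<and> ((0::nat) = 0 \<longrightarrow> x = s)" by blast
    fix x and n :: nat assume *: "step\<^sup>*\<^sup>* s x \<and> (n = 0 \<longrightarrow> x = s)"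
    then obtain u where "step x u" using assms nf unfolding halts_def by blast
    then show "\<exists>y. (step\<^sup>*\<^sup>* s y \<and> (Suc n = 0 \<longrightarrow> y = s)) \<and> step x y"
      using * rtranclp.rtrancl_into_rtrancl[of step s x u] by blast
  qed
  then show False using assms unfolding halts_def by blast
qed

context module_order
begin

text \<open>\<open>shift \<alpha> (LM P r (G ! k))\<close>, the leading monomial of \<open>a\<^sup>\<alpha> g\<^sub>k\<close>, is the height of the monomial
  \<open>a\<^sup>\<alpha> \<epsilon>\<^sub>k\<close> of \<open>A\<^sup>G\<close>.\<close>

definition heights_below :: "'a vec list \<Rightarrow> 'a vec \<Rightarrow> fmon \<Rightarrow> bool" where
  "heights_below G h m \<longleftrightarrow> (\<forall>(\<alpha>, k)\<in>vsupp h. r (shift \<alpha> (LM P r (G ! k))) m)"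

lemma heights_below_add: "heights_below G h m \<Longrightarrow> heights_below G h' m \<Longrightarrow> heights_below G (h + h') m"
  unfolding heights_below_def using vsupp_add[of h h'] by blast

text \<open>Bounds on the dividend \<open>x\<close> are quantified, instead of speaking of its leading monomial, since an
  S-polynomial will be divided that is known to lie below a monomial it does not contain.\<close>

definition div_inv :: "'a vec list \<Rightarrow> 'a vec \<Rightarrow> 'a vec \<times> 'a vec \<times> 'a vec \<Rightarrow> bool" where
  "div_inv G x = (\<lambda>(y, q, \<rho>). y \<in> fcar E \<and> q \<in> fcar {..<length G} \<and> \<rho> \<in> fcar E \<and>
     x = y + row_mult q G + \<rho> \<and>
     (\<forall>m\<in>mons. below x m \<longrightarrow> below y m \<and> heights_below G q m \<and> below \<rho> m) \<and>
     (\<forall>m\<in>vsupp \<rho>. \<forall>k<length G. \<not> mon_dvd (LM P r (G ! k)) m) \<and>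
     (\<forall>b dv d. (\<forall>k<length G. homv b (dv k) (G ! k)) \<longrightarrow> homv b d x \<longrightarrow>
        homv b d y \<and> homv dv d q \<and> homv b d \<rho>))"

lemma fun_upd_add_single: "q(k := q k + h) = q + single k (h::'a)"
  by (auto simp: fun_eq_iff single_def vec_apply)

lemma div_step_cases:
  assumes G: "set G \<subseteq> fcar E - {0}" and y: "y \<in> fcar E"
    and step: "div_step P r G (y, q, \<rho>) (y', q', \<rho>')"
  obtains
    (reduce) k h \<gamma> where "y \<noteq> 0" "k < length G" "supp h = {\<gamma>}" "shift \<gamma> (LM P r (G ! k)) = LM P r y"
      "below y' (LM P r y)" "y' = y - lmul h (G ! k)" "q' = q + single k h" "\<rho>' = \<rho>"
  | (remainder) t where "y \<noteq> 0" "vsupp t = {LM P r y}" "t \<in> fcar E"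
      "\<forall>k<length G. \<not> mon_dvd (LM P r (G ! k)) (LM P r y)"
      "below y' (LM P r y)" "y' = y - t" "q' = q" "\<rho>' = \<rho> + t"
proof -
  have y0: "y \<noteq> 0" using step by (auto simp: div_step_def)
  show ?thesis
  proof (cases "\<exists>k<length G. mon_dvd (LM P r (G ! k)) (LM P r y)")
    case True
    then obtain k where k: "k < length G" "mon_dvd (LM P r (G ! k)) (LM P r y)"
      and eqs: "let a = pbw P (fst (LM P r y) - fst (LM P r (G ! k)));
              h = smulK P (LC P r y / LC P r (lmul a (G ! k))) a
          in y' = y - lmul h (G ! k) \<and> q' = q(k := q k + h) \<and> \<rho>' = \<rho>"
      using step unfolding div_step_def by blast
    have g: "G ! k \<in> fcar E" "G ! k \<noteq> 0" using G k(1) nth_mem by auto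
    show ?thesis
      using eqs leading_term_cancel[OF y y0 g k(2)]
      by (intro reduce[OF y0 k(1)]) (auto simp: Let_def fun_upd_add_single)
  next
    case False
    obtain \<alpha> i where LM: "LM P r y = (\<alpha>, i)" by fastforce
    define t where "t = single i (smulK P (LC P r y) (pbw P \<alpha>))"
    have ai: "\<alpha> \<in> expos P" "i \<in> E" using LM_components[OF y y0] LM by simp_all
    have t: "y' = y - t" "q' = q" "\<rho>' = \<rho> + t"
      using step False LM unfolding div_step_def t_def by (simp_all add: Let_def) blast+
    have vt: "vsupp t = {(\<alpha>, i)}"
      using LC_nz[OF y y0] ai by (simp add: t_def vsupp_single supp_smulK supp_pbw)
    have tE: "t \<in> fcar E" using ai by (simp add: t_def fcar_single)
    have LMt: "LM P r t = (\<alpha>, i)" using vt tE by (intro LM_eqI) auto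
    have "LC P r t = LC P r y" using LC_eq[OF LMt] ai by (simp add: t_def coef_pbw)
    then have "below y' (LM P r y)"
      unfolding t(1) using LMt LM vt tE y y0 by (intro below_cancel) auto
    then show ?thesis using remainder[of t] y0 vt tE False t LM by simp
  qed
qed

lemma div_inv_step:
  assumes G: "set G \<subseteq> fcar E - {0}" and inv: "div_inv G x st" and step: "div_step P r G st st'"
  shows "div_inv G x st'"
proof -
  obtain y q \<rho> where st: "st = (y, q, \<rho>)" by (cases st)
  obtain y' q' \<rho>' where st': "st' = (y', q', \<rho>')" by (cases st')
  from inv st have y: "y \<in> fcar E" and q: "q \<in> fcar {..<length G}" and \<rho>: "\<rho> \<in> fcar E"
    and eq: "x = y + row_mult q G + \<rho>"
    and bel: "\<And>m. m \<in> mons \<Longrightarrow> below x m \<Longrightarrow> below y m \<and> heights_below G q m \<and> below \<rho> m"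
    and irr: "\<forall>m\<in>vsupp \<rho>. \<forall>k<length G. \<not> mon_dvd (LM P r (G ! k)) m"
    and hom: "\<And>b dv d. (\<forall>k<length G. homv b (dv k) (G ! k)) \<Longrightarrow> homv b d x \<Longrightarrow>
        homv b d y \<and> homv dv d q \<and> homv b d \<rho>"
    unfolding div_inv_def prod.case by blast+
  from step have "div_step P r G (y, q, \<rho>) (y', q', \<rho>')" by (simp add: st st')
  with G y show ?thesis
  proof (cases rule: div_step_cases)
    case (reduce k h \<gamma>)
    have g: "G ! k \<in> fcar E" "G ! k \<noteq> 0" using G reduce(2) nth_mem by auto
    have LMy: "LM P r y \<in> mons" "LM P r y \<in> vsupp y" using LM_props[OF y reduce(1)] by blast+
    have y': "y' \<in> fcar E" using y g reduce(6) by simp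
    have vs: "vsupp (single k h) = {(\<gamma>, k)}" using reduce(3) by (simp add: vsupp_single)
    have "x = y' + row_mult q' G + \<rho>'"
      using eq reduce by (simp add: row_mult_add row_mult_single)
    moreover have "q' \<in> fcar {..<length G}" using q reduce by (simp add: fcar_single)
    moreover have "below y' m \<and> heights_below G q' m \<and> below \<rho>' m" if m: "m \<in> mons" "below x m" for m
    proof -
      have r: "r (LM P r y) m" using bel[OF m] LMy(2) by (simp add: below_def)
      then have "heights_below G (single k h) m"
        using reduce(4) by (simp add: heights_below_def vs)
      then show ?thesis
        using bel[OF m] reduce heights_below_add below_mono[OF reduce(5) r y' LMy(1) m(1)] by simp
    qed
    moreover have "homv b d y' \<and> homv dv d q' \<and> homv b d \<rho>'"
      if h: "\<forall>k<length G. homv b (dv k) (G ! k)" "homv b d x" for b dv d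
    proof -
      have dg: "homv b (dv k) (G ! k)" using h(1) reduce(2) by blast
      obtain \<beta> i where gi: "LM P r (G ! k) = (\<beta>, i)" by fastforce
      have "deg P \<beta> + b i = dv k"
        using homvD[OF dg, of \<beta> i] LM_props(1)[OF g] gi by simp
      moreover have "deg P (\<gamma> + \<beta>) + b i = d"
        using hom[OF h] homvD[of b d y "\<gamma> + \<beta>" i] LMy(2) reduce(4) gi by simp
      ultimately have "deg P \<gamma> + dv k = d" by simp
      then show ?thesis
        using hom[OF h] reduce dg homv_lmul[of h "dv k" d b "G ! k"]
        by (auto intro!: homv_diff homv_add simp: homv_single)
    qed
    moreover have "\<rho>' \<in> fcar E" "\<forall>m\<in>vsupp \<rho>'. \<forall>k<length G. \<not> mon_dvd (LM P r (G ! k)) m"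
      using \<rho> irr reduce(8) by simp_all
    ultimately show ?thesis using y' unfolding div_inv_def st' prod.case by blast
  next
    case (remainder t)
    have LMy: "LM P r y \<in> mons" "LM P r y \<in> vsupp y" using LM_props[OF y remainder(1)] by blast+
    have y': "y' \<in> fcar E" using y remainder by simp
    have "x = y' + row_mult q' G + \<rho>'" using eq remainder by simp
    moreover have "below y' m \<and> heights_below G q' m \<and> below \<rho>' m" if m: "m \<in> mons" "below x m" for m
    proof -
      have r: "r (LM P r y) m" using bel[OF m] LMy(2) by (simp add: below_def)
      then have "below t m" using remainder(2) by (simp add: below_def)
      then show ?thesis
        using bel[OF m] remainder below_add below_mono[OF remainder(5) r y' LMy(1) m(1)] by simp
    qed
    moreover have "\<forall>m\<in>vsupp \<rho>'. \<forall>k<length G. \<not> mon_dvd (LM P r (G ! k)) m"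
      using irr remainder vsupp_add[of \<rho> t] by auto
    moreover have "homv b d y' \<and> homv dv d q' \<and> homv b d \<rho>'"
      if h: "\<forall>k<length G. homv b (dv k) (G ! k)" "homv b d x" for b dv d
    proof -
      have "homv b d t" using hom[OF h] LMy(2) remainder(2) by (auto simp: homv_def)
      then show ?thesis using hom[OF h] remainder homv_diff homv_add by simp
    qed
    moreover have "\<rho>' \<in> fcar E" "q' \<in> fcar {..<length G}" using \<rho> q remainder by simp_all
    ultimately show ?thesis using y' unfolding div_inv_def st' prod.case by blast
  qed
qed

lemma div_inv_reachable:
  assumes G: "set G \<subseteq> fcar E - {0}" and x: "x \<in> fcar E"
    and "(div_step P r G)\<^sup>*\<^sup>* (x, 0, 0) st"
  shows "div_inv G x st"
  using assms(3)
proof (induction rule: rtranclp_induct)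
  case base
  show ?case using x by (auto simp: div_inv_def heights_below_def)
next
  case (step st st')
  then show ?case using div_inv_step[OF G] by blast
qed

text \<open>Each step lowers the leading monomial of what is left to be divided.\<close>

lemma division_halts:
  assumes G: "set G \<subseteq> fcar E - {0}" and x: "x \<in> fcar E"
  shows "halts (div_step P r G) div_final (x, 0, 0)"
  unfolding halts_def
proof (intro conjI allI impI)
  show "\<not> (\<exists>f. f 0 = (x, 0, 0) \<and> (\<forall>k. div_step P r G (f k) (f (Suc k))))"
  proof
    assume "\<exists>f. f 0 = (x, 0, 0) \<and> (\<forall>k. div_step P r G (f k) (f (Suc k)))"
    then obtain f where f: "f 0 = (x, 0, 0)" "\<And>k. div_step P r G (f k) (f (Suc k))" by blast
    have reach: "(div_step P r G)\<^sup>*\<^sup>* (x, 0, 0) (f k)" for k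
    proof (induction k)
      case (Suc k)
      then show ?case using f(2)[of k] by (rule rtranclp.rtrancl_into_rtrancl)
    qed (simp add: f(1))
    have y: "fst (f k) \<in> fcar E" for k
      using div_inv_reachable[OF G x reach, of k] by (auto simp: div_inv_def split: prod.splits)
    have y0: "fst (f k) \<noteq> 0" for k
      using f(2)[of k] by (auto simp: div_step_def split: prod.splits)
    have "(LM P r (fst (f (Suc k))), LM P r (fst (f k))) \<in> {(m', m). m' \<in> mons \<and> m \<in> mons \<and> r m' m}" for k
    proof -
      obtain y1 q \<rho> where 1: "f k = (y1, q, \<rho>)" by (cases "f k")
      obtain y2 q' \<rho>' where 2: "f (Suc k) = (y2, q', \<rho>')" by (cases "f (Suc k)")
      have "y1 \<in> fcar E" "div_step P r G (y1, q, \<rho>) (y2, q', \<rho>')"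
        using y[of k] f(2)[of k] 1 2 by simp_all
      with G have "below y2 (LM P r y1)" by (cases rule: div_step_cases)
      then show ?thesis
        using below_iff_LM[of y2 "LM P r y1"] LM_props(3) y[of k] y[of "Suc k"] y0[of k] y0[of "Suc k"] 1 2
        by simp
    qed
    then have "\<exists>g. \<forall>k. (g (Suc k), g k) \<in> {(m', m). m' \<in> mons \<and> m \<in> mons \<and> r m' m}"
      by (intro exI[of _ "\<lambda>k. LM P r (fst (f k))"] allI)
    then show False by (rule notE[OF wf_r[unfolded wf_iff_no_infinite_down_chain]])
  qed
  fix t assume "(div_step P r G)\<^sup>*\<^sup>* (x, 0, 0) t"
  obtain y q \<rho> where "t = (y, q, \<rho>)" by (cases t)
  then show "div_final t \<or> (\<exists>u. div_step P r G t u)"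
    unfolding div_final_def div_step_def Let_def
    by (cases "\<exists>k<length G. mon_dvd (LM P r (G ! k)) (LM P r y)") (simp_all, blast+)
qed

lemma division_exists:
  assumes G: "set G \<subseteq> fcar E - {0}" and x: "x \<in> fcar E"
  obtains q \<rho> where "division P r G x q \<rho>"
proof -
  obtain t where "(div_step P r G)\<^sup>*\<^sup>* (x, 0, 0) t" "div_final t"
    using halts_reaches_final[OF division_halts[OF G x]] by blast
  moreover obtain y q \<rho> where "t = (y, q, \<rho>)" by (cases t)
  ultimately have "division P r G x q \<rho>" by (simp add: division_def div_final_def)
  then show ?thesis by (rule that)
qed

lemma division_props:
  assumes G: "set G \<subseteq> fcar E - {0}" and x: "x \<in> fcar E" and div: "division P r G x q \<rho>"
  shows "q \<in> fcar {..<length G}" "\<rho> \<in> fcar E" "x = row_mult q G + \<rho>"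
    "m \<in> mons \<Longrightarrow> below x m \<Longrightarrow> heights_below G q m"
    "m \<in> mons \<Longrightarrow> below x m \<Longrightarrow> below \<rho> m"
    "\<rho> \<noteq> 0 \<Longrightarrow> k < length G \<Longrightarrow> \<not> mon_dvd (LM P r (G ! k)) (LM P r \<rho>)"
    "(\<And>k. k < length G \<Longrightarrow> homv b (dv k) (G ! k)) \<Longrightarrow> homv b d x \<Longrightarrow> homv dv d q"
    "(\<And>k. k < length G \<Longrightarrow> homv b (dv k) (G ! k)) \<Longrightarrow> homv b d x \<Longrightarrow> homv b d \<rho>"
proof -
  have inv: "div_inv G x (0, q, \<rho>)"
    using div_inv_reachable[OF G x] div by (simp add: division_def)
  then show "q \<in> fcar {..<length G}" and \<rho>: "\<rho> \<in> fcar E"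
    and "m \<in> mons \<Longrightarrow> below x m \<Longrightarrow> heights_below G q m"
    and "m \<in> mons \<Longrightarrow> below x m \<Longrightarrow> below \<rho> m"
    unfolding div_inv_def prod.case by blast+
  show "x = row_mult q G + \<rho>" using inv by (simp add: div_inv_def)
  show "\<rho> \<noteq> 0 \<Longrightarrow> k < length G \<Longrightarrow> \<not> mon_dvd (LM P r (G ! k)) (LM P r \<rho>)"
    using inv LM_props(1)[OF \<rho>] by (simp add: div_inv_def)
  show "(\<And>k. k < length G \<Longrightarrow> homv b (dv k) (G ! k)) \<Longrightarrow> homv b d x \<Longrightarrow> homv dv d q"
    "(\<And>k. k < length G \<Longrightarrow> homv b (dv k) (G ! k)) \<Longrightarrow> homv b d x \<Longrightarrow> homv b d \<rho>"
    using inv unfolding div_inv_def by blast+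
qed

end


section \<open>Schreyer's ordering and syzygies of Groebner bases\<close>

context weighted_solvable
begin

text \<open>The defining condition on leading monomials of products amounts to compatibility with the
  addition of exponents, by the second condition on the ordering.\<close>

lemma left_monomial_orderingI:
  assumes tot: "strict_total_order_on (expos P \<times> E) r"
    and add: "\<And>\<alpha> \<beta> \<gamma> i j. r (\<alpha>, i) (\<beta>, j) \<Longrightarrow> (\<alpha>, i) \<in> expos P \<times> E \<Longrightarrow> (\<beta>, j) \<in> expos P \<times> E \<Longrightarrow>
        \<gamma> \<in> expos P \<Longrightarrow> r (\<gamma> + \<alpha>, i) (\<gamma> + \<beta>, j)"
    and mon: "\<And>\<alpha> \<beta> i. mless P \<alpha> \<beta> \<Longrightarrow> \<alpha> \<in> expos P \<Longrightarrow> \<beta> \<in> expos P \<Longrightarrow> i \<in> E \<Longrightarrow> r (\<alpha>, i) (\<beta>, i)"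
  shows "left_monomial_ordering P E r"
proof -
  have "LM P r (single i (pbw P \<gamma> * pbw P \<alpha>)) = (\<gamma> + \<alpha>, i)"
    if "\<alpha> \<in> expos P" "i \<in> E" "\<gamma> \<in> expos P" for \<alpha> i \<gamma>
    unfolding LM_def vsupp_def[symmetric] vsupp_single
  proof (rule greatest_wrt_eqI[OF tot])
    show "(\<lambda>\<alpha>. (\<alpha>, i)) ` supp (pbw P \<gamma> * pbw P \<alpha>) \<subseteq> expos P \<times> E"
      using that by (auto dest: suppD)
    show "(\<gamma> + \<alpha>, i) \<in> (\<lambda>\<alpha>. (\<alpha>, i)) ` supp (pbw P \<gamma> * pbw P \<alpha>)"
      using monomial_product(1) that by blast
    fix m' assume "m' \<in> (\<lambda>\<alpha>. (\<alpha>, i)) ` supp (pbw P \<gamma> * pbw P \<alpha>)" "m' \<noteq> (\<gamma> + \<alpha>, i)"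
    then show "r m' (\<gamma> + \<alpha>, i)"
      using monomial_product(2)[of \<gamma> \<alpha>] that mon plus_expos suppD(1) by blast
  qed (simp add: finite_supp)
  then show ?thesis
    unfolding left_monomial_ordering_def using tot add mon by auto
qed

lemma left_monomial_ordering_exists: "\<exists>r. left_monomial_ordering P E r"
proof -
  define r :: "fmon \<Rightarrow> fmon \<Rightarrow> bool" where
    "r = (\<lambda>(\<alpha>, i) (\<beta>, j). mless P \<alpha> \<beta> \<or> \<alpha> = \<beta> \<and> i < j)"
  have "left_monomial_ordering P E r"
  proof (rule left_monomial_orderingI)
    show "strict_total_order_on (expos P \<times> E) r"
      unfolding strict_total_order_on_def
    proof (intro conjI)
      show "irreflp_on (expos P \<times> E) r" by (auto simp: irreflp_on_def r_def mless_irrefl)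
      show "transp_on (expos P \<times> E) r"
        by (rule transp_onI) (auto simp: r_def intro: mless_trans)
      show "totalp_on (expos P \<times> E) r"
        by (rule totalp_onI) (use mless_total in \<open>fastforce simp: r_def\<close>)
    qed
  qed (auto simp: r_def mless_add_left)
  then show ?thesis by blast
qed

end

context module_order
begin

text \<open>The monomials of \<open>A\<^sup>G\<close> are compared by the leading monomials they produce in \<open>L\<close>; among those
  producing the same one, a later position is larger.\<close>

definition schreyer :: "'a vec list \<Rightarrow> fmon \<Rightarrow> fmon \<Rightarrow> bool" where
  "schreyer G = (\<lambda>(\<alpha>, k) (\<beta>, l).
     r (shift \<alpha> (LM P r (G ! k))) (shift \<beta> (LM P r (G ! l))) \<or>
     shift \<alpha> (LM P r (G ! k)) = shift \<beta> (LM P r (G ! l)) \<and> k < l)"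

lemma schreyer_Pair: "schreyer G (\<alpha>, k) (\<beta>, l) \<longleftrightarrow>
     r (shift \<alpha> (LM P r (G ! k))) (shift \<beta> (LM P r (G ! l))) \<or>
     shift \<alpha> (LM P r (G ! k)) = shift \<beta> (LM P r (G ! l)) \<and> k < l"
  by (simp add: schreyer_def)

lemma shift_inj: "shift \<alpha> m = shift \<beta> m \<longleftrightarrow> \<alpha> = \<beta>"
  by (simp add: shift_def)

lemma LM_nth_mons: "set G \<subseteq> fcar E - {0} \<Longrightarrow> k < length G \<Longrightarrow> LM P r (G ! k) \<in> mons"
  using LM_props(3)[of "G ! k"] nth_mem[of k G] by blast

text \<open>Heights are shifted along with monomials, and a position together with a height determines the
  exponent: hence compatibility and totality.\<close>

lemma schreyer_order:
  assumes G: "set G \<subseteq> fcar E - {0}"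
  shows "module_order P {..<length G} (schreyer G)"
proof unfold_locales
  show "finite {..<length G}" by simp
  have sm: "shift \<alpha> (LM P r (G ! k)) \<in> mons" if "\<alpha> \<in> expos P" "k < length G" for \<alpha> k
    using shift_mons[OF that(1) LM_nth_mons[OF G that(2)]] .
  show "left_monomial_ordering P {..<length G} (schreyer G)"
  proof (rule left_monomial_orderingI)
    show "strict_total_order_on (expos P \<times> {..<length G}) (schreyer G)"
      unfolding strict_total_order_on_def
    proof (intro conjI)
      show "irreflp_on (expos P \<times> {..<length G}) (schreyer G)"
        using sm r_irrefl by (auto simp: irreflp_on_def schreyer_Pair)
      show "transp_on (expos P \<times> {..<length G}) (schreyer G)"
      proof (rule transp_onI, clarify)
        fix \<alpha> k \<beta> l \<gamma> n
        assume *: "\<alpha> \<in> expos P" "k < length G" "\<beta> \<in> expos P" "l < length G" "\<gamma> \<in> expos P" "n < length G"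
          "schreyer G (\<alpha>, k) (\<beta>, l)" "schreyer G (\<beta>, l) (\<gamma>, n)"
        have "r (shift \<alpha> (LM P r (G ! k))) (shift \<gamma> (LM P r (G ! n)))"
          if "r (shift \<alpha> (LM P r (G ! k))) (shift \<beta> (LM P r (G ! l)))"
            "r (shift \<beta> (LM P r (G ! l))) (shift \<gamma> (LM P r (G ! n)))"
          using r_trans[OF that sm sm sm] * by blast
        then show "schreyer G (\<alpha>, k) (\<gamma>, n)"
          using *(7,8) unfolding schreyer_Pair by (elim disjE conjE) simp_all
      qed
      show "totalp_on (expos P \<times> {..<length G}) (schreyer G)"
      proof (rule totalp_onI)
        fix m n assume "m \<in> expos P \<times> {..<length G}" "n \<in> expos P \<times> {..<length G}" "m \<noteq> n"
        then obtain \<alpha> k \<beta> l where *: "m = (\<alpha>, k)" "n = (\<beta>, l)" "\<alpha> \<in> expos P" "k < length G"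
          "\<beta> \<in> expos P" "l < length G" "(\<alpha>, k) \<noteq> (\<beta>, l)"
          by (cases m, cases n) auto
        have "shift \<alpha> (LM P r (G ! k)) \<noteq> shift \<beta> (LM P r (G ! l)) \<or> k \<noteq> l"
          using *(7) by (auto simp: shift_inj)
        then show "schreyer G m n \<or> schreyer G n m"
          using r_total[OF sm[OF *(3,4)] sm[OF *(5,6)]] *(1,2) unfolding schreyer_Pair
          by (auto simp: schreyer_Pair)
      qed
    qed
  next
    fix \<alpha> \<beta> \<gamma> k l
    assume "schreyer G (\<alpha>, k) (\<beta>, l)" "(\<alpha>, k) \<in> expos P \<times> {..<length G}"
      "(\<beta>, l) \<in> expos P \<times> {..<length G}" "\<gamma> \<in> expos P"
    then show "schreyer G (\<gamma> + \<alpha>, k) (\<gamma> + \<beta>, l)"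
      using r_shift[OF _ sm[of \<alpha> k] sm[of \<beta> l], of \<gamma>]
      unfolding schreyer_Pair by (auto simp: shift_shift[symmetric])
  next
    fix \<alpha> \<beta> k assume "mless P \<alpha> \<beta>" "\<alpha> \<in> expos P" "\<beta> \<in> expos P" "k \<in> {..<length G}"
    then show "schreyer G (\<alpha>, k) (\<beta>, k)"
      unfolding schreyer_Pair using r_shift_less LM_nth_mons[OF G] by blast
  qed
qed

text \<open>The largest height occurring in \<open>h\<close>, the monomial by which Schreyer's ordering compares.\<close>

definition height :: "'a vec list \<Rightarrow> 'a vec \<Rightarrow> fmon" where
  "height G h = (case LM P (schreyer G) h of (\<tau>, i) \<Rightarrow> shift \<tau> (LM P r (G ! i)))"

lemma height_props:
  assumes G: "set G \<subseteq> fcar E - {0}" and h: "h \<in> fcar {..<length G}" "h \<noteq> 0"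
  shows "height G h \<in> mons"
    "(\<alpha>, k) \<in> vsupp h \<Longrightarrow> shift \<alpha> (LM P r (G ! k)) = height G h \<or> r (shift \<alpha> (LM P r (G ! k))) (height G h)"
proof -
  interpret S: module_order P "{..<length G}" "schreyer G" by (rule schreyer_order[OF G])
  obtain \<tau> i where LM: "LM P (schreyer G) h = (\<tau>, i)" by fastforce
  have *: "\<tau> \<in> expos P" "i < length G" using S.LM_components[OF h] LM by simp_all
  then show "height G h \<in> mons"
    unfolding height_def LM using shift_mons[OF *(1) LM_nth_mons[OF G *(2)]] by simp
  assume ak: "(\<alpha>, k) \<in> vsupp h"
  have "(\<alpha>, k) = (\<tau>, i) \<or> schreyer G (\<alpha>, k) (\<tau>, i)" using S.LM_props(2)[OF h ak] LM by simp
  then show "shift \<alpha> (LM P r (G ! k)) = height G h \<or> r (shift \<alpha> (LM P r (G ! k))) (height G h)"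
    unfolding height_def LM schreyer_Pair prod.case by (elim disjE conjE) simp_all
qed

lemma deg_LM:
  assumes "x \<in> fcar E" "x \<noteq> 0" "homv b d x"
  shows "deg P (fst (LM P r x)) + b (snd (LM P r x)) = d"
  using homvD[OF assms(3), of "fst (LM P r x)" "snd (LM P r x)"] LM_props(1)[OF assms(1,2)] by simp

lemma LM_row_mult_le_height:
  assumes G: "set G \<subseteq> fcar E - {0}" and h: "h \<in> fcar {..<length G}" and nz: "row_mult h G \<noteq> 0"
  shows "h \<noteq> 0" "LM P r (row_mult h G) = height G h \<or> r (LM P r (row_mult h G)) (height G h)"
proof -
  show h0: "h \<noteq> 0" using nz by auto
  note H = height_props[OF G h h0]
  have x: "row_mult h G \<in> fcar E" using G by (intro fcar_row_mult) auto
  have X: "LM P r (row_mult h G) \<in> mons" using LM_props(3)[OF x nz] .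
  show "LM P r (row_mult h G) = height G h \<or> r (LM P r (row_mult h G)) (height G h)"
  proof (rule ccontr)
    assume "\<not> ?thesis"
    then have hx: "r (height G h) (LM P r (row_mult h G))" using r_total[OF X H(1)] by blast
    have "r (shift \<alpha> (LM P r (G ! k))) (LM P r (row_mult h G))"
      if "(\<alpha>, k) \<in> vsupp h" "k < length G" for \<alpha> k
      using H(2)[OF that(1)] hx r_trans[OF _ hx _ H(1) X, of "shift \<alpha> (LM P r (G ! k))"]
        shift_mons[OF _ LM_nth_mons[OF G that(2)], of \<alpha>] that(1) by (auto simp: vsupp_def)
    then have "below (row_mult h G) (LM P r (row_mult h G))"
      by (rule below_row_mult[OF G X])
    then show False using LM_props(1)[OF x nz] r_irrefl[OF X] by (auto simp: below_def)
  qed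
qed

text \<open>The leading term of a single summand attaining the largest height could not be cancelled by the others,
which lie strictly below it.\<close>

lemma height_cancel:
  assumes G: "set G \<subseteq> fcar E - {0}" and h: "h \<in> fcar {..<length G}" "h \<noteq> 0"
    and LM: "LM P (schreyer G) h = (\<tau>, i)"
    and bel: "below (row_mult h G) (height G h)"
  shows "\<exists>j<i. \<exists>\<sigma>\<in>expos P. shift \<sigma> (LM P r (G ! j)) = shift \<tau> (LM P r (G ! i))"
proof (rule ccontr)
  assume "\<not> ?thesis"
  then have no: "shift \<sigma> (LM P r (G ! j)) \<noteq> shift \<tau> (LM P r (G ! i))" if "j < i" "\<sigma> \<in> expos P" for j \<sigma>
    using that by blast
  interpret S: module_order P "{..<length G}" "schreyer G" by (rule schreyer_order[OF G])
  have \<tau>: "\<tau> \<in> expos P" "i < length G" using S.LM_components[OF h] LM by simp_all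
  have g: "G ! i \<in> fcar E" "G ! i \<noteq> 0" using G \<tau>(2) nth_mem by auto
  have H: "height G h = shift \<tau> (LM P r (G ! i))" "height G h \<in> mons"
    using LM height_props(1)[OF G h] by (simp_all add: height_def)
  \<comment> \<open>without its leading term, \<open>h\<close> has all heights strictly below: nothing can cancel that term\<close>
  define c where "c = coef P (h i) \<tau>"
  have c: "c \<noteq> 0" using S.LM_props(1)[OF h] LM by (simp add: c_def vsupp_def)
  define t where "t = smulK P c (pbw P \<tau>)"
  define h' where "h' = h - single i t"
  have vs: "vsupp (single i t) = {(\<tau>, i)}" using c \<tau> by (simp add: t_def vsupp_single supp_smulK supp_pbw)
  have low: "r (shift \<alpha> (LM P r (G ! k))) (height G h)" if "(\<alpha>, k) \<in> vsupp h'" "k < length G" for \<alpha> k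
  proof -
    have ne: "(\<alpha>, k) \<noteq> (\<tau>, i)"
      using that(1) \<tau> by (auto simp: h'_def t_def c_def vsupp_def coef_pbw)
    then have "(\<alpha>, k) \<in> vsupp h" using that(1) vs vsupp_diff[of h "single i t"] by (auto simp: h'_def)
    then have "schreyer G (\<alpha>, k) (\<tau>, i)" using S.LM_props(2)[OF h] ne LM by metis
    then show ?thesis
      using no[of k \<alpha>] \<open>(\<alpha>, k) \<in> vsupp h\<close> by (auto simp: schreyer_Pair H vsupp_def)
  qed
  have "below (row_mult h' G) (height G h)" by (rule below_row_mult[OF G H(2) low])
  moreover have "row_mult h G - row_mult h' G = lmul t (G ! i)"
    using \<tau>(2) by (simp add: h'_def row_mult_diff row_mult_single)
  ultimately have "below (lmul t (G ! i)) (height G h)" using below_diff bel by metis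
  moreover have "height G h \<in> vsupp (lmul t (G ! i))"
    using LM_props(1)[of "lmul t (G ! i)"] LM_lmul_term[OF g \<tau>(1) c] g H by (simp add: t_def)
  ultimately show False using r_irrefl H by (auto simp: below_def)
qed


subsection \<open>S-polynomials\<close>

definition mlcm :: "fmon \<Rightarrow> fmon \<Rightarrow> fmon" where
  "mlcm m m' = ((\<lambda>k. max (fst m k) (fst m' k)), snd m)"

lemma mlcm_commute: "snd m = snd m' \<Longrightarrow> mlcm m m' = mlcm m' m"
  by (simp add: mlcm_def max.commute)

lemma mlcm_mons: "m \<in> mons \<Longrightarrow> m' \<in> mons \<Longrightarrow> mlcm m m' \<in> mons"
  by (auto simp: mlcm_def max_expos)

lemma mlcm_shift: "shift (fst (mlcm m m') - fst m) m = mlcm m m'"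
  by (auto simp: mlcm_def shift_def fun_eq_iff vec_apply)

lemma mlcm_least: "mon_dvd m n \<Longrightarrow> mon_dvd m' n \<Longrightarrow> mon_dvd (mlcm m m') n"
  by (simp add: mlcm_def mon_dvd_def)

lemma S_mult_props:
  assumes x: "x \<in> fcar E" "x \<noteq> 0" and y: "y \<in> fcar E" "y \<noteq> 0"
  defines "\<gamma> \<equiv> fst (mlcm (LM P r x) (LM P r y)) - fst (LM P r x)"
  shows "supp (S_mult P r x y) = {\<gamma>}" "\<gamma> \<in> expos P"
    "LM P r (lmul (S_mult P r x y) x) = mlcm (LM P r x) (LM P r y)"
    "LC P r (lmul (S_mult P r x y) x) = 1" "lmul (S_mult P r x y) x \<noteq> 0"
proof -
  have "fst (mlcm (LM P r x) (LM P r y)) \<in> expos P"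
    using mlcm_mons LM_props(3) x y by (auto simp: mem_Times_iff)
  then show \<gamma>: "\<gamma> \<in> expos P" unfolding \<gamma>_def by (rule minus_expos)
  have S: "S_mult P r x y = smulK P (1 / LC P r (lmul (pbw P \<gamma>) x)) (pbw P \<gamma>)"
    by (simp add: S_mult_def Let_def \<gamma>_def mlcm_def)
  have nz: "LC P r (lmul (pbw P \<gamma>) x) \<noteq> 0"
    using LM_lmul_pbw[OF x \<gamma>] x by (intro LC_nz) auto
  show "supp (S_mult P r x y) = {\<gamma>}" unfolding S using nz \<gamma> by (simp add: supp_smulK supp_pbw)
  show "LM P r (lmul (S_mult P r x y) x) = mlcm (LM P r x) (LM P r y)"
    "LC P r (lmul (S_mult P r x y) x) = 1" "lmul (S_mult P r x y) x \<noteq> 0"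
    unfolding S using LM_lmul_term[OF x \<gamma>, of "1 / LC P r (lmul (pbw P \<gamma>) x)"] nz
    by (simp_all add: \<gamma>_def mlcm_shift)
qed

lemma S_mult_deg:
  assumes x: "x \<in> fcar E" "x \<noteq> 0" "homv b d x" and y: "y \<in> fcar E" "y \<noteq> 0"
    and \<alpha>: "\<alpha> \<in> supp (S_mult P r x y)"
  shows "deg P \<alpha> + d = S_deg P b r x y"
proof -
  have \<alpha>: "\<alpha> = fst (mlcm (LM P r x) (LM P r y)) - fst (LM P r x)"
    using S_mult_props(1)[OF x(1,2) y] \<alpha> by simp
  have "\<alpha> + fst (LM P r x) = fst (mlcm (LM P r x) (LM P r y))"
    unfolding \<alpha> using mlcm_shift[of "LM P r x" "LM P r y"] by (metis fst_shift)
  then have "deg P \<alpha> + deg P (fst (LM P r x)) = deg P (fst (mlcm (LM P r x) (LM P r y)))"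
    by (metis deg_add)
  then show ?thesis using deg_LM[OF x] by (simp add: S_deg_def mlcm_def)
qed

lemma S_deg_commute: "snd (LM P r x) = snd (LM P r y) \<Longrightarrow> S_deg P b r x y = S_deg P b r y x"
  by (simp add: S_deg_def max.commute)

text \<open>The two multiples of \<open>x\<close> and \<open>y\<close> have the same leading term, with coefficient \<open>1\<close>.\<close>

lemma S_poly_props:
  assumes x: "x \<in> fcar E" "x \<noteq> 0" and y: "y \<in> fcar E" "y \<noteq> 0" and "snd (LM P r x) = snd (LM P r y)"
  shows "S_poly P r x y \<in> fcar E" "below (S_poly P r x y) (mlcm (LM P r x) (LM P r y))"
    "homv b dx x \<Longrightarrow> homv b dy y \<Longrightarrow> homv b (S_deg P b r x y) (S_poly P r x y)"
proof -
  note Sx = S_mult_props[OF x y] and Sy = S_mult_props[OF y x]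
  have comm: "mlcm (LM P r y) (LM P r x) = mlcm (LM P r x) (LM P r y)"
    using assms(5) by (simp add: mlcm_commute)
  show "S_poly P r x y \<in> fcar E" using x y by (simp add: S_poly_def)
  show "below (S_poly P r x y) (mlcm (LM P r x) (LM P r y))"
    unfolding S_poly_def using below_cancel[of "lmul (S_mult P r x y) x" "lmul (S_mult P r y x) y"]
      Sx Sy x y comm by simp
  show "homv b dx x \<Longrightarrow> homv b dy y \<Longrightarrow> homv b (S_deg P b r x y) (S_poly P r x y)"
    unfolding S_poly_def
    using homv_lmul[OF S_mult_deg[OF x _ y]] homv_lmul[OF S_mult_deg[OF y _ x]]
      S_deg_commute[OF assms(5)] by (auto intro: homv_diff)
qed

text \<open>The row recorded when an S-polynomial is reduced with quotients \<open>q\<close>; a syzygy of \<open>G\<close> when the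
  remainder is \<open>0\<close>.\<close>

definition pair_syz :: "'a vec list \<Rightarrow> nat \<Rightarrow> nat \<Rightarrow> 'a vec \<Rightarrow> 'a vec" where
  "pair_syz G i j q = single i (S_mult P r (G ! i) (G ! j)) - single j (S_mult P r (G ! j) (G ! i)) - q"

lemma row_mult_pair_syz:
  "i < length G \<Longrightarrow> j < length G \<Longrightarrow>
    row_mult (pair_syz G i j q) G = S_poly P r (G ! i) (G ! j) - row_mult q G"
  by (simp add: pair_syz_def row_mult_diff row_mult_single S_poly_def)

text \<open>The later position \<open>j\<close> wins the tie between the two terms producing the least common
  multiple.\<close>

lemma LM_pair_syz:
  assumes G: "set G \<subseteq> fcar E - {0}" and ij: "i < j" "j < length G"
    and comp: "snd (LM P r (G ! i)) = snd (LM P r (G ! j))"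
    and q: "q \<in> fcar {..<length G}" "heights_below G q (mlcm (LM P r (G ! i)) (LM P r (G ! j)))"
  defines "m \<equiv> mlcm (LM P r (G ! i)) (LM P r (G ! j))"
  shows "pair_syz G i j q \<in> fcar {..<length G}" "pair_syz G i j q \<noteq> 0"
    "LM P (schreyer G) (pair_syz G i j q) = (fst m - fst (LM P r (G ! j)), j)"
proof -
  interpret S: module_order P "{..<length G}" "schreyer G" by (rule schreyer_order[OF G])
  have gi: "G ! i \<in> fcar E" "G ! i \<noteq> 0" and gj: "G ! j \<in> fcar E" "G ! j \<noteq> 0"
    using subsetD[OF G nth_mem[of i]] subsetD[OF G nth_mem[of j]] ij by auto
  have m': "m = mlcm (LM P r (G ! j)) (LM P r (G ! i))"
    unfolding m_def using comp by (rule mlcm_commute)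
  have mm: "m \<in> mons" unfolding m_def using mlcm_mons LM_props(3) gi gj by blast
  define \<sigma>i where "\<sigma>i = fst m - fst (LM P r (G ! i))"
  define \<sigma>j where "\<sigma>j = fst m - fst (LM P r (G ! j))"
  have si: "supp (S_mult P r (G ! i) (G ! j)) = {\<sigma>i}" "shift \<sigma>i (LM P r (G ! i)) = m"
    using S_mult_props(1)[OF gi gj] mlcm_shift by (simp_all add: m_def \<sigma>i_def)
  have sj: "supp (S_mult P r (G ! j) (G ! i)) = {\<sigma>j}" "shift \<sigma>j (LM P r (G ! j)) = m"
    using S_mult_props(1)[OF gj gi] mlcm_shift by (simp_all add: m' \<sigma>j_def)
  show fc: "pair_syz G i j q \<in> fcar {..<length G}"
    using ij q by (simp add: pair_syz_def fcar_single)
  have "(\<sigma>j, j) \<notin> vsupp q"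
    using q(2) sj(2) r_irrefl[OF mm] unfolding heights_below_def m_def[symmetric] by fastforce
  moreover have "\<sigma>j \<in> supp (S_mult P r (G ! j) (G ! i))" using sj by simp
  ultimately have top: "(\<sigma>j, j) \<in> vsupp (pair_syz G i j q)"
    using ij by (auto simp: vsupp_def supp_def pair_syz_def single_def)
  then show "pair_syz G i j q \<noteq> 0" by auto
  show "LM P (schreyer G) (pair_syz G i j q) = (fst m - fst (LM P r (G ! j)), j)"
    unfolding \<sigma>j_def[symmetric]
  proof (rule S.LM_eqI[OF fc top])
    fix n assume n: "n \<in> vsupp (pair_syz G i j q)" "n \<noteq> (\<sigma>j, j)"
    then have "n = (\<sigma>i, i) \<or> n \<in> vsupp q"
      using vsupp_diff[of "single i (S_mult P r (G ! i) (G ! j)) - single j (S_mult P r (G ! j) (G ! i))" q]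
        vsupp_diff[of "single i (S_mult P r (G ! i) (G ! j))" "single j (S_mult P r (G ! j) (G ! i))"]
      by (auto simp: pair_syz_def vsupp_single si sj)
    then show "schreyer G n (\<sigma>j, j)"
    proof
      assume "n = (\<sigma>i, i)"
      then show ?thesis using si(2) sj(2) ij by (simp add: schreyer_Pair)
    next
      assume "n \<in> vsupp q"
      then show ?thesis
        using q(2) sj(2) unfolding heights_below_def m_def[symmetric]
        by (cases n) (auto simp: schreyer_Pair)
    qed
  qed
qed


subsection \<open>Standard representations\<close>

text \<open>One reduction argument serves Buchberger's criterion, also in its version truncated at a
  degree, and the generation of the syzygy module.  Suppose that each pair of generators whose least
  common multiple has degree at most \<open>d\<close> has in \<open>Z\<close> a syzygy with Schreyer's leading monomial.
  While the largest height of \<open>h\<close> cancels, one of these syzygies lowers the leading monomial of \<open>h\<close>.\<close>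

lemma standard_representation:
  assumes G: "set G \<subseteq> fcar E - {0}" and Z: "closed_submodule Z"
    and pairs: "\<And>i j. i < j \<Longrightarrow> j < length G \<Longrightarrow> snd (LM P r (G ! i)) = snd (LM P r (G ! j)) \<Longrightarrow>
      S_deg P b r (G ! i) (G ! j) \<le> d \<Longrightarrow>
      \<exists>z\<in>Z. z \<in> fcar {..<length G} \<and> z \<noteq> 0 \<and> row_mult z G = 0 \<and>
        LM P (schreyer G) z
          = (fst (mlcm (LM P r (G ! i)) (LM P r (G ! j))) - fst (LM P r (G ! j)), j) \<and>
        homv dv (S_deg P b r (G ! i) (G ! j)) z"
    and dv: "\<And>k. k < length G \<Longrightarrow> homv b (dv k) (G ! k)"
    and h: "h \<in> fcar {..<length G}" "\<And>\<alpha> k. (\<alpha>, k) \<in> vsupp h \<Longrightarrow> deg P \<alpha> + dv k \<le> d"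
  shows "\<exists>h'\<in>fcar {..<length G}. h - h' \<in> Z \<and> row_mult h' G = row_mult h G \<and>
    (row_mult h G = 0 \<longrightarrow> h' = 0) \<and>
    (row_mult h G \<noteq> 0 \<longrightarrow> h' \<noteq> 0 \<and> LM P r (row_mult h G) = height G h')"
proof -
  interpret S: module_order P "{..<length G}" "schreyer G" by (rule schreyer_order[OF G])
  let ?R = "{(m', m). m' \<in> S.mons \<and> m \<in> S.mons \<and> schreyer G m' m}"
  have main: "h \<noteq> 0 \<Longrightarrow> LM P (schreyer G) h = m \<Longrightarrow> h \<in> fcar {..<length G} \<Longrightarrow>
    (\<And>\<alpha> k. (\<alpha>, k) \<in> vsupp h \<Longrightarrow> deg P \<alpha> + dv k \<le> d) \<Longrightarrow>
    \<exists>h'\<in>fcar {..<length G}. h - h' \<in> Z \<and> row_mult h' G = row_mult h G \<and>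
    (row_mult h G = 0 \<longrightarrow> h' = 0) \<and>
    (row_mult h G \<noteq> 0 \<longrightarrow> h' \<noteq> 0 \<and> LM P r (row_mult h G) = height G h')" for m h
  proof (induction m arbitrary: h rule: wf_induct_rule[OF S.wf_r])
    case (1 m h)
    note h0 = 1(2) and LMm = 1(3) and hf = 1(4) and hd = 1(5)
    note H = height_props[OF G hf h0]
    have xE: "row_mult h G \<in> fcar E" using G by (intro fcar_row_mult) auto
    show ?case
    proof (cases "row_mult h G \<noteq> 0 \<and> LM P r (row_mult h G) = height G h")
      case True
      then show ?thesis using hf h0 closed_submoduleD(1)[OF Z] by (intro bexI[of _ h]) auto
    next
      case False
      then have bel: "below (row_mult h G) (height G h)"
        unfolding below_iff_LM[OF xE H(1)] using LM_row_mult_le_height(2)[OF G hf] by blast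
      obtain \<tau> i where LM: "LM P (schreyer G) h = (\<tau>, i)" by fastforce
      obtain j \<sigma> where j: "j < i" "\<sigma> \<in> expos P"
        "shift \<sigma> (LM P r (G ! j)) = shift \<tau> (LM P r (G ! i))"
        using height_cancel[OF G hf h0 LM bel] by blast
      have \<tau>: "\<tau> \<in> expos P" "i < length G" using S.LM_components[OF hf h0] LM by simp_all
      let ?n = "mlcm (LM P r (G ! j)) (LM P r (G ! i))"
      have comp: "snd (LM P r (G ! j)) = snd (LM P r (G ! i))" using j(3) by (metis snd_shift)
      have ndvd: "mon_dvd ?n (shift \<tau> (LM P r (G ! i)))"
        using mon_dvd_shift j(3) by (metis mlcm_least)
      have gi: "G ! i \<in> fcar E" "G ! i \<noteq> 0" using G \<tau>(2) nth_mem by auto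
      have dvi: "deg P (fst (LM P r (G ! i))) + b (snd (LM P r (G ! i))) = dv i"
        by (rule deg_LM[OF gi dv[OF \<tau>(2)]])
      define \<delta> where "\<delta> = fst (shift \<tau> (LM P r (G ! i))) - fst ?n"
      have \<delta>: "\<delta> + fst ?n = \<tau> + fst (LM P r (G ! i))"
        using mon_dvd_imp_shift[OF ndvd] by (metis \<delta>_def fst_shift)
      have ddeg: "deg P \<delta> + S_deg P b r (G ! j) (G ! i) = deg P \<tau> + dv i"
        using arg_cong[OF \<delta>, of "deg P"] dvi comp by (simp add: S_deg_def mlcm_def)
      \<comment> \<open>the least common multiple divides the height of \<open>h\<close>, so its degree is at most \<open>d\<close> too\<close>
      have "deg P \<tau> + dv i \<le> d" using hd S.LM_props(1)[OF hf h0] LM by simp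
      then have "S_deg P b r (G ! j) (G ! i) \<le> d" using ddeg by simp
      then obtain z where z: "z \<in> Z" "z \<in> fcar {..<length G}" "z \<noteq> 0" "row_mult z G = 0"
          "LM P (schreyer G) z = (fst ?n - fst (LM P r (G ! i)), i)"
          "homv dv (S_deg P b r (G ! j) (G ! i)) z"
        using pairs[OF j(1) \<tau>(2) comp] by blast
      have "fst ?n k \<le> \<tau> k + fst (LM P r (G ! i)) k" for k
        using ndvd by (simp add: mon_dvd_def vec_apply)
      then have zdvd: "mon_dvd (LM P (schreyer G) z) (LM P (schreyer G) h)"
        by (simp add: z(5) LM mon_dvd_def le_diff_conv)
      define \<gamma> where "\<gamma> = fst (LM P (schreyer G) h) - fst (LM P (schreyer G) z)"
      define u where "u = smulK P (LC P (schreyer G) h / LC P (schreyer G) (lmul (pbw P \<gamma>) z)) (pbw P \<gamma>)"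
      note C = S.leading_term_cancel[OF hf h0 z(2,3) zdvd, folded \<gamma>_def, folded u_def]
      \<comment> \<open>one reduction step of \<open>h\<close> by \<open>z\<close>, with respect to Schreyer's ordering\<close>
      define h1 where "h1 = h - lmul u z"
      have h1: "h1 \<in> fcar {..<length G}" using hf z(2) by (simp add: h1_def)
      have rm1: "row_mult h1 G = row_mult h G"
        by (simp add: h1_def row_mult_diff row_mult_lmul z(4) lmul_simps)
      have hh1: "h - h1 \<in> Z" using closed_submoduleD(3)[OF Z z(1)] by (simp add: h1_def)
      have "\<gamma> + fst (LM P (schreyer G) z) = \<tau>" using C(3) LM by (metis fst_conv fst_shift)
      then have gd: "deg P \<gamma> + S_deg P b r (G ! j) (G ! i) = deg P \<tau> + dv i"
      proof -
        have zi: "(fst (LM P (schreyer G) z), i) \<in> vsupp z"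
          using S.LM_props(1)[OF z(2,3)] z(5) by simp
        have "deg P (fst (LM P (schreyer G) z)) + dv i = S_deg P b r (G ! j) (G ! i)"
          by (rule homvD[OF z(6) zi])
        moreover have "deg P \<gamma> + deg P (fst (LM P (schreyer G) z)) = deg P \<tau>"
          using \<open>\<gamma> + fst (LM P (schreyer G) z) = \<tau>\<close> by (metis deg_add)
        ultimately show ?thesis by simp
      qed
      have "homv dv (deg P \<tau> + dv i) (lmul u z)"
        by (rule homv_lmul[OF _ z(6)]) (use C(2) gd in simp)
      then have h1d: "deg P \<alpha> + dv k \<le> d" if "(\<alpha>, k) \<in> vsupp h1" for \<alpha> k
        using that vsupp_diff[of h "lmul u z"] hd[of \<alpha> k] \<open>deg P \<tau> + dv i \<le> d\<close>
          homvD[OF \<open>homv dv (deg P \<tau> + dv i) (lmul u z)\<close>, of \<alpha> k]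
        unfolding h1_def by fastforce
      show ?thesis
      proof (cases "h1 = 0")
        case True
        then show ?thesis using hh1 rm1 by (intro bexI[of _ 0]) auto
      next
        case h10: False
        have "schreyer G (LM P (schreyer G) h1) m"
          using C(1) S.below_iff_LM[OF h1 S.LM_props(3)[OF hf h0]] h10 LMm
          by (simp add: h1_def)
        then have "(LM P (schreyer G) h1, m) \<in> ?R"
          using S.LM_props(3)[OF hf h0] S.LM_props(3)[OF h1 h10] LMm by simp
        then have "\<exists>h'\<in>fcar {..<length G}. h1 - h' \<in> Z \<and> row_mult h' G = row_mult h1 G \<and>
            (row_mult h1 G = 0 \<longrightarrow> h' = 0) \<and>
            (row_mult h1 G \<noteq> 0 \<longrightarrow> h' \<noteq> 0 \<and> LM P r (row_mult h1 G) = height G h')"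
          by (rule 1(1)[OF _ h10 refl h1]) (rule h1d)
        then obtain h' where h': "h' \<in> fcar {..<length G}" "h1 - h' \<in> Z" "row_mult h' G = row_mult h1 G"
          "row_mult h1 G = 0 \<longrightarrow> h' = 0" "row_mult h1 G \<noteq> 0 \<longrightarrow> h' \<noteq> 0 \<and> LM P r (row_mult h1 G) = height G h'"
          by blast
        have "h - h' \<in> Z" using closed_submoduleD(2)[OF Z hh1 h'(2)] by simp
        then show ?thesis using h' rm1 by (intro bexI[of _ h']) (simp_all del: minus_apply)
      qed
    qed
  qed
  show ?thesis
  proof (cases "h = 0")
    case True
    then show ?thesis using closed_submoduleD(1)[OF Z] by (intro bexI[of _ 0]) auto
  qed (use main[OF _ refl h] in blast)
qed

lemma height_mon_dvd:
  assumes "set G \<subseteq> fcar E - {0}" "h \<in> fcar {..<length G}" "h \<noteq> 0"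
  shows "\<exists>g\<in>set G. mon_dvd (LM P r g) (height G h)"
proof -
  interpret S: module_order P "{..<length G}" "schreyer G" by (rule schreyer_order[OF assms(1)])
  obtain \<tau> i where LM: "LM P (schreyer G) h = (\<tau>, i)" by fastforce
  have "i < length G" using S.LM_components(2)[OF assms(2,3)] LM by simp
  then show ?thesis
    unfolding height_def LM prod.case by (intro bexI[of _ "G ! i"] mon_dvd_shift nth_mem)
qed

end

declare minus_apply [simp del] uminus_apply [simp del]

section \<open>Free resolutions of length at most the number of variables\<close>

text \<open>For a submodule \<open>N\<close> of a free module \<open>L\<close>: the quotient \<open>L/N\<close> has a free resolution
  \<open>0 \<rightarrow> F\<^sub>m \<rightarrow> \<dots> \<rightarrow> F\<^sub>1 \<rightarrow> L\<close> with finite bases.  The resolution need be neither graded nor minimal.\<close>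

primrec short_res :: "nat \<Rightarrow> 'a::ring_1 vec set \<Rightarrow> bool" where
  "short_res 0 N \<longleftrightarrow> N = {0}"
| "short_res (Suc m) N \<longleftrightarrow> (\<exists>G. N = row_space G \<and> short_res m (syz G))"

context module_order
begin

lemma groebner_remainder_zero:
  assumes "closed_submodule N" "N \<subseteq> fcar E" "set G \<subseteq> N - {0}"
    and gb: "\<And>x. x \<in> N \<Longrightarrow> x \<noteq> 0 \<Longrightarrow> \<exists>g\<in>set G. mon_dvd (LM P r g) (LM P r x)"
    and "x \<in> N" "division P r G x q \<rho>"
  shows "\<rho> = 0"
proof (rule ccontr)
  assume "\<rho> \<noteq> 0"
  have G: "set G \<subseteq> fcar E - {0}" and x: "x \<in> fcar E" using assms by auto
  note D = division_props[OF G x assms(6)]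
  have "row_mult q G \<in> N" using assms(1,3) by (intro closed_submodule_row_mult) auto
  then have "x - row_mult q G \<in> N" using closed_submoduleD(4)[OF assms(1)] assms(5) by blast
  then have "\<rho> \<in> N" using D(3) by simp
  then obtain g where "g \<in> set G" "mon_dvd (LM P r g) (LM P r \<rho>)" using gb \<open>\<rho> \<noteq> 0\<close> by blast
  then show False using D(6)[OF \<open>\<rho> \<noteq> 0\<close>] by (metis in_set_conv_nth)
qed

lemma groebner_spans:
  assumes "closed_submodule N" "N \<subseteq> fcar E" "set G \<subseteq> N - {0}"
    and gb: "\<And>x. x \<in> N \<Longrightarrow> x \<noteq> 0 \<Longrightarrow> \<exists>g\<in>set G. mon_dvd (LM P r g) (LM P r x)"
  shows "N = row_space G"
proof
  have G: "set G \<subseteq> fcar E - {0}" using assms by auto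
  show "row_space G \<subseteq> N" using assms(1,3) by (auto intro!: closed_submodule_row_mult)
  show "N \<subseteq> row_space G"
  proof
    fix x assume x: "x \<in> N"
    then have xE: "x \<in> fcar E" using assms(2) by blast
    obtain q \<rho> where div: "division P r G x q \<rho>" by (rule division_exists[OF G xE])
    then have "x = row_mult q G"
      using groebner_remainder_zero[OF assms x div] division_props(3)[OF G xE div] by simp
    then show "x \<in> row_space G" by blast
  qed
qed

end

context weighted_solvable
begin

text \<open>The leading monomials of \<open>N\<close> are generated by monomials without the first \<open>k\<close> variables.\<close>

definition avoids :: "(fmon \<Rightarrow> fmon \<Rightarrow> bool) \<Rightarrow> nat \<Rightarrow> 'a vec set \<Rightarrow> bool" where
  "avoids r k N \<longleftrightarrow> (\<forall>x\<in>N. x \<noteq> 0 \<longrightarrow>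
     (\<exists>y\<in>N. y \<noteq> 0 \<and> mon_dvd (LM P r y) (LM P r x) \<and> (\<forall>l<k. fst (LM P r y) l = 0)))"

end

context module_order
begin

text \<open>Dickson's lemma is applied to the leading monomials without the first \<open>k\<close> variables only.\<close>

lemma avoiding_groebner_basis:
  assumes N: "N \<subseteq> fcar E" and av: "avoids r k N"
  obtains G where "set G \<subseteq> N - {0}"
    "\<And>x. x \<in> N \<Longrightarrow> x \<noteq> 0 \<Longrightarrow> \<exists>g\<in>set G. mon_dvd (LM P r g) (LM P r x)"
    "\<And>g l. g \<in> set G \<Longrightarrow> l < k \<Longrightarrow> fst (LM P r g) l = 0"
proof -
  define Y where "Y = {y \<in> N. y \<noteq> 0 \<and> (\<forall>l<k. fst (LM P r y) l = 0)}"
  have "LM P r ` Y \<subseteq> mons" using LM_props(3) N unfolding Y_def by blast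
  then obtain B where B: "finite B" "B \<subseteq> LM P r ` Y" "\<And>m. m \<in> LM P r ` Y \<Longrightarrow> \<exists>b\<in>B. mon_dvd b m"
    using dickson_basis[OF finite_E] by metis
  obtain Z where Z: "finite Z" "Z \<subseteq> Y" "B = LM P r ` Z"
    using finite_subset_image[OF B(1,2)] by blast
  obtain G where G: "set G = Z" using finite_list[OF Z(1)] by blast
  have "\<exists>g\<in>set G. mon_dvd (LM P r g) (LM P r x)" if x: "x \<in> N" "x \<noteq> 0" for x
  proof -
    obtain y where y: "y \<in> Y" "mon_dvd (LM P r y) (LM P r x)"
      using av x unfolding avoids_def Y_def by blast
    then obtain b where "b \<in> B" "mon_dvd b (LM P r y)" using B(3) by blast
    then show ?thesis using Z(3) G y(2) mon_dvd_trans by blast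
  qed
  then show ?thesis using that[of G] G Z(2) by (auto simp: Y_def)
qed

text \<open>Sorting a Groebner basis by the exponents of \<open>a\<^sub>k\<close> keeps \<open>a\<^sub>k\<close> out of the leading monomials of
  the syzygies: the cofactor of the later of two generators in their least common multiple does not
  involve \<open>a\<^sub>k\<close>.\<close>

lemma syz_avoids:
  assumes N: "closed_submodule N" "N \<subseteq> fcar E" and G: "set G \<subseteq> N - {0}"
    and gb: "\<And>x. x \<in> N \<Longrightarrow> x \<noteq> 0 \<Longrightarrow> \<exists>g\<in>set G. mon_dvd (LM P r g) (LM P r x)"
    and av: "\<And>g l. g \<in> set G \<Longrightarrow> l < k \<Longrightarrow> fst (LM P r g) l = 0"
    and sorted: "\<And>i j. i < j \<Longrightarrow> j < length G \<Longrightarrow> fst (LM P r (G ! i)) k \<le> fst (LM P r (G ! j)) k"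
  shows "avoids (schreyer G) (Suc k) (syz G)"
  unfolding avoids_def
proof (intro ballI impI)
  have GE: "set G \<subseteq> fcar E - {0}" using G N by auto
  interpret S: module_order P "{..<length G}" "schreyer G" by (rule schreyer_order[OF GE])
  fix h assume h: "h \<in> syz G" "h \<noteq> 0"
  then have hf: "h \<in> fcar {..<length G}" and h0: "row_mult h G = 0" by (simp_all add: syz_iff)
  obtain \<tau> i where LM: "LM P (schreyer G) h = (\<tau>, i)" by fastforce
  obtain j \<sigma> where j: "j < i" "shift \<sigma> (LM P r (G ! j)) = shift \<tau> (LM P r (G ! i))"
    using height_cancel[OF GE hf h(2) LM] h0 by auto
  have i: "i < length G" using S.LM_components(2)[OF hf h(2)] LM by simp
  have comp: "snd (LM P r (G ! j)) = snd (LM P r (G ! i))" using j(2) by (metis snd_shift)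
  have gi: "G ! i \<in> N" "G ! i \<in> fcar E" "G ! i \<noteq> 0" "G ! i \<in> set G"
    using nth_mem[OF i] G N by auto
  have "j < length G" using i j by simp
  then have "G ! j \<in> set G" by simp
  then have gj: "G ! j \<in> N" "G ! j \<in> fcar E" "G ! j \<noteq> 0" "G ! j \<in> set G"
    using G N by auto
  let ?n = "mlcm (LM P r (G ! j)) (LM P r (G ! i))"
  have nm: "?n \<in> mons" using mlcm_mons LM_props(3) gi gj by blast
  note Sp = S_poly_props[OF gj(2,3) gi(2,3) comp]
  obtain q \<rho> where div: "division P r G (S_poly P r (G ! j) (G ! i)) q \<rho>"
    by (rule division_exists[OF GE Sp(1)])
  note D = division_props[OF GE Sp(1) div]
  have "S_poly P r (G ! j) (G ! i) \<in> N"
    unfolding S_poly_def using closed_submoduleD(3,4)[OF N(1)] gi gj by blast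
  then have "\<rho> = 0" using groebner_remainder_zero[OF N G gb _ div] by blast
  note L = LM_pair_syz[OF GE j(1) i comp D(1) D(4)[OF nm Sp(2)]]
  define w where "w = pair_syz G j i q"
  have "row_mult w G = 0"
    unfolding w_def using row_mult_pair_syz[of j G i q] i j D(3) \<open>\<rho> = 0\<close> by simp
  then have "w \<in> syz G" "w \<noteq> 0" using L by (simp_all add: w_def syz_iff)
  moreover have "mon_dvd (LM P (schreyer G) w) (LM P (schreyer G) h)"
  proof -
    have "mon_dvd ?n (shift \<tau> (LM P r (G ! i)))" using mon_dvd_shift j(2) by (metis mlcm_least)
    then have "fst ?n l \<le> \<tau> l + fst (LM P r (G ! i)) l" for l
      by (simp add: mon_dvd_def vec_apply)
    then show ?thesis
      by (simp add: w_def L LM mon_dvd_def le_diff_conv minus_apply)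
  qed
  moreover have "fst (LM P (schreyer G) w) l = 0" if "l < Suc k" for l
  proof (cases "l = k")
    case True
    then show ?thesis using sorted[OF j(1) i] by (simp add: w_def L mlcm_def minus_apply)
  next
    case False
    then show ?thesis using that av[OF gi(4), of l] av[OF gj(4), of l]
      by (simp add: w_def L mlcm_def minus_apply)
  qed
  ultimately show "\<exists>y\<in>syz G. y \<noteq> 0 \<and> mon_dvd (LM P (schreyer G) y) (LM P (schreyer G) h) \<and>
      (\<forall>l<Suc k. fst (LM P (schreyer G) y) l = 0)" by blast
qed

text \<open>When at most the last variable occurs, the leading monomials in each component are the
  multiples of a single one; one generator for each component leaves no room for syzygies.\<close>

lemma free_if_one_variable:
  assumes N: "closed_submodule N" "N \<subseteq> fcar E" and av: "avoids r k N" and k: "Suc k = nvars P"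
  shows "short_res (Suc 0) N"
proof -
  define Y where "Y = {y \<in> N. y \<noteq> 0 \<and> (\<forall>l<k. fst (LM P r y) l = 0)}"
  define I where "I = (\<lambda>y. snd (LM P r y)) ` Y"
  have Y: "y \<in> fcar E" "y \<noteq> 0" "y \<in> N" "\<And>l. l < k \<Longrightarrow> fst (LM P r y) l = 0" if "y \<in> Y" for y
    using that N by (auto simp: Y_def)
  have "I \<subseteq> E" using LM_components(2) Y by (auto simp: I_def)
  then have finI: "finite I" using finite_E finite_subset by blast
  have "\<exists>y. y \<in> Y \<and> snd (LM P r y) = i \<and>
      (\<forall>y'. y' \<in> Y \<and> snd (LM P r y') = i \<longrightarrow> fst (LM P r y) k \<le> fst (LM P r y') k)" if "i \<in> I" for i
  proof -
    obtain y0 where "y0 \<in> Y \<and> snd (LM P r y0) = i" using \<open>i \<in> I\<close> unfolding I_def by blast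
    then show ?thesis
      using ex_has_least_nat[of "\<lambda>y. y \<in> Y \<and> snd (LM P r y) = i" y0 "\<lambda>y. fst (LM P r y) k"] by blast
  qed
  then obtain g where g: "\<And>i. i \<in> I \<Longrightarrow> g i \<in> Y" "\<And>i. i \<in> I \<Longrightarrow> snd (LM P r (g i)) = i"
    "\<And>i y. i \<in> I \<Longrightarrow> y \<in> Y \<Longrightarrow> snd (LM P r y) = i \<Longrightarrow> fst (LM P r (g i)) k \<le> fst (LM P r y) k"
    by metis
  define ls where "ls = sorted_list_of_set I"
  have ls: "set ls = I" "distinct ls" using finI by (simp_all add: ls_def)
  define G where "G = map g ls"
  have G: "set G \<subseteq> N - {0}" using g(1) Y ls(1) by (auto simp: G_def)
  have GE: "set G \<subseteq> fcar E - {0}" using G N by auto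
  have gb: "\<exists>g\<in>set G. mon_dvd (LM P r g) (LM P r x)" if x: "x \<in> N" "x \<noteq> 0" for x
  proof -
    obtain y where y: "y \<in> Y" "mon_dvd (LM P r y) (LM P r x)"
      using av x unfolding avoids_def Y_def by blast
    define i where "i = snd (LM P r y)"
    have i: "i \<in> I" using y(1) by (auto simp: I_def i_def)
    have "mon_dvd (LM P r (g i)) (LM P r y)"
      unfolding mon_dvd_def
    proof (intro conjI allI)
      show "snd (LM P r (g i)) = snd (LM P r y)" using g(2)[OF i] by (simp add: i_def)
      fix l
      consider "l < k" | "l = k" | "l \<ge> nvars P" using k by linarith
      then show "fst (LM P r (g i)) l \<le> fst (LM P r y) l"
      proof cases
        case 1
        then show ?thesis using Y(4)[OF g(1)[OF i]] by simp
      next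
        case 2
        then show ?thesis using g(3)[OF i y(1)] by (simp add: i_def)
      next
        case 3
        then show ?thesis using LM_components(1)[OF Y(1,2)[OF g(1)[OF i]]] by (simp add: expos_def)
      qed
    qed
    then have "mon_dvd (LM P r (g i)) (LM P r x)" using y(2) by (rule mon_dvd_trans)
    then show ?thesis using i ls(1) by (auto simp: G_def)
  qed
  have "h = 0" if h: "h \<in> syz G" for h
  proof (rule ccontr)
    assume h0: "h \<noteq> 0"
    interpret S: module_order P "{..<length G}" "schreyer G" by (rule schreyer_order[OF GE])
    have hf: "h \<in> fcar {..<length G}" and hz: "row_mult h G = 0" using h by (simp_all add: syz_iff)
    obtain \<tau> i where LM: "LM P (schreyer G) h = (\<tau>, i)" by fastforce
    obtain j \<sigma> where j: "j < i" "shift \<sigma> (LM P r (G ! j)) = shift \<tau> (LM P r (G ! i))"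
      using height_cancel[OF GE hf h0 LM] hz by auto
    have i: "i < length ls" using S.LM_components(2)[OF hf h0] LM by (simp add: G_def)
    have "snd (LM P r (G ! j)) = snd (LM P r (G ! i))" using j(2) by (metis snd_shift)
    then have "ls ! j = ls ! i"
      using i j(1) g(2) ls(1) nth_mem[of i ls] nth_mem[of j ls] by (simp add: G_def)
    then show False using i j(1) ls(2) by (simp add: nth_eq_iff_index_eq)
  qed
  then have "syz G = {0}" using closed_submoduleD(1)[OF closed_submodule_syz] by blast
  then show ?thesis using groebner_spans[OF N G gb] by auto
qed

end

context weighted_solvable
begin

text \<open>Schreyer's form of the syzygy theorem: each passage to syzygies frees one more variable.\<close>

lemma short_res_if_avoids:
  "module_order P E r \<Longrightarrow> closed_submodule N \<Longrightarrow> N \<subseteq> fcar E \<Longrightarrow> avoids r k N \<Longrightarrow>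
    k + Suc m = nvars P \<Longrightarrow> short_res (Suc m) N"
proof (induction m arbitrary: k E r N)
  case 0
  interpret module_order P E r by fact
  show ?case using free_if_one_variable[of N k] 0 by simp
next
  case (Suc m)
  interpret module_order P E r by fact
  obtain G0 where G0: "set G0 \<subseteq> N - {0}"
    "\<And>x. x \<in> N \<Longrightarrow> x \<noteq> 0 \<Longrightarrow> \<exists>g\<in>set G0. mon_dvd (LM P r g) (LM P r x)"
    "\<And>g l. g \<in> set G0 \<Longrightarrow> l < k \<Longrightarrow> fst (LM P r g) l = 0"
    using avoiding_groebner_basis[OF Suc.prems(3,4)] by metis
  define G where "G = sort_key (\<lambda>g. fst (LM P r g) k) G0"
  have set: "set G = set G0" by (simp add: G_def)
  have sorted: "fst (LM P r (G ! i)) k \<le> fst (LM P r (G ! j)) k" if "i < j" "j < length G" for i j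
    using sorted_nth_mono[of "map (\<lambda>g. fst (LM P r g) k) G" i j] that
    by (simp add: G_def)
  have G: "set G \<subseteq> N - {0}" "set G \<subseteq> fcar E - {0}" using G0(1) Suc.prems(3) set by auto
  note gb = G0(2)[folded set]
  have "short_res (Suc m) (syz G)"
  proof (rule Suc.IH)
    show "module_order P {..<length G} (schreyer G)" by (rule schreyer_order[OF G(2)])
    show "closed_submodule (syz G)" by (rule closed_submodule_syz)
    show "syz G \<subseteq> fcar {..<length G}" by (auto simp: syz_iff)
    show "avoids (schreyer G) (Suc k) (syz G)"
      using syz_avoids[OF Suc.prems(2,3) G(1) gb G0(3)[folded set] sorted] by blast
    show "Suc k + Suc m = nvars P" using Suc.prems(5) by simp
  qed
  then show ?case using groebner_spans[OF Suc.prems(2,3) G(1) gb] by auto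
qed

lemma short_res_nvars:
  fixes N :: "'a vec set"
  assumes "closed_submodule N" "N \<subseteq> fcar E" "finite E" "nvars P \<noteq> 0"
  shows "short_res (nvars P) N"
proof -
  obtain r where "left_monomial_ordering P E r" using left_monomial_ordering_exists by blast
  then have "module_order P E r" using assms(3) by unfold_locales
  moreover have "avoids r 0 N" using mon_dvd_refl by (auto simp: avoids_def)
  moreover obtain m where "nvars P = Suc m" using assms(4) by (cases "nvars P") auto
  ultimately show ?thesis using short_res_if_avoids[of E r N 0 m] assms(1,2) by simp
qed

end


section \<open>Comparison of resolutions\<close>

lemma alin_trunc: "alin (trunc m)"
  by (auto simp: alin_def trunc_def fun_eq_iff vec_apply lmul_apply)

lemma alin_diff: "alin f \<Longrightarrow> alin g \<Longrightarrow> alin (\<lambda>x. f x - g x)"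
  by (simp add: alin_def lmul_simps)

lemma alin_id: "alin (\<lambda>x. x)"
  by (simp add: alin_def)

text \<open>A linear map on a free module is lifted by lifting its values on the basis, here the \<open>f w\<close>.\<close>

lemma lift_rows:
  assumes "\<And>w. w \<in> set W \<Longrightarrow> f w \<in> row_space V"
  obtains C where "map (\<lambda>c. row_mult c V) C = map f W" "length C = length W" "set C \<subseteq> fcar {..<length V}"
proof -
  have "\<exists>c. row_mult c V = f w \<and> c \<in> fcar {..<length V}" if "w \<in> set W" for w
    using assms[OF that] row_mult_trunc trunc_fcar by (metis imageE)
  then obtain c where c: "\<And>w. w \<in> set W \<Longrightarrow> row_mult (c w) V = f w \<and> c w \<in> fcar {..<length V}"
    by metis
  show ?thesis by (rule that[of "map c W"]) (use c in auto)
qed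

text \<open>Let \<open>\<dots> \<rightarrow> F\<^sub>1 \<rightarrow> F\<^sub>0 \<rightarrow> N\<^sub>0\<close> be exact, let \<open>N'\<close> have a free resolution of length \<open>m\<close>, and let
  \<open>v \<circ> u\<close> with \<open>u: N\<^sub>0 \<rightarrow> N'\<close>, \<open>v: N' \<rightarrow> N\<^sub>0\<close> be homotopic to the identity.  Lifting \<open>u\<close>, \<open>v\<close> and the
  homotopy along the resolutions until the second one ends makes the identity of \<open>N\<^sub>m\<close> null-homotopic.\<close>

lemma identity_null_homotopic:
  fixes Fs :: "nat \<Rightarrow> 'a::ring_1 vec list"
  assumes "short_res m N'"
    "\<And>i. i \<le> m \<Longrightarrow> Ns i = row_space (Fs i)"
    "\<And>i. i < m \<Longrightarrow> Ns (Suc i) = syz (Fs i)"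
    "alin u" "alin v" "alin h" "\<And>x. x \<in> Ns 0 \<Longrightarrow> u x \<in> N'" "\<And>y. y \<in> N' \<Longrightarrow> v y \<in> Ns 0"
    "\<And>x. x \<in> Ns 0 \<Longrightarrow> x - v (u x) = row_mult (h x) (Fs 0)"
  shows "\<exists>h. alin h \<and> (\<forall>x\<in>Ns m. x = row_mult (h x) (Fs m))"
  using assms
proof (induction m arbitrary: N' Ns Fs u v h)
  case 0
  have "x = row_mult (h x) (Fs 0)" if "x \<in> Ns 0" for x
  proof -
    have "u x = 0" using 0 that by simp
    then show ?thesis using "0.prems"(9)[OF that] alinD(3)[OF "0.prems"(5)] by simp
  qed
  then show ?case using "0.prems"(6) by blast
next
  case (Suc m)
  note u = Suc.prems(4) and v = Suc.prems(5) and h = Suc.prems(6)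
  obtain G where G: "N' = row_space G" "short_res m (syz G)"
    using Suc.prems(1) by auto
  let ?F = "Fs 0"
  have N0: "Ns 0 = row_space ?F" and N1: "Ns (Suc 0) = syz ?F"
    "Ns (Suc 0) = row_space (Fs (Suc 0))"
    using Suc.prems(2)[of 0] Suc.prems(3)[of 0] Suc.prems(2)[of "Suc 0"] by auto
  obtain A where A: "map (\<lambda>c. row_mult c G) A = map u ?F" "length A = length ?F" "set A \<subseteq> fcar {..<length G}"
    by (rule lift_rows[of ?F u G]) (use Suc.prems(7)[unfolded N0 G(1), OF row_space_member] in blast)
  obtain B where B: "map (\<lambda>c. row_mult c ?F) B = map v G" "length B = length G" "set B \<subseteq> fcar {..<length ?F}"
    by (rule lift_rows[of G v ?F]) (use Suc.prems(8)[unfolded N0 G(1), OF row_space_member] in blast)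
  define \<alpha> where "\<alpha> = (\<lambda>x. row_mult x A)"
  define \<beta> where "\<beta> = (\<lambda>x. row_mult x B)"
  have \<alpha>: "alin \<alpha>" "\<And>x. row_mult (\<alpha> x) G = u (row_mult x ?F)" "\<And>x. \<alpha> x \<in> fcar {..<length G}"
    using A by (simp_all add: \<alpha>_def alin_row_mult row_mult_assoc alin_row_mult_eq[OF u] fcar_row_mult)
  have \<beta>: "alin \<beta>" "\<And>x. row_mult (\<beta> x) ?F = v (row_mult x G)" "\<And>x. \<beta> x \<in> fcar {..<length ?F}"
    using B by (simp_all add: \<beta>_def alin_row_mult row_mult_assoc alin_row_mult_eq[OF v] fcar_row_mult)
  \<comment> \<open>\<open>1 - \<beta>\<alpha> - h d\<close> maps \<open>F\<^sub>0\<close> into the kernel of \<open>d\<close>, and is lifted to \<open>F\<^sub>1\<close> by \<open>h'\<close>\<close>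
  define D where "D = (\<lambda>x. x - \<beta> (\<alpha> x) - trunc (length ?F) (h (row_mult x ?F)))"
  have D: "alin D"
    unfolding D_def
    by (intro alin_diff alin_id alin_comp[OF \<beta>(1)] alin_comp[OF alin_trunc] alin_comp[OF h] \<alpha>(1) alin_row_mult)
  have Dsyz: "D x \<in> row_space (Fs (Suc 0))" if x: "x \<in> fcar {..<length ?F}" for x
  proof -
    have "row_mult (D x) ?F = row_mult x ?F - v (u (row_mult x ?F)) - row_mult (h (row_mult x ?F)) ?F"
      by (simp add: D_def row_mult_diff \<alpha> \<beta>)
    also have "\<dots> = 0" using Suc.prems(9)[of "row_mult x ?F"] N0 by simp
    finally have "D x \<in> syz ?F" using x \<beta>(3) by (simp add: syz_iff D_def)
    then show ?thesis unfolding N1(2)[symmetric] N1(1) .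
  qed
  let ?U = "map (\<lambda>k. single k (1::'a)) [0..<length ?F]"
  obtain C where C: "map (\<lambda>c. row_mult c (Fs (Suc 0))) C = map D ?U" "length C = length ?U"
    by (rule lift_rows[of ?U D "Fs (Suc 0)"]) (auto intro!: Dsyz fcar_single)
  define h' where "h' = (\<lambda>x. row_mult x C)"
  have h': "row_mult (h' x) (Fs (Suc 0)) = D x" if x: "x \<in> fcar {..<length ?F}" for x
  proof -
    have "x = row_mult x ?U"
      using fcar_expansion[OF _ x] by (simp add: row_mult_def lmul_simps)
    then have "D x = row_mult x (map D ?U)" using alin_row_mult_eq[OF D, of x ?U] by simp
    then show ?thesis by (simp only: h'_def row_mult_assoc C(1))
  qed
  have "\<exists>h. alin h \<and> (\<forall>x\<in>Ns (Suc m). x = row_mult (h x) (Fs (Suc m)))"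
  proof (rule Suc.IH[OF G(2), of "\<lambda>i. Ns (Suc i)" "\<lambda>i. Fs (Suc i)" \<alpha> \<beta> h'])
    show "alin h'" by (simp add: h'_def alin_row_mult)
    show "\<alpha> x \<in> syz G" if "x \<in> Ns (Suc 0)" for x
      using that \<alpha> alinD(3)[OF u] unfolding N1(1) by (simp add: syz_iff)
    show "\<beta> y \<in> Ns (Suc 0)" if "y \<in> syz G" for y
      unfolding N1(1) using that \<beta> alinD(3)[OF v] by (simp add: syz_iff)
    show "x - \<beta> (\<alpha> x) = row_mult (h' x) (Fs (Suc 0))" if "x \<in> Ns (Suc 0)" for x
    proof -
      have x: "x \<in> fcar {..<length ?F}" "row_mult x ?F = 0"
        using that unfolding N1(1) by (simp_all add: syz_iff)
      then show ?thesis using h'[OF x(1)] alinD(3)[OF h] alinD(3)[OF alin_trunc] by (simp add: D_def)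
    qed
    show "Ns (Suc i) = row_space (Fs (Suc i))" if "i \<le> m" for i
      using Suc.prems(2)[of "Suc i"] that by blast
    show "Ns (Suc (Suc i)) = syz (Fs (Suc i))" if "i < m" for i
      using Suc.prems(3)[of "Suc i"] that by blast
  qed (fact \<alpha>(1) \<beta>(1))+
  then show ?case .
qed

context weighted_solvable
begin

text \<open>In a minimal chain all syzygies have entries in \<open>A\<^sub>+\<close>, and a null-homotopic identity would put
  a basis element into \<open>A\<^sub>+ F\<close>.\<close>

lemma minimal_chain_length:
  assumes N: "closed_submodule (Ns 0)" "Ns 0 \<subseteq> fcar E" "finite E"
    and chain: "\<And>i. i \<le> nvars P \<Longrightarrow> Ns i = row_space (Fs i)"
      "\<And>i. i < nvars P \<Longrightarrow> Ns (Suc i) = syz (Fs i)"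
    and pos: "Ns (nvars P) \<subseteq> posv" "syz (Fs (nvars P)) \<subseteq> posv"
  shows "Ns (nvars P) = {0}"
proof (rule ccontr)
  let ?n = "nvars P"
  assume nz: "Ns ?n \<noteq> {0}"
  \<comment> \<open>without variables the algebra is the field and \<open>A\<^sub>+\<close> is \<open>0\<close>\<close>
  have n0: "?n \<noteq> 0"
  proof
    assume n: "?n = 0"
    have "x = 0" if "x \<in> posv" for x :: "'a vec"
    proof (rule ext)
      fix i
      have "coef P (x i) 0 = 0" using that by (simp add: posv_def)
      moreover have "expos P = {0}" using n by (auto simp: expos_def fun_eq_iff zero_fun_apply)
      ultimately have "supp (x i) = {}" by (simp add: supp_def)
      then show "x i = 0 i" by (simp add: supp_empty_iff vec_apply)
    qed
    moreover have "0 \<in> Ns ?n" using closed_submoduleD(1)[OF N(1)] n by simp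
    ultimately show False using pos(1) nz by blast
  qed
  have "\<exists>h. alin h \<and> (\<forall>x\<in>Ns ?n. x = row_mult (h x) (Fs ?n))"
  proof (rule identity_null_homotopic[where u = "\<lambda>x. x" and v = "\<lambda>x. x"
        and h = "\<lambda>x. row_mult x []" and N' = "Ns 0" and Ns = Ns and Fs = Fs])
    show "short_res ?n (Ns 0)" by (rule short_res_nvars[OF N n0])
    show "Ns i = row_space (Fs i)" if "i \<le> ?n" for i by (rule chain(1)[OF that])
    show "Ns (Suc i) = syz (Fs i)" if "i < ?n" for i by (rule chain(2)[OF that])
    show "alin (\<lambda>x. row_mult x [])" by (rule alin_row_mult)
  qed (simp_all add: alin_id)
  then obtain h where h: "alin h" "\<And>x. x \<in> Ns ?n \<Longrightarrow> x = row_mult (h x) (Fs ?n)"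
    by blast
  let ?F = "Fs ?n"
  have "?F \<noteq> []"
  proof
    assume "?F = []"
    then have "Ns ?n = {0}" using chain(1)[of ?n] by auto
    then show False using nz by blast
  qed
  then have k: "0 < length ?F" by simp
  define x where "x = ?F ! 0"
  have x: "x \<in> Ns ?n" using chain(1)[of ?n] row_space_member[of x ?F] k by (simp add: x_def)
  obtain m where m: "?n = Suc m" using n0 by (cases ?n) auto
  have "x \<in> fcar {..<length (Fs m)}" using x chain(2)[of m] m by (simp add: syz_iff)
  then have hx: "h x \<in> posv" using alin_posv[OF h(1) _ finite_lessThan] x pos(1) by blast
  \<comment> \<open>\<open>x\<close> is the image both of a basis element and of an element with entries in \<open>A\<^sub>+\<close>\<close>
  define y where "y = single 0 1 - trunc (length ?F) (h x)"
  have "row_mult y ?F = 0"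
    using h(2)[OF x] k by (simp add: y_def row_mult_diff row_mult_single lmul_simps x_def)
  then have "y \<in> syz ?F" using k by (simp add: syz_iff y_def fcar_single)
  then have "coef P (y 0) 0 = 0" using pos(2) by (auto simp: posv_def)
  moreover have "coef P (y 0) 0 = 1"
    using hx k by (simp add: y_def posv_def trunc_def minus_apply coef_1)
  ultimately show False by simp
qed

end

section \<open>Algorithm MinSub\<close>

context weighted_solvable
begin

lemma homv_cong:
  "x \<in> fcar E \<Longrightarrow> (\<And>i. i \<in> E \<Longrightarrow> b i = b' i) \<Longrightarrow> homv b q x \<longleftrightarrow> homv b' q x"
  unfolding homv_def using vsupp_subset by fastforce

lemma deg_strict_mono:
  assumes "\<And>k. \<alpha> k \<le> \<beta> k" "\<alpha> \<noteq> \<beta>" "\<beta> \<in> expos P"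
  shows "deg P \<alpha> < deg P \<beta>"
proof -
  have eq: "\<beta> = \<alpha> + (\<beta> - \<alpha>)" using assms(1) by (auto simp: fun_eq_iff vec_apply minus_apply)
  have "deg P (\<beta> - \<alpha>) \<noteq> 0"
    using deg_eq_0[OF minus_expos[OF assms(3)], of \<alpha>] eq assms(2) by (metis add_0_right)
  then show ?thesis using deg_add[of \<alpha> "\<beta> - \<alpha>"] eq by simp
qed

end

lemma row_mult_snoc_fcar: "h \<in> fcar {..<length V} \<Longrightarrow> row_mult h (V @ [w]) = row_mult (h::'a::ring_1 vec) V"
  by (simp add: row_mult_append1 fcar_def lmul_simps)

lemma row_space_append: "row_space V \<subseteq> row_space (V @ W)"
  by (rule row_space_subset) (use row_space_member[of _ "V @ W"] in auto)

locale minsub_problem = module_order P E r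
  for P :: "('k::field, 'a::ring_1) pbw_data" and E r +
  fixes b :: "nat \<Rightarrow> nat" and U :: "'a vec list"
  assumes inputs: "x \<in> set U \<Longrightarrow> x \<in> fcar E \<and> x \<noteq> 0 \<and> (\<exists>q. homv b q x)"
begin

abbreviation "dg \<equiv> hdeg (free_mod P E b)"

abbreviation "degs G \<equiv> \<lambda>k. dg (G ! k)"

lemma dg_eq: "x \<in> fcar E \<Longrightarrow> x \<noteq> 0 \<Longrightarrow> homv b q x \<Longrightarrow> dg x = q"
  by (rule hdeg_free_mod[OF finite_E])

lemma input_hom: "x \<in> set U \<Longrightarrow> homv b (dg x) x"
  using inputs[of x] dg_eq[of x] by blast

definition gb_ok :: "nat \<Rightarrow> 'a vec list \<Rightarrow> bool" where
  "gb_ok \<nu> G \<longleftrightarrow> set G \<subseteq> fcar E - {0} \<and>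
     (\<forall>k<length G. homv b (dg (G ! k)) (G ! k) \<and> dg (G ! k) < \<nu>) \<and>
     (\<forall>i j. i < j \<longrightarrow> j < length G \<longrightarrow> \<not> mon_dvd (LM P r (G ! i)) (LM P r (G ! j)))"

lemma gb_okD:
  assumes "gb_ok \<nu> G"
  shows "set G \<subseteq> fcar E - {0}" "k < length G \<Longrightarrow> homv b (dg (G ! k)) (G ! k)"
    "k < length G \<Longrightarrow> dg (G ! k) < \<nu>" "k < length G \<Longrightarrow> G ! k \<in> fcar E" "k < length G \<Longrightarrow> G ! k \<noteq> 0"
    "i < j \<Longrightarrow> j < length G \<Longrightarrow> \<not> mon_dvd (LM P r (G ! i)) (LM P r (G ! j))"
  using assms nth_mem[of k G] unfolding gb_ok_def by blast+

lemma gb_ok_snoc: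
  assumes G: "gb_ok \<nu> G" and \<eta>: "\<eta> \<in> fcar E" "\<eta> \<noteq> 0" "homv b d \<eta>" "d < \<nu>"
    and irr: "\<And>k. k < length G \<Longrightarrow> \<not> mon_dvd (LM P r (G ! k)) (LM P r \<eta>)"
  shows "gb_ok \<nu> (G @ [\<eta>])"
  unfolding gb_ok_def
proof (intro conjI allI impI)
  show "set (G @ [\<eta>]) \<subseteq> fcar E - {0}" using gb_okD(1)[OF G] \<eta> by auto
  fix k assume "k < length (G @ [\<eta>])"
  then show "homv b (dg ((G @ [\<eta>]) ! k)) ((G @ [\<eta>]) ! k)" "dg ((G @ [\<eta>]) ! k) < \<nu>"
    using gb_okD(2,3)[OF G, of k] \<eta> dg_eq[OF \<eta>(1,2,3)] by (auto simp: nth_append)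
next
  fix i j assume "i < j" "j < length (G @ [\<eta>])"
  then show "\<not> mon_dvd (LM P r ((G @ [\<eta>]) ! i)) (LM P r ((G @ [\<eta>]) ! j))"
    using gb_okD(6)[OF G, of i j] irr[of i] by (auto simp: nth_append less_Suc_eq)
qed

definition all_pairs :: "'a vec list \<Rightarrow> (nat \<times> nat) set" where
  "all_pairs G = {(i, j). i < j \<and> j < length G \<and> snd (LM P r (G ! i)) = snd (LM P r (G ! j))}"

lemma finite_all_pairs: "finite (all_pairs G)"
  by (rule finite_subset[of _ "{..<length G} \<times> {..<length G}"]) (auto simp: all_pairs_def)

lemma all_pairs_snoc: "all_pairs (G @ [\<eta>]) = all_pairs G \<union> new_pairs P r G \<eta>"
  unfolding all_pairs_def new_pairs_def
  by (auto simp: nth_append less_Suc_eq split: if_splits)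

abbreviation "pair_deg G i j \<equiv> S_deg P b r (G ! i) (G ! j)"

text \<open>A syzygy of the pair has been recorded.  Keeping the quotients explicit makes the property
  independent of generators appended later, although Schreyer's ordering depends on them.\<close>

definition pair_done :: "'a vec list \<Rightarrow> 'a vec set \<Rightarrow> nat \<Rightarrow> nat \<Rightarrow> bool" where
  "pair_done G Z i j \<longleftrightarrow> (\<exists>q. pair_syz G i j q \<in> Z \<and> q \<in> fcar {..<length G} \<and>
     heights_below G q (mlcm (LM P r (G ! i)) (LM P r (G ! j))) \<and>
     homv (degs G) (pair_deg G i j) (pair_syz G i j q))"

lemma pair_done_mono: "pair_done G Z i j \<Longrightarrow> Z \<subseteq> Z' \<Longrightarrow> pair_done G Z' i j"
  unfolding pair_done_def by blast

lemma pair_syz_fcar: "i < length G \<Longrightarrow> j < length G \<Longrightarrow> q \<in> fcar {..<length G} \<Longrightarrow>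
    pair_syz G i j q \<in> fcar {..<length G}"
  by (simp add: pair_syz_def fcar_single)

lemma heights_below_snoc:
  assumes "q \<in> fcar {..<length G}"
  shows "heights_below (G @ [\<eta>]) q m \<longleftrightarrow> heights_below G q m"
  unfolding heights_below_def using vsupp_subset[OF assms] by (force simp: nth_append)

lemma fcar_snoc: "x \<in> fcar {..<length G} \<Longrightarrow> x \<in> fcar {..<length (G @ [\<eta>])}"
  by (auto simp: fcar_def)

lemma homv_snoc:
  "x \<in> fcar {..<length G} \<Longrightarrow>
    homv (degs (G @ [\<eta>])) d x \<longleftrightarrow> homv (degs G) d x"
  by (rule homv_cong) (auto simp: nth_append)

lemma pair_done_snoc:
  assumes "pair_done G Z i j" "i < length G" "j < length G"
  shows "pair_done (G @ [\<eta>]) Z i j"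
proof -
  obtain q where q: "pair_syz G i j q \<in> Z" "q \<in> fcar {..<length G}"
     "heights_below G q (mlcm (LM P r (G ! i)) (LM P r (G ! j)))"
     "homv (degs G) (pair_deg G i j) (pair_syz G i j q)"
    using assms(1) unfolding pair_done_def by blast
  have eq: "(G @ [\<eta>]) ! i = G ! i" "(G @ [\<eta>]) ! j = G ! j" using assms by (simp_all add: nth_append)
  then have ps: "pair_syz (G @ [\<eta>]) i j q = pair_syz G i j q" by (simp add: pair_syz_def)
  show ?thesis
    unfolding pair_done_def
    using q pair_syz_fcar[OF assms(2,3) q(2)] fcar_snoc[OF q(2)]
    by (intro exI[of _ q]) (simp add: ps eq heights_below_snoc homv_snoc)
qed


lemma homv_pair_syz:
  assumes G: "gb_ok \<nu> G" and ij: "(i, j) \<in> all_pairs G"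
    and q: "homv (degs G) (pair_deg G i j) q"
  shows "homv (degs G) (pair_deg G i j) (pair_syz G i j q)"
proof -
  have *: "i < length G" "j < length G" "snd (LM P r (G ! i)) = snd (LM P r (G ! j))"
    using ij by (auto simp: all_pairs_def)
  note gi = gb_okD(4,5,2)[OF G *(1)] and gj = gb_okD(4,5,2)[OF G *(2)]
  show ?thesis
    unfolding pair_syz_def
    using q S_mult_deg[OF gi gj(1,2)] S_mult_deg[OF gj gi(1,2)] S_deg_commute[OF *(3)]
    by (intro homv_diff) (auto simp: homv_single)
qed

text \<open>Least common multiples with a remainder are proper multiples of its leading monomial: the pairs
  arising in a round belong to later rounds.\<close>

lemma S_deg_increases:
  assumes x: "x \<in> fcar E" "x \<noteq> 0" and y: "y \<in> fcar E" "y \<noteq> 0" "homv b d y"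
    and comp: "snd (LM P r x) = snd (LM P r y)" and irr: "\<not> mon_dvd (LM P r x) (LM P r y)"
  shows "d < S_deg P b r x y"
proof -
  let ?m = "fst (mlcm (LM P r x) (LM P r y))"
  have "?m \<noteq> fst (LM P r y)"
  proof
    assume *: "?m = fst (LM P r y)"
    have "fst (LM P r x) k \<le> ?m k" for k by (simp add: mlcm_def)
    then show False using irr comp unfolding * by (simp add: mon_dvd_def)
  qed
  moreover have "?m \<in> expos P" using mlcm_mons LM_props(3) x y by (metis SigmaE fst_conv)
  ultimately have "deg P (fst (LM P r y)) < deg P ?m"
    by (intro deg_strict_mono) (auto simp: mlcm_def)
  then show ?thesis using deg_LM[OF y] comp by (simp add: S_deg_def mlcm_def)
qed

text \<open>The standard representations available once the pairs up to degree \<open>d\<close> are done.\<close>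

lemma done_pairs_representation:
  assumes G: "gb_ok \<nu> G" and Z: "closed_submodule Z" "Z' \<subseteq> Z" "Z' \<subseteq> syz G"
    and pairs: "\<And>i j. (i, j) \<in> all_pairs G \<Longrightarrow> pair_deg G i j \<le> d \<Longrightarrow> pair_done G Z' i j"
    and h: "h \<in> fcar {..<length G}" "\<And>\<alpha> k. (\<alpha>, k) \<in> vsupp h \<Longrightarrow> deg P \<alpha> + dg (G ! k) \<le> d"
  shows "\<exists>h'\<in>fcar {..<length G}. h - h' \<in> Z \<and> row_mult h' G = row_mult h G \<and>
    (row_mult h G = 0 \<longrightarrow> h' = 0) \<and>
    (row_mult h G \<noteq> 0 \<longrightarrow> h' \<noteq> 0 \<and> LM P r (row_mult h G) = height G h')"
proof (rule standard_representation[OF gb_okD(1)[OF G] Z(1) _ gb_okD(2)[OF G] h])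
  fix i j assume ij: "i < j" "j < length G" "snd (LM P r (G ! i)) = snd (LM P r (G ! j))"
    and "pair_deg G i j \<le> d"
  then have "pair_done G Z' i j" using pairs by (simp add: all_pairs_def)
  then obtain q where q: "pair_syz G i j q \<in> Z'" "q \<in> fcar {..<length G}"
     "heights_below G q (mlcm (LM P r (G ! i)) (LM P r (G ! j)))"
     "homv (degs G) (pair_deg G i j) (pair_syz G i j q)"
    unfolding pair_done_def by blast
  note L = LM_pair_syz[OF gb_okD(1)[OF G] ij q(2,3)]
  have "row_mult (pair_syz G i j q) G = 0" using q(1) Z(3) by (auto simp: syz_iff)
  then show "\<exists>z\<in>Z. z \<in> fcar {..<length G} \<and> z \<noteq> 0 \<and> row_mult z G = 0 \<and>
        LM P (schreyer G) z = (fst (mlcm (LM P r (G ! i)) (LM P r (G ! j))) - fst (LM P r (G ! j)), j) \<and>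
        homv (degs G) (pair_deg G i j) z"
    using L q(1,4) Z(2) by (intro bexI[of _ "pair_syz G i j q"]) auto
qed

text \<open>Further invariants of MinSub concern the representations of the current list \<open>G\<close> by the generators
  \<open>Um\<close> kept, the pairs, the inputs and the minimality of \<open>Um\<close>; the sets \<open>S\<close> and \<open>W\<close> are what is still
  to be processed.\<close>

definition rows_ok :: "'a vec list \<Rightarrow> 'a vec list \<Rightarrow> 'a vec list \<Rightarrow> bool" where
  "rows_ok G Um V \<longleftrightarrow> length V = length G \<and>
     (\<forall>k<length G. V ! k \<in> fcar {..<length Um} \<and> row_mult (V ! k) Um = G ! k \<and>
        homv (degs Um) (dg (G ! k)) (V ! k)) \<and>
     set Um \<subseteq> row_space G"

definition pairs_ok :: "'a vec list \<Rightarrow> 'a vec list \<Rightarrow> (nat \<times> nat) set \<Rightarrow> bool" where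
  "pairs_ok G Z S \<longleftrightarrow> S \<subseteq> all_pairs G \<and> (\<forall>(i, j)\<in>all_pairs G - S. pair_done G (set Z) i j) \<and>
     (\<forall>z\<in>set Z. z \<in> syz G \<and> (\<exists>d. homv (degs G) d z))"

lemma pairs_okD:
  "pairs_ok G Z S \<Longrightarrow> (i, j) \<in> all_pairs G \<Longrightarrow> (i, j) \<notin> S \<Longrightarrow> pair_done G (set Z) i j"
  unfolding pairs_ok_def by blast

definition waiting_ok :: "'a vec list \<Rightarrow> nat set \<Rightarrow> bool" where
  "waiting_ok G W \<longleftrightarrow> W \<subseteq> {..<length U} \<and>
     (\<forall>j<length U. j \<notin> W \<longrightarrow> U ! j \<in> row_space G)"

definition minimal_ok :: "nat \<Rightarrow> 'a vec list \<Rightarrow> bool" where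
  "minimal_ok \<nu> Um \<longleftrightarrow> set Um \<subseteq> set U \<and> sorted (map dg Um) \<and>
     (\<forall>k<length Um. Um ! k \<notin> row_space (take k Um) \<and> dg (Um ! k) < \<nu>)"

text \<open>\<open>\<nu>\<close> is one more than the degree of the current round, so that \<open>0\<close> serves before the first.\<close>

definition degrees_ok :: "nat \<Rightarrow> 'a minsub_state \<Rightarrow> bool" where
  "degrees_ok \<nu> s \<longleftrightarrow>
     (\<forall>(i, j)\<in>spairs_now s. Suc (pair_deg (gb s) i j) = \<nu>) \<and>
     (\<forall>j\<in>waiting_now s. Suc (dg (U ! j)) = \<nu>) \<and>
     (\<forall>(i, j)\<in>spairs s. \<nu> \<le> pair_deg (gb s) i j) \<and> (\<forall>j\<in>waiting s. \<nu> \<le> dg (U ! j))"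

definition minsub_inv :: "nat \<Rightarrow> 'a minsub_state \<Rightarrow> bool" where
  "minsub_inv \<nu> s \<longleftrightarrow> gb_ok \<nu> (gb s) \<and> rows_ok (gb s) (umin s) (vrows s) \<and>
     pairs_ok (gb s) (syzs s) (spairs s \<union> spairs_now s) \<and>
     waiting_ok (gb s) (waiting s \<union> waiting_now s) \<and> minimal_ok \<nu> (umin s) \<and> degrees_ok \<nu> s"

lemma minsub_inv_init: "minsub_inv 0 (minsub_init U)"
  by (auto simp: minsub_inv_def minsub_init_def gb_ok_def rows_ok_def pairs_ok_def waiting_ok_def
      minimal_ok_def degrees_ok_def all_pairs_def)

lemma gb_ok_mono: "gb_ok \<nu> G \<Longrightarrow> \<nu> \<le> \<nu>' \<Longrightarrow> gb_ok \<nu>' G"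
  and minimal_ok_mono: "minimal_ok \<nu> Um \<Longrightarrow> \<nu> \<le> \<nu>' \<Longrightarrow> minimal_ok \<nu>' Um"
  unfolding gb_ok_def minimal_ok_def by (meson order_less_le_trans)+

lemma map_rows:
  "rows_ok G Um V \<Longrightarrow> map (\<lambda>w. row_mult w Um) V = G"
  by (rule nth_equalityI) (auto simp: rows_ok_def)

text \<open>When \<open>\<eta>\<close> is appended, old syzygies stay syzygies; of the old pairs, only those leaving \<open>S\<close> need
  new ones.\<close>

lemma pairs_ok_snoc:
  assumes "pairs_ok G Z S" "\<And>i j. (i, j) \<in> all_pairs G \<Longrightarrow> (i, j) \<notin> S' \<Longrightarrow> (i, j) \<in> S \<Longrightarrow> pair_done (G @ [\<eta>]) (set Z') i j"
    "set Z \<subseteq> set Z'" "S' \<subseteq> all_pairs G"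
    "\<And>z. z \<in> set Z' - set Z \<Longrightarrow> z \<in> syz (G @ [\<eta>]) \<and> (\<exists>d. homv (degs (G @ [\<eta>])) d z)"
  shows "pairs_ok (G @ [\<eta>]) Z' (S' \<union> new_pairs P r G \<eta>)"
  unfolding pairs_ok_def
proof (intro conjI ballI)
  show "S' \<union> new_pairs P r G \<eta> \<subseteq> all_pairs (G @ [\<eta>])" using assms(4) by (auto simp: all_pairs_snoc)
  show "case p of (i, j) \<Rightarrow> pair_done (G @ [\<eta>]) (set Z') i j"
    if p: "p \<in> all_pairs (G @ [\<eta>]) - (S' \<union> new_pairs P r G \<eta>)" for p
  proof -
    obtain i j where ij: "p = (i, j)" by fastforce
    have *: "(i, j) \<in> all_pairs G" "(i, j) \<notin> S'" using p ij by (auto simp: all_pairs_snoc)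
    have "pair_done (G @ [\<eta>]) (set Z') i j"
    proof (cases "(i, j) \<in> S")
      case False
      then have "pair_done G (set Z) i j" using assms(1) * by (auto simp: pairs_ok_def)
      then have "pair_done (G @ [\<eta>]) (set Z) i j"
        by (rule pair_done_snoc) (use * in \<open>auto simp: all_pairs_def\<close>)
      then show ?thesis using assms(3) by (rule pair_done_mono)
    qed (use assms(2) * in blast)
    then show ?thesis by (simp add: ij)
  qed
  fix z assume "z \<in> set Z'"
  show "z \<in> syz (G @ [\<eta>])" "\<exists>d. homv (degs (G @ [\<eta>])) d z"
  proof (atomize (full), cases "z \<in> set Z")
    case True
    then obtain d where z: "z \<in> syz G" "homv (degs G) d z"
      using assms(1) by (auto simp: pairs_ok_def)
    then have zf: "z \<in> fcar {..<length G}" "row_mult z G = 0" by (simp_all add: syz_iff)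
    then show "z \<in> syz (G @ [\<eta>]) \<and> (\<exists>d. homv (degs (G @ [\<eta>])) d z)"
      using fcar_snoc[OF zf(1), of \<eta>] z(2) homv_snoc[OF zf(1), of \<eta> d] row_mult_snoc_fcar[OF zf(1), of \<eta>]
      by (auto simp: syz_iff)
  qed (use assms(5) \<open>z \<in> set Z'\<close> in blast)
qed

lemma waiting_ok_snoc:
  "waiting_ok G W \<Longrightarrow> waiting_ok (G @ [\<eta>]) W"
  unfolding waiting_ok_def using row_space_append[of G "[\<eta>]"] by blast

lemma new_pairs_degree:
  assumes "gb_ok \<nu> G" "\<eta> \<in> fcar E" "\<eta> \<noteq> 0" "homv b d \<eta>" "Suc d = \<nu>"
    "\<And>k. k < length G \<Longrightarrow> \<not> mon_dvd (LM P r (G ! k)) (LM P r \<eta>)" "(i, j) \<in> new_pairs P r G \<eta>"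
  shows "\<nu> \<le> pair_deg (G @ [\<eta>]) i j"
proof -
  have *: "i < length G" "j = length G" "snd (LM P r (G ! i)) = snd (LM P r \<eta>)"
    using assms(7) by (auto simp: new_pairs_def)
  then have "d < S_deg P b r (G ! i) \<eta>"
    using S_deg_increases[OF gb_okD(4,5)[OF assms(1) *(1)] assms(2-4) *(3) assms(6)] by simp
  then show ?thesis using assms(5) * by (simp add: nth_append)
qed

lemma old_pair_degree: "(i, j) \<in> all_pairs G \<Longrightarrow> pair_deg (G @ [\<eta>]) i j = pair_deg G i j"
  by (simp add: all_pairs_def nth_append)

text \<open>Up to the degree of the round, inputs are only tested once all S-polynomials have been reduced,
  so the current list is a truncated Groebner basis.\<close>

lemma truncated_groebner_basis:
  assumes inv: "minsub_inv \<nu> s" and now: "spairs_now s = {}" and "d < \<nu>"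
    and y: "y \<in> row_space (gb s)" "homv b d y" "y \<noteq> 0"
  shows "\<exists>k<length (gb s). mon_dvd (LM P r (gb s ! k)) (LM P r y)"
proof -
  let ?G = "gb s"
  have G: "gb_ok \<nu> ?G" and p: "pairs_ok ?G (syzs s) (spairs s)" and dg: "degrees_ok \<nu> s"
    using inv now by (simp_all add: minsub_inv_def)
  obtain h0 where "y = row_mult h0 ?G" using y(1) by blast
  then have y0: "y = row_mult (trunc (length ?G) h0) ?G" by simp
  define h where "h = hcomp (degs ?G) d (trunc (length ?G) h0)"
  have h: "h \<in> fcar {..<length ?G}" unfolding h_def by (intro hcomp_fcar trunc_fcar)
  have yh: "row_mult h ?G = y"
    unfolding h_def y0 by (rule hcomp_row_mult[of _ b]) (use gb_okD(2)[OF G] y(2) y0 in auto)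
  have hd: "deg P \<alpha> + dg (?G ! k) \<le> d" if "(\<alpha>, k) \<in> vsupp h" for \<alpha> k
    using homvD[OF homv_hcomp that[unfolded h_def]] by simp
  have pd: "pair_done ?G (set (syzs s)) i j" if "(i, j) \<in> all_pairs ?G" "pair_deg ?G i j \<le> d" for i j
  proof -
    have "(i, j) \<notin> spairs s" using dg that(2) \<open>d < \<nu>\<close> by (auto simp: degrees_ok_def)
    then show ?thesis using p that(1) by (auto simp: pairs_ok_def)
  qed
  have Z: "set (syzs s) \<subseteq> syz ?G" using p by (auto simp: pairs_ok_def)
  obtain h' where "h' \<in> fcar {..<length ?G}" "h' \<noteq> 0" "LM P r y = height ?G h'"
    using done_pairs_representation[OF G closed_submodule_syz Z Z pd h hd] yh y(3) by auto
  then show ?thesis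
    using height_mon_dvd[OF gb_okD(1)[OF G]] by (metis in_set_conv_nth)
qed

text \<open>The two steps that append an element to the list rest on the same facts about a nonzero remainder
  \<open>\<eta>\<close>: it is homogeneous of the degree of the round, and no element of the list divides its leading
  monomial.  An S-polynomial then gets its syzygy with the additional quotient \<open>1\<close> of \<open>\<eta>\<close>; an input
  is new modulo the generators kept, because the list is a truncated Groebner basis.\<close>

lemma minsub_inv_step:
  assumes inv: "minsub_inv \<nu> s" and step: "minsub_step P E b r U s s'"
  shows "\<exists>\<nu>'. minsub_inv \<nu>' s'"
proof -
  let ?G = "gb s" let ?n = "length (gb s)"
  have G: "gb_ok \<nu> ?G" and R: "rows_ok ?G (umin s) (vrows s)"
    and p: "pairs_ok ?G (syzs s) (spairs s \<union> spairs_now s)"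
    and w: "waiting_ok ?G (waiting s \<union> waiting_now s)" and m: "minimal_ok \<nu> (umin s)"
    and dg: "degrees_ok \<nu> s"
    using inv by (simp_all add: minsub_inv_def)
  note GE = gb_okD(1)[OF G]
  have pair_facts: "(i, j) \<in> all_pairs ?G" "i < ?n" "j < ?n" "Suc (pair_deg ?G i j) = \<nu>"
    "S_poly P r (?G ! i) (?G ! j) \<in> fcar E"
    "below (S_poly P r (?G ! i) (?G ! j)) (mlcm (LM P r (?G ! i)) (LM P r (?G ! j)))"
    "mlcm (LM P r (?G ! i)) (LM P r (?G ! j)) \<in> mons"
    "homv b (pair_deg ?G i j) (S_poly P r (?G ! i) (?G ! j))" if ij: "(i, j) \<in> spairs_now s" for i j
  proof -
    show "(i, j) \<in> all_pairs ?G" using p ij by (auto simp: pairs_ok_def)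
    then have *: "i < ?n" "j < ?n" and c: "snd (LM P r (?G ! i)) = snd (LM P r (?G ! j))"
      by (auto simp: all_pairs_def)
    show "i < ?n" "j < ?n" by (rule *)+
    show "Suc (pair_deg ?G i j) = \<nu>" using dg ij by (auto simp: degrees_ok_def)
    note gi = gb_okD(4,5,2)[OF G *(1)] and gj = gb_okD(4,5,2)[OF G *(2)]
    show "S_poly P r (?G ! i) (?G ! j) \<in> fcar E"
      "below (S_poly P r (?G ! i) (?G ! j)) (mlcm (LM P r (?G ! i)) (LM P r (?G ! j)))"
      "homv b (pair_deg ?G i j) (S_poly P r (?G ! i) (?G ! j))"
      using S_poly_props[OF gi(1,2) gj(1,2) c] gi(3) gj(3) by blast+
    show "mlcm (LM P r (?G ! i)) (LM P r (?G ! j)) \<in> mons"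
      using mlcm_mons LM_props(3) gi gj by blast
  qed
  from step show ?thesis
  proof (cases rule: minsub_step.cases)
    case (new_round sd wd \<mu>)
    let ?D = "sd ` spairs s \<union> wd ` waiting s"
    have sub: "spairs s \<subseteq> all_pairs ?G" "waiting s \<subseteq> {..<length U}"
      using p w by (auto simp: pairs_ok_def waiting_ok_def)
    have fin: "finite ?D"
      using finite_subset[OF sub(1) finite_all_pairs] finite_subset[OF sub(2)] by simp
    have sd: "sd (i, j) = pair_deg ?G i j" for i j using new_round by simp
    have wd: "wd j = dg (U ! j)" for j using new_round by simp
    have ge: "\<nu> \<le> d" if "d \<in> ?D" for d
      using that dg by (auto simp: degrees_ok_def sd wd)
    have mu: "\<mu> \<in> ?D" using Min_in[OF fin] new_round by auto
    have le: "\<mu> \<le> d" if "d \<in> ?D" for d using Min_le[OF fin that] new_round by simp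
    have nu: "\<nu> \<le> Suc \<mu>" using ge[OF mu] by simp
    have fields: "gb s' = ?G" "umin s' = umin s" "vrows s' = vrows s" "syzs s' = syzs s"
      "spairs s' \<union> spairs_now s' = spairs s \<union> spairs_now s"
      "waiting s' \<union> waiting_now s' = waiting s \<union> waiting_now s"
      using new_round(2,3) by (auto simp: new_round(1))
    have "degrees_ok (Suc \<mu>) s'"
      unfolding degrees_ok_def new_round(1) using le
      by (fastforce simp: sd[symmetric] wd[symmetric] Suc_le_eq le_less)
    then have "minsub_inv (Suc \<mu>) s'"
      using R p w gb_ok_mono[OF G nu] minimal_ok_mono[OF m nu]
      unfolding minsub_inv_def fields by blast
    then show ?thesis by blast
  next
    case (S_poly_zero i j q z)
    note F = pair_facts[OF S_poly_zero(2)]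
    note D = division_props[OF GE F(5) S_poly_zero(3)]
    have z: "z = pair_syz ?G i j q" using S_poly_zero by (simp add: pair_syz_def)
    have hz: "homv (degs ?G) (pair_deg ?G i j) z"
      unfolding z by (rule homv_pair_syz[OF G F(1)]) (rule D(7)[OF gb_okD(2)[OF G] F(8)])
    have zs: "z \<in> syz ?G"
      using D(3) row_mult_pair_syz[OF F(2,3), of q] pair_syz_fcar[OF F(2,3) D(1)]
      by (simp add: z syz_iff)
    let ?Z = "set (syzs s @ [z])"
    have "pair_done ?G ?Z i j"
      unfolding pair_done_def
      using D(1) D(4)[OF F(7,6)] hz by (intro exI[of _ q]) (simp add: z)
    moreover have "pair_done ?G ?Z k l" if "(k, l) \<in> all_pairs ?G" "(k, l) \<notin> spairs s \<union> spairs_now s" for k l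
      by (rule pair_done_mono[OF pairs_okD[OF p that]]) auto
    ultimately have "\<forall>(k, l)\<in>all_pairs ?G - (spairs s \<union> (spairs_now s - {(i, j)})). pair_done ?G ?Z k l"
      by blast
    then have "pairs_ok ?G (syzs s @ [z]) (spairs s \<union> (spairs_now s - {(i, j)}))"
      using p hz zs unfolding pairs_ok_def by auto
    then have "minsub_inv \<nu> s'"
      using G R w m dg by (simp add: minsub_inv_def S_poly_zero(1) degrees_ok_def)
    then show ?thesis by blast
  next
    case (S_poly_nonzero i j q \<eta> z)
    note F = pair_facts[OF S_poly_nonzero(2)]
    note D = division_props[OF GE F(5) S_poly_nonzero(3)]
    have z: "z = pair_syz ?G i j q" using S_poly_nonzero by (simp add: pair_syz_def)
    have hq: "homv (degs ?G) (pair_deg ?G i j) q" by (rule D(7)[OF gb_okD(2)[OF G] F(8)])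
    have hz: "homv (degs ?G) (pair_deg ?G i j) z"
      unfolding z by (rule homv_pair_syz[OF G F(1) hq])
    have h\<eta>: "homv b (pair_deg ?G i j) \<eta>" by (rule D(8)[OF gb_okD(2)[OF G] F(8)])
    have d\<eta>: "dg \<eta> = pair_deg ?G i j" by (rule dg_eq[OF D(2) S_poly_nonzero(4) h\<eta>])
    have irr: "\<not> mon_dvd (LM P r (?G ! k)) (LM P r \<eta>)" if "k < ?n" for k
      by (rule D(6)[OF S_poly_nonzero(4) that])
    have zf: "z \<in> fcar {..<?n}" unfolding z by (rule pair_syz_fcar[OF F(2,3) D(1)])
    have z\<eta>: "row_mult z ?G = \<eta>"
      using row_mult_pair_syz[OF F(2,3), of q] D(3) by (simp add: z)
    let ?G' = "?G @ [\<eta>]" let ?z' = "z - single ?n 1"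
    have G': "gb_ok \<nu> ?G'"
      by (rule gb_ok_snoc[OF G D(2) S_poly_nonzero(4) h\<eta> _ irr]) (use F(4) in simp_all)
    have z'f: "?z' \<in> fcar {..<length ?G'}" using fcar_snoc[OF zf] by (simp add: fcar_single)
    have z's: "?z' \<in> syz ?G'"
      using z'f zf z\<eta> unfolding syz_iff
      by (simp add: row_mult_diff row_mult_single row_mult_snoc_fcar lmul_simps)
    have hz': "homv (degs ?G') (pair_deg ?G i j) ?z'"
      using hz homv_snoc[OF zf] d\<eta> by (intro homv_diff) (simp_all add: homv_single supp_1)
    have "pair_done ?G' (set (syzs s @ [?z'])) i j"
      unfolding pair_done_def
    proof (intro exI[of _ "q + single ?n 1"] conjI)
      have e: "pair_syz ?G' i j (q + single ?n 1) = ?z'"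
        using F(2,3) by (simp add: pair_syz_def z nth_append)
      show "pair_syz ?G' i j (q + single ?n 1) \<in> set (syzs s @ [?z'])" by (simp add: e)
      show "homv (degs ?G') (pair_deg ?G' i j) (pair_syz ?G' i j (q + single ?n 1))"
        using hz' unfolding e old_pair_degree[OF F(1)] .
      show "q + single ?n 1 \<in> fcar {..<length ?G'}"
        using fcar_snoc[OF D(1)] by (simp add: fcar_single)
      have "below \<eta> (mlcm (LM P r (?G ! i)) (LM P r (?G ! j)))" by (rule D(5)[OF F(7,6)])
      then have "r (LM P r \<eta>) (mlcm (LM P r (?G ! i)) (LM P r (?G ! j)))"
        using LM_props(1)[OF D(2) S_poly_nonzero(4)] by (simp add: below_def)
      then have "heights_below ?G' (single ?n 1) (mlcm (LM P r (?G ! i)) (LM P r (?G ! j)))"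
        by (simp add: heights_below_def vsupp_single supp_1 shift_def)
      then show "heights_below ?G' (q + single ?n 1) (mlcm (LM P r (?G' ! i)) (LM P r (?G' ! j)))"
        using D(4)[OF F(7,6)] heights_below_snoc[OF D(1)] F(2,3)
        by (simp add: heights_below_add nth_append)
    qed
    then have p': "pairs_ok ?G' (syzs s @ [?z']) (spairs s \<union> (spairs_now s - {(i, j)}) \<union> new_pairs P r ?G \<eta>)"
      using z's hz' p by (intro pairs_ok_snoc[OF p]) (auto simp: pairs_ok_def)
    have R': "rows_ok ?G' (umin s) (vrows s @ [row_mult z (vrows s)])"
    proof -
      have "row_mult (row_mult z (vrows s)) (umin s) = \<eta>"
        by (simp add: row_mult_assoc map_rows[OF R] z\<eta>)
      moreover have "homv (degs (umin s)) (dg \<eta>) (row_mult z (vrows s))"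
        unfolding d\<eta> by (rule homv_row_mult[OF hz]) (use R in \<open>auto simp: rows_ok_def\<close>)
      moreover have "row_mult z (vrows s) \<in> fcar {..<length (umin s)}"
        by (rule fcar_row_mult) (use R in \<open>auto simp: rows_ok_def in_set_conv_nth\<close>)
      ultimately show ?thesis
        using R row_space_append[of ?G "[\<eta>]"] unfolding rows_ok_def
        by (auto simp: nth_append less_Suc_eq)
    qed
    have "degrees_ok \<nu> s'"
      unfolding degrees_ok_def S_poly_nonzero(1)
      using dg new_pairs_degree[OF G D(2) S_poly_nonzero(4) h\<eta> F(4) irr] p
      by (auto simp: degrees_ok_def pairs_ok_def old_pair_degree subset_iff)
    then have "minsub_inv \<nu> s'"
      using G' R' p' waiting_ok_snoc[OF w] m
      by (simp add: minsub_inv_def S_poly_nonzero(1) Un_ac)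
    then show ?thesis by blast
  next
    case (input_zero j q)
    have "j < length U" using w input_zero(3) by (auto simp: waiting_ok_def)
    then have x: "U ! j \<in> fcar E" using inputs by simp
    have "U ! j = row_mult q ?G" using division_props(3)[OF GE x input_zero(4)] by simp
    then have "waiting_ok ?G (waiting s \<union> (waiting_now s - {j}))"
      using w by (auto simp: waiting_ok_def)
    then have "minsub_inv \<nu> s'"
      using G R p m dg by (simp add: minsub_inv_def input_zero(1) degrees_ok_def)
    then show ?thesis by blast
  next
    case (input_nonzero j q \<eta>)
    have j: "j < length U" using w input_nonzero(3) by (auto simp: waiting_ok_def)
    let ?x = "U ! j" let ?d = "dg (U ! j)" let ?l = "length (umin s)"
    have x: "?x \<in> fcar E" "?x \<noteq> 0" "homv b ?d ?x" using inputs[of ?x] input_hom[of ?x] j by auto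
    have d: "Suc ?d = \<nu>" using dg input_nonzero(3) by (auto simp: degrees_ok_def)
    note D = division_props[OF GE x(1) input_nonzero(4)]
    have hq: "homv (degs ?G) ?d q" by (rule D(7)[OF gb_okD(2)[OF G] x(3)])
    have h\<eta>: "homv b ?d \<eta>" by (rule D(8)[OF gb_okD(2)[OF G] x(3)])
    have d\<eta>: "dg \<eta> = ?d" by (rule dg_eq[OF D(2) input_nonzero(5) h\<eta>])
    have irr: "\<not> mon_dvd (LM P r (?G ! k)) (LM P r \<eta>)" if "k < ?n" for k
      by (rule D(6)[OF input_nonzero(5) that])
    let ?G' = "?G @ [\<eta>]" let ?U' = "umin s @ [?x]" let ?v = "single ?l 1 - row_mult q (vrows s)"
    have G': "gb_ok \<nu> ?G'"
      by (rule gb_ok_snoc[OF G D(2) input_nonzero(5) h\<eta> _ irr]) (use d in simp_all)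
    have p': "pairs_ok ?G' (syzs s) (spairs s \<union> spairs_now s \<union> new_pairs P r ?G \<eta>)"
      using p by (intro pairs_ok_snoc[OF p]) (auto simp: pairs_ok_def)
    have qv: "row_mult q (vrows s) \<in> fcar {..<?l}"
      by (rule fcar_row_mult) (use R in \<open>auto simp: rows_ok_def in_set_conv_nth\<close>)
    have xG': "?x \<in> row_space ?G'"
    proof (rule range_eqI)
      show "?x = row_mult (q + single ?n 1) ?G'"
        using D(3) row_mult_snoc_fcar[OF D(1), of \<eta>]
        by (simp add: row_mult_add row_mult_single lmul_simps)
    qed
    have R': "rows_ok ?G' ?U' (vrows s @ [?v])"
    proof -
      have "row_mult (row_mult q (vrows s)) (umin s) = row_mult q ?G"
        by (simp add: row_mult_assoc map_rows[OF R])
      then have "row_mult ?v ?U' = \<eta>"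
        using D(3) row_mult_snoc_fcar[OF qv, of ?x]
        by (simp add: row_mult_diff row_mult_single lmul_simps)
      moreover have "homv (degs (umin s)) ?d (row_mult q (vrows s))"
        by (rule homv_row_mult[OF hq]) (use R in \<open>auto simp: rows_ok_def\<close>)
      then have "homv (degs ?U') (dg \<eta>) ?v"
        using homv_snoc[OF qv] d\<eta> by (intro homv_diff) (simp_all add: homv_single supp_1)
      moreover have "?v \<in> fcar {..<length ?U'}"
        using fcar_snoc[OF qv] by (simp add: fcar_single)
      moreover have "vrows s ! k \<in> fcar {..<length ?U'} \<and> row_mult (vrows s ! k) ?U' = ?G ! k \<and>
        homv (degs ?U') (dg (?G ! k)) (vrows s ! k)" if k: "k < ?n" for k
      proof -
        have v: "vrows s ! k \<in> fcar {..<?l}" "row_mult (vrows s ! k) (umin s) = ?G ! k"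
          "homv (degs (umin s)) (dg (?G ! k)) (vrows s ! k)"
          using R k by (auto simp: rows_ok_def)
        show ?thesis
          using v fcar_snoc[OF v(1), of ?x] row_mult_snoc_fcar[OF v(1), of ?x]
            homv_snoc[OF v(1), of ?x "dg (?G ! k)"] by simp
      qed
      ultimately show ?thesis
        using R row_space_append[of ?G "[\<eta>]"] xG' unfolding rows_ok_def
        by (auto simp: nth_append less_Suc_eq)
    qed
    have w': "waiting_ok ?G' (waiting s \<union> (waiting_now s - {j}))"
      using waiting_ok_snoc[OF w, of \<eta>] xG' by (auto simp: waiting_ok_def)
    have new: "?x \<notin> row_space (umin s)"
    proof
      assume "?x \<in> row_space (umin s)"
      then have "?x \<in> row_space ?G"
        using row_space_subset[of "umin s" ?G] R by (auto simp: rows_ok_def)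
      then have "?x - row_mult q ?G \<in> row_space ?G"
        using closed_submoduleD(4)[OF closed_submodule_row_space, of ?x ?G "row_mult q ?G"] by blast
      then have "\<eta> \<in> row_space ?G" using D(3) by simp
      then have "\<exists>k<?n. mon_dvd (LM P r (?G ! k)) (LM P r \<eta>)"
        using truncated_groebner_basis[OF inv input_nonzero(2) _ _ h\<eta> input_nonzero(5)] d by simp
      then show False using irr by blast
    qed
    have "dg u \<le> ?d" if "u \<in> set (umin s)" for u
    proof -
      obtain k where "k < ?l" "u = umin s ! k" using \<open>u \<in> set (umin s)\<close> unfolding in_set_conv_nth by blast
      then have "dg u < \<nu>" using m by (auto simp: minimal_ok_def)
      then show ?thesis using d by simp
    qed
    then have m': "minimal_ok \<nu> ?U'"
      using m new d j unfolding minimal_ok_def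
      by (auto simp: nth_append less_Suc_eq sorted_append)
    have "degrees_ok \<nu> s'"
      unfolding degrees_ok_def input_nonzero(1)
      using dg new_pairs_degree[OF G D(2) input_nonzero(5) h\<eta> d irr] p
      by (auto simp: degrees_ok_def pairs_ok_def old_pair_degree subset_iff)
    then have "minsub_inv \<nu> s'"
      using G' R' p' w' m' by (simp add: minsub_inv_def input_nonzero(1) Un_ac)
    then show ?thesis by blast
  qed
qed

lemma minsub_inv_reachable:
  assumes "(minsub_step P E b r U)\<^sup>*\<^sup>* (minsub_init U) s"
  shows "\<exists>\<nu>. minsub_inv \<nu> s"
  using assms
proof (induction rule: rtranclp_induct)
  case base
  show ?case using minsub_inv_init by blast
next
  case (step s s')
  then show ?case using minsub_inv_step by blast
qed

end

context minsub_problem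
begin

subsection \<open>Termination\<close>

lemma minsub_gb_prefix:
  "minsub_step P E b r U s s' \<Longrightarrow> \<exists>ys. gb s' = gb s @ ys"
  by (erule minsub_step.cases) auto

text \<open>A step appends to the list of Groebner basis elements, whose length \<open>B\<close> bounds, or starts a round,
  which takes something out of the pending sets, or finishes one item of the round.\<close>

lemma minsub_measure_decreases:
  assumes inv: "minsub_inv \<nu> s" and step: "minsub_step P E b r U s s'" and B: "length (gb s') \<le> B"
  shows "((B - length (gb s'), card (spairs s') + card (waiting s'), card (spairs_now s') + card (waiting_now s')),
     (B - length (gb s), card (spairs s) + card (waiting s), card (spairs_now s) + card (waiting_now s)))
     \<in> less_than <*lex*> less_than <*lex*> less_than"
proof -
  have sub: "spairs s \<union> spairs_now s \<subseteq> all_pairs (gb s)" "waiting s \<union> waiting_now s \<subseteq> {..<length U}"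
    using inv by (auto simp: minsub_inv_def pairs_ok_def waiting_ok_def)
  have fin: "finite (spairs s)" "finite (spairs_now s)" "finite (waiting s)" "finite (waiting_now s)"
    using finite_subset[OF sub(1) finite_all_pairs] finite_subset[OF sub(2)] by auto
  from step show ?thesis
  proof (cases rule: minsub_step.cases)
    case (new_round sd wd \<mu>)
    have "\<mu> \<in> sd ` spairs s \<union> wd ` waiting s"
      unfolding new_round(7) by (rule Min_in) (use fin new_round(4) in auto)
    moreover have "card {p \<in> spairs s. sd p \<noteq> \<mu>} \<le> card (spairs s)"
      "card {j \<in> waiting s. wd j \<noteq> \<mu>} \<le> card (waiting s)"
      using fin by (auto intro: card_mono)
    moreover have "card {p \<in> spairs s. sd p \<noteq> \<mu>} < card (spairs s)" if "\<mu> \<in> sd ` spairs s"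
      using that fin by (intro psubset_card_mono) auto
    moreover have "card {j \<in> waiting s. wd j \<noteq> \<mu>} < card (waiting s)" if "\<mu> \<in> wd ` waiting s"
      using that fin by (intro psubset_card_mono) auto
    ultimately show ?thesis by (auto simp: new_round(1))
  next
    case (S_poly_zero i j q z)
    then have "card (spairs_now s - {(i, j)}) < card (spairs_now s)"
      using fin by (intro card_Diff1_less) auto
    then show ?thesis by (simp add: S_poly_zero(1))
  next
    case (input_zero j q)
    then have "card (waiting_now s - {j}) < card (waiting_now s)"
      using fin by (intro card_Diff1_less) auto
    then show ?thesis by (simp add: input_zero(1))
  qed (use B in auto)
qed

text \<open>In an infinite run the list would grow beyond all bounds, and its leading monomials would violate
  Dickson's lemma.\<close>

lemma minsub_halts: "halts (minsub_step P E b r U) minsub_final (minsub_init U)"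
  unfolding halts_def
proof (intro conjI allI impI)
  show "\<not> (\<exists>f. f 0 = minsub_init U \<and> (\<forall>k. minsub_step P E b r U (f k) (f (Suc k))))"
  proof
    assume "\<exists>f. f 0 = minsub_init U \<and> (\<forall>k. minsub_step P E b r U (f k) (f (Suc k)))"
    then obtain f where f0: "f 0 = minsub_init U" and f: "\<And>k. minsub_step P E b r U (f k) (f (Suc k))"
      by blast
    have "(minsub_step P E b r U)\<^sup>*\<^sup>* (minsub_init U) (f k)" for k
    proof (induction k)
      case (Suc k)
      then show ?case using f[of k] by (rule rtranclp.rtrancl_into_rtrancl)
    qed (simp add: f0)
    then have inv: "\<exists>\<nu>. minsub_inv \<nu> (f k)" for k by (rule minsub_inv_reachable)
    have prefix: "\<exists>ys. gb (f l) = gb (f k) @ ys" if "k \<le> l" for k l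
      using that
    proof (induction l rule: dec_induct)
      case (step l)
      then show ?case using minsub_gb_prefix[OF f[of l]] by fastforce
    qed simp
    have "\<exists>B. \<forall>k. length (gb (f k)) \<le> B"
    proof (rule ccontr)
      assume "\<not> ?thesis"
      then have ex: "\<exists>k. n < length (gb (f k))" for n by (metis not_le)
      define K where "K = (\<lambda>n. SOME k. n < length (gb (f k)))"
      have K: "n < length (gb (f (K n)))" for n unfolding K_def by (rule someI_ex[OF ex])
      define L where "L = (\<lambda>n. LM P r (gb (f (K n)) ! n))"
      have L: "L n = LM P r (gb (f k) ! n)" if "n < length (gb (f k))" for n k
      proof (cases "K n \<le> k")
        case True
        then show ?thesis using prefix[OF True] K[of n] by (auto simp: L_def nth_append)
      next
        case False
        then show ?thesis using prefix[of k "K n"] that by (auto simp: L_def nth_append)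
      qed
      have "L n \<in> mons" for n
      proof -
        obtain \<nu> where "gb_ok \<nu> (gb (f (K n)))" using inv by (auto simp: minsub_inv_def)
        then show ?thesis using LM_nth_mons[OF gb_okD(1) K] by (simp add: L_def)
      qed
      then obtain i j where ij: "i < j" "mon_dvd (L i) (L j)"
        using dickson_sequence[OF finite_E] by metis
      obtain \<nu> where G: "gb_ok \<nu> (gb (f (K j)))" using inv by (auto simp: minsub_inv_def)
      show False
        using gb_okD(6)[OF G ij(1) K] ij L[of i "K j"] L[of j "K j"] K[of j] by simp
    qed
    then obtain B where B: "\<And>k. length (gb (f k)) \<le> B" by blast
    define \<mu> where "\<mu> = (\<lambda>s. (B - length (gb s), card (spairs s) + card (waiting s),
      card (spairs_now s) + card (waiting_now (s :: 'a minsub_state))))"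
    have "(\<mu> (f (Suc k)), \<mu> (f k)) \<in> less_than <*lex*> less_than <*lex*> less_than" for k
    proof -
      obtain \<nu> where "minsub_inv \<nu> (f k)" using inv by blast
      then show ?thesis unfolding \<mu>_def by (rule minsub_measure_decreases[OF _ f B])
    qed
    then have "\<exists>g. \<forall>k. (g (Suc k), g k) \<in> less_than <*lex*> less_than <*lex*> less_than"
      by (intro exI[of _ "\<lambda>k. \<mu> (f k)"] allI)
    moreover have "wf (less_than <*lex*> less_than <*lex*> less_than)"
      by (intro wf_lex_prod wf_less_than)
    ultimately show False unfolding wf_iff_no_infinite_down_chain by blast
  qed
next
  fix s assume "(minsub_step P E b r U)\<^sup>*\<^sup>* (minsub_init U) s"
  then obtain \<nu> where inv: "minsub_inv \<nu> s" using minsub_inv_reachable by blast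
  then have G: "gb_ok \<nu> (gb s)" by (simp add: minsub_inv_def)
  note GE = gb_okD(1)[OF G]
  show "minsub_final s \<or> (\<exists>u. minsub_step P E b r U s u)"
  proof (cases "spairs_now s = {}")
    case False
    then obtain i j where ij: "(i, j) \<in> spairs_now s" by auto
    then have "(i, j) \<in> all_pairs (gb s)" using inv by (auto simp: minsub_inv_def pairs_ok_def)
    then have *: "i < length (gb s)" "j < length (gb s)" "snd (LM P r (gb s ! i)) = snd (LM P r (gb s ! j))"
      by (auto simp: all_pairs_def)
    have "S_poly P r (gb s ! i) (gb s ! j) \<in> fcar E"
      by (rule S_poly_props(1)[OF gb_okD(4,5)[OF G *(1)] gb_okD(4,5)[OF G *(2)] *(3)])
    then obtain q \<eta> where "division P r (gb s) (S_poly P r (gb s ! i) (gb s ! j)) q \<eta>"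
      by (rule division_exists[OF GE])
    then show ?thesis
      using minsub_step.S_poly_zero[OF ij, of P r q] minsub_step.S_poly_nonzero[OF ij, of P r q \<eta>]
      by (cases "\<eta> = 0") blast+
  next
    case sn: True
    show ?thesis
    proof (cases "waiting_now s = {}")
      case False
      then obtain j where j: "j \<in> waiting_now s" by auto
      then have "j < length U" using inv by (auto simp: minsub_inv_def waiting_ok_def)
      then have "U ! j \<in> fcar E" using inputs by simp
      then obtain q \<eta> where "division P r (gb s) (U ! j) q \<eta>"
        by (rule division_exists[OF GE])
      then show ?thesis
        using minsub_step.input_zero[OF sn j, of P r U q] minsub_step.input_nonzero[OF sn j, of P r U q \<eta>]
        by (cases "\<eta> = 0") blast+
    next
      case wn: True
      show ?thesis
      proof (cases "spairs s = {} \<and> waiting s = {}")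
        case True
        then show ?thesis using sn wn by (simp add: minsub_final_def)
      next
        case False
        then have "\<exists>u. minsub_step P E b r U s u"
          using minsub_step.new_round[OF sn wn _ refl refl refl] by blast
        then show ?thesis by blast
      qed
    qed
  qed
qed

lemma minsub_division_halts:
  assumes "(minsub_step P E b r U)\<^sup>*\<^sup>* (minsub_init U) s" "x \<in> fcar E"
  shows "halts (div_step P r (gb s)) div_final (x, 0, 0)"
proof -
  obtain \<nu> where "minsub_inv \<nu> s" using minsub_inv_reachable[OF assms(1)] by blast
  then have "gb_ok \<nu> (gb s)" by (simp add: minsub_inv_def)
  then show ?thesis by (rule division_halts[OF gb_okD(1) assms(2)])
qed


subsection \<open>The output\<close>

text \<open>At the end all pairs are done, so standard representations are available in every degree: for an
  element of the submodule they give a divisor of its leading monomial, and for a syzygy they say that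
  it lies in the span of the recorded ones.\<close>

lemma minsub_output_props:
  assumes reach: "(minsub_step P E b r U)\<^sup>*\<^sup>* (minsub_init U) s" and fin: "minsub_final s"
  defines "N \<equiv> row_space U"
  shows "\<exists>\<nu>. gb_ok \<nu> (gb s)" "rows_ok (gb s) (umin s) (vrows s)" "set (umin s) \<subseteq> set U"
    "row_space (umin s) = N" "row_space (gb s) = N"
    "k < length (umin s) \<Longrightarrow> umin s ! k \<notin> row_space (take k (umin s))"
    "sorted (map dg (umin s))"
    "set (gb s) \<subseteq> N - {0}"
    "x \<in> N \<Longrightarrow> x \<noteq> 0 \<Longrightarrow> \<exists>g\<in>set (gb s). mon_dvd (LM P r g) (LM P r x)"
    "row_space (syzs s) = syz (gb s)"
    "z \<in> set (syzs s) \<Longrightarrow> \<exists>d. homv (degs (gb s)) d z"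
proof -
  let ?G = "gb s"
  obtain \<nu> where inv: "minsub_inv \<nu> s" using minsub_inv_reachable[OF reach] by blast
  have G: "gb_ok \<nu> ?G" and R: "rows_ok ?G (umin s) (vrows s)" and p: "pairs_ok ?G (syzs s) {}"
    and w: "waiting_ok ?G {}" and m: "minimal_ok \<nu> (umin s)"
    using inv fin by (simp_all add: minsub_inv_def minsub_final_def)
  show "\<exists>\<nu>. gb_ok \<nu> ?G" using G by blast
  show "rows_ok ?G (umin s) (vrows s)" by (rule R)
  show um: "set (umin s) \<subseteq> set U" and "sorted (map dg (umin s))"
    "k < length (umin s) \<Longrightarrow> umin s ! k \<notin> row_space (take k (umin s))"
    using m by (simp_all add: minimal_ok_def)
  have "set ?G \<subseteq> row_space (umin s)"
  proof
    fix g assume "g \<in> set ?G"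
    then obtain k where "k < length ?G" "g = ?G ! k" by (metis in_set_conv_nth)
    then have "g = row_mult (vrows s ! k) (umin s)" using R by (simp add: rows_ok_def)
    then show "g \<in> row_space (umin s)" by blast
  qed
  then have 1: "row_space ?G \<subseteq> row_space (umin s)" by (rule row_space_subset)
  have 2: "row_space (umin s) \<subseteq> N"
    unfolding N_def by (rule row_space_subset) (use um row_space_member[of _ U] in blast)
  have 3: "N \<subseteq> row_space ?G"
    unfolding N_def by (rule row_space_subset) (use w in \<open>auto simp: waiting_ok_def in_set_conv_nth\<close>)
  show "row_space (umin s) = N" using 1 2 3 by blast
  show gN: "row_space ?G = N" using 1 2 3 by blast
  show "set ?G \<subseteq> N - {0}" using gN row_space_member[of _ ?G] gb_okD(1)[OF G] by blast
  have Z: "set (syzs s) \<subseteq> syz ?G" using p by (auto simp: pairs_ok_def)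
  have Zr: "set (syzs s) \<subseteq> row_space (syzs s)" using row_space_member[of _ "syzs s"] by blast
  have rep: "\<exists>h'\<in>fcar {..<length ?G}. h - h' \<in> row_space (syzs s) \<and>
    row_mult h' ?G = row_mult h ?G \<and> (row_mult h ?G = 0 \<longrightarrow> h' = 0) \<and>
    (row_mult h ?G \<noteq> 0 \<longrightarrow> h' \<noteq> 0 \<and> LM P r (row_mult h ?G) = height ?G h')"
    if h: "h \<in> fcar {..<length ?G}" for h
  proof -
    \<comment> \<open>a common bound for the degrees in \<open>h\<close>, which need not be homogeneous\<close>
    let ?d = "Max (insert 0 ((\<lambda>(\<alpha>, k). deg P \<alpha> + dg (?G ! k)) ` vsupp h))"
    have "finite (vsupp h)" using finite_vsupp[OF _ h] by simp
    then have "deg P \<alpha> + dg (?G ! k) \<le> ?d" if "(\<alpha>, k) \<in> vsupp h" for \<alpha> k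
      using that by (intro Max_ge) force+
    then show ?thesis
      by (rule done_pairs_representation[OF G closed_submodule_row_space Zr Z _ h, rotated])
        (assumption, rule pairs_okD[OF p], assumption, simp)
  qed
  show "x \<in> N \<Longrightarrow> x \<noteq> 0 \<Longrightarrow> \<exists>g\<in>set ?G. mon_dvd (LM P r g) (LM P r x)"
  proof -
    assume x: "x \<in> N" "x \<noteq> 0"
    then obtain h0 where "x = row_mult h0 ?G" using gN by blast
    then have xh: "x = row_mult (trunc (length ?G) h0) ?G" by simp
    then obtain h' where "h' \<in> fcar {..<length ?G}" "h' \<noteq> 0" "LM P r x = height ?G h'"
      using rep[of "trunc (length ?G) h0"] x(2) by auto
    then show ?thesis using height_mon_dvd[OF gb_okD(1)[OF G]] by metis
  qed
  show "row_space (syzs s) = syz ?G"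
  proof
    show "row_space (syzs s) \<subseteq> syz ?G"
      using closed_submodule_row_mult[OF closed_submodule_syz Z] by blast
    show "syz ?G \<subseteq> row_space (syzs s)"
    proof
      fix h assume "h \<in> syz ?G"
      then have "h \<in> fcar {..<length ?G}" "row_mult h ?G = 0" by (simp_all add: syz_iff)
      then have "h - 0 \<in> row_space (syzs s)" using rep[of h] by auto
      then show "h \<in> row_space (syzs s)" by simp
    qed
  qed
  show "z \<in> set (syzs s) \<Longrightarrow> \<exists>d. homv (degs (gb s)) d z"
    using p by (auto simp: pairs_ok_def)
qed

context
  fixes s
  assumes reach: "(minsub_step P E b r U)\<^sup>*\<^sup>* (minsub_init U) s" and fin: "minsub_final s"
begin

lemmas out = minsub_output_props[OF reach fin]

lemma umin_props:
  assumes "k < length (umin s)"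
  shows "umin s ! k \<in> fcar E" "umin s ! k \<noteq> 0" "homv b (dg (umin s ! k)) (umin s ! k)"
proof -
  have "umin s ! k \<in> set U" using out(3) assms by auto
  then show "umin s ! k \<in> fcar E" "umin s ! k \<noteq> 0" "homv b (dg (umin s ! k)) (umin s ! k)"
    using inputs input_hom by blast+
qed

lemma gb_props:
  assumes "k < length (gb s)"
  shows "gb s ! k \<in> fcar E" "gb s ! k \<noteq> 0" "homv b (dg (gb s ! k)) (gb s ! k)"
  using out(1) gb_okD(2,4,5)[OF _ assms] by blast+

lemma distinct_umin: "distinct (umin s)"
  unfolding distinct_conv_nth
proof (intro allI impI)
  have *: "umin s ! i \<noteq> umin s ! j" if "i < j" "j < length (umin s)" for i j
  proof
    assume "umin s ! i = umin s ! j"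
    then have "umin s ! j \<in> set (take j (umin s))"
      using that by (auto simp: in_set_conv_nth intro!: exI[of _ i])
    then show False using out(6)[OF that(2)] row_space_member by blast
  qed
  fix i j assume "i < length (umin s)" "j < length (umin s)" "i \<noteq> j"
  then show "umin s ! i \<noteq> umin s ! j" using *[of i j] *[of j i] by (cases "i < j") auto
qed

text \<open>A homogeneous syzygy with a constant entry would put the last generator with such an entry into
  the span of earlier ones: the generators after it have at least its degree, so that their entries
  are constant, hence zero.\<close>

lemma homogeneous_syzygy_posv:
  assumes h: "h \<in> syz (umin s)" and hom: "homv (degs (umin s)) d h"
  shows "h \<in> posv"
proof (rule ccontr)
  let ?n = "length (umin s)"
  let ?K = "{k. k < ?n \<and> coef P (h k) 0 \<noteq> 0}"
  have hf: "h \<in> fcar {..<?n}" and h0: "row_mult h (umin s) = 0" using h by (simp_all add: syz_iff)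
  assume "h \<notin> posv"
  then obtain k0 where "coef P (h k0) 0 \<noteq> 0" by (auto simp: posv_def)
  moreover from this have "k0 < ?n" using fcarD[OF hf, of k0] by (cases "k0 < ?n") auto
  ultimately have ne: "?K \<noteq> {}" by blast
  have finK: "finite ?K" by simp
  define k where "k = Max ?K"
  have k: "k < ?n" "coef P (h k) 0 \<noteq> 0" using Max_in[OF finK ne] by (auto simp: k_def)
  have dk: "d = dg (umin s ! k)"
    using homvD[OF hom, of 0 k] k(2) by (simp add: vsupp_iff supp_def)
  have const: "h l = smulK P (coef P (h l) 0) 1" if "l \<ge> k" "l < ?n" for l
  proof (rule constant_eq, rule subsetI)
    fix \<alpha> assume \<alpha>: "\<alpha> \<in> supp (h l)"
    have "dg (umin s ! k) \<le> dg (umin s ! l)"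
      using sorted_nth_mono[OF out(7), of k l] that by simp
    then have "deg P \<alpha> = 0" using homvD[OF hom, of \<alpha> l] \<alpha> dk by (simp add: vsupp_iff)
    then show "\<alpha> \<in> {0}" using deg_eq_0 suppD(1)[OF \<alpha>] by simp
  qed
  have zero: "h l = 0" if "k < l" "l < ?n" for l
  proof -
    have "coef P (h l) 0 = 0"
    proof (rule ccontr)
      assume "coef P (h l) 0 \<noteq> 0"
      then have "l \<le> k" unfolding k_def using finK that(2) by (intro Max_ge) auto
      then show False using that(1) by simp
    qed
    then show ?thesis using const[of l] that by simp
  qed
  let ?c = "coef P (h k) 0"
  have "row_mult h (umin s) = row_mult h (take k (umin s)) + lmul (h k) (umin s ! k)"
  proof -
    have split: "umin s = (take k (umin s) @ [umin s ! k]) @ drop (Suc k) (umin s)"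
      using id_take_nth_drop[OF k(1)] by simp
    have "row_mult (\<lambda>l. h (length (take k (umin s) @ [umin s ! k]) + l)) (drop (Suc k) (umin s)) = 0"
      using zero k(1) by (subst row_mult_cong[of _ _ 0]) (simp_all add: zero_fun_apply)
    then show ?thesis
      using k(1) row_mult_append[of h "take k (umin s) @ [umin s ! k]" "drop (Suc k) (umin s)"]
      by (subst split) (simp add: row_mult_append1)
  qed
  then have "lmul (h k) (umin s ! k) = - row_mult h (take k (umin s))"
    using h0 by (simp add: eq_neg_iff_add_eq_0 add.commute)
  then have "lmul (smulK P (1 / ?c) 1) (lmul (h k) (umin s ! k))
    = lmul (smulK P (1 / ?c) 1) (lmul (- 1) (row_mult h (take k (umin s))))" by (simp add: lmul_simps(9))
  moreover have "lmul (smulK P (1 / ?c) 1) (lmul (h k) (umin s ! k)) = umin s ! k"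
    using const[of k] k by (simp add: lmul_simps smulK_mult_left)
      (metis (no_types, lifting) lmul_simps(8) vs.scale_one vs.scale_scale nonzero_divide_eq_eq)
  ultimately have "umin s ! k = row_mult (lmul (smulK P (1 / ?c) 1) (lmul (- 1) h)) (take k (umin s))"
    by (simp only: row_mult_lmul)
  then show False using out(6)[OF k(1)] by blast
qed

lemma division_matrix_props:
  assumes W: "division_matrix P r s W" and k: "k < length (umin s)"
  shows "W ! k \<in> fcar {..<length (gb s)}" "row_mult (W ! k) (gb s) = umin s ! k"
    "homv (degs (gb s)) (dg (umin s ! k)) (W ! k)"
proof -
  obtain \<rho> where div: "division P r (gb s) (umin s ! k) (W ! k) \<rho>"
    using W k by (auto simp: division_matrix_def)
  have N: "row_space U \<subseteq> fcar E" using inputs by (auto intro!: fcar_row_mult)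
  have x: "umin s ! k \<in> row_space U"
    by (rule row_space_member[OF subsetD[OF out(3) nth_mem[OF k]]])
  have "\<rho> = 0"
    by (rule groebner_remainder_zero[OF closed_submodule_row_space N out(8) out(9) x div])
  have G: "set (gb s) \<subseteq> fcar E - {0}" using out(1) gb_okD(1) by blast
  note D = division_props[OF G umin_props(1)[OF k] div]
  show "W ! k \<in> fcar {..<length (gb s)}" by (rule D(1))
  show "row_mult (W ! k) (gb s) = umin s ! k" using D(3) \<open>\<rho> = 0\<close> by simp
  show "homv (degs (gb s)) (dg (umin s ! k)) (W ! k)"
    by (rule D(7)[OF gb_props(3) umin_props(3)[OF k]])
qed

lemma division_matrix_exists: "\<exists>W. division_matrix P r s W"
proof -
  have G: "set (gb s) \<subseteq> fcar E - {0}" using out(1) gb_okD(1) by blast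
  have "\<exists>q \<rho>. division P r (gb s) (umin s ! k) q \<rho>" if "k < length (umin s)" for k
    using division_exists[OF G umin_props(1)[OF that]] by metis
  then obtain q where q: "\<And>k. k < length (umin s) \<Longrightarrow> \<exists>\<rho>. division P r (gb s) (umin s ! k) (q k) \<rho>"
    by metis
  then show ?thesis
    by (intro exI[of _ "map q [0..<length (umin s)]"]) (simp add: division_matrix_def)
qed

lemma syzygy_rows_props:
  assumes W: "division_matrix P r s W" and z: "z \<in> set (syzygy_rows s W)"
  shows "z \<in> syz (umin s)" "\<exists>d. homv (degs (umin s)) d z"
proof -
  let ?n = "length (umin s)"
  have R: "length (vrows s) = length (gb s)" "\<And>k. k < length (gb s) \<Longrightarrow> vrows s ! k \<in> fcar {..<?n}"
    "\<And>k. k < length (gb s) \<Longrightarrow> homv (degs (umin s)) (dg (gb s ! k)) (vrows s ! k)"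
    using out(2) by (auto simp: rows_ok_def)
  have V: "set (vrows s) \<subseteq> fcar {..<?n}" using R by (auto simp: in_set_conv_nth)
  have GV: "row_mult (row_mult h (vrows s)) (umin s) = row_mult h (gb s)" for h
    by (simp add: row_mult_assoc map_rows[OF out(2)])
  have hom: "homv (degs (umin s)) d (row_mult h (vrows s))" if "homv (degs (gb s)) d h" for d h
    by (rule homv_row_mult[OF that]) (use R in simp)
  consider z0 where "z0 \<in> set (syzs s)" "z = row_mult z0 (vrows s)"
    | k where "k < ?n" "z = row_mult (W ! k) (vrows s) - single k 1"
    using z by (auto simp: syzygy_rows_def)
  then have "z \<in> syz (umin s) \<and> (\<exists>d. homv (degs (umin s)) d z)"
  proof cases
    case 1
    have "row_mult z0 (gb s) = 0"
      using 1(1) out(10) row_space_member[of z0 "syzs s"] by (auto simp: syz_iff)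
    moreover obtain d where "homv (degs (gb s)) d z0" using out(11)[OF 1(1)] by blast
    ultimately show ?thesis using hom fcar_row_mult[OF V] by (auto simp: 1(2) syz_iff GV)
  next
    case 2
    note D = division_matrix_props[OF W 2(1)]
    have "row_mult z (umin s) = 0"
      using 2(1) by (simp add: 2(2) row_mult_diff row_mult_single GV D(2) lmul_simps)
    moreover have "homv (degs (umin s)) (dg (umin s ! k)) z"
      unfolding 2(2) using hom[OF D(3)] by (intro homv_diff) (simp_all add: homv_single supp_1)
    moreover have "z \<in> fcar {..<?n}"
      unfolding 2(2) using 2(1) fcar_row_mult[OF V] by (simp add: fcar_single)
    ultimately show ?thesis by (auto simp: syz_iff)
  qed
  then show "z \<in> syz (umin s)" "\<exists>d. homv (degs (umin s)) d z" by blast+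
qed

text \<open>For a syzygy \<open>h\<close> of the minimal generators \<open>hW\<close> is a syzygy of the Groebner basis, and
  \<open>h = hWV - h(WV - I)\<close>.\<close>

lemma syzygy_rows_span:
  assumes W: "division_matrix P r s W"
  shows "row_space (syzygy_rows s W) = syz (umin s)"
proof
  let ?n = "length (umin s)" let ?R = "row_space (syzygy_rows s W)"
  have lW: "length W = ?n" using W by (simp add: division_matrix_def)
  show "?R \<subseteq> syz (umin s)"
    using closed_submodule_row_mult[OF closed_submodule_syz] syzygy_rows_props(1)[OF W] by blast
  show "syz (umin s) \<subseteq> ?R"
  proof
    fix h assume "h \<in> syz (umin s)"
    then have hf: "h \<in> fcar {..<?n}" and h0: "row_mult h (umin s) = 0" by (simp_all add: syz_iff)
    note closed = closed_submodule_row_space[of "syzygy_rows s W"]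
    have "map (\<lambda>w. row_mult w (gb s)) W = umin s"
      using lW division_matrix_props(2)[OF W] by (intro nth_equalityI) auto
    then have "row_mult (row_mult h W) (gb s) = 0" using h0 by (simp add: row_mult_assoc)
    moreover have "set W \<subseteq> fcar {..<length (gb s)}"
      using lW division_matrix_props(1)[OF W] by (auto simp: in_set_conv_nth)
    ultimately have "row_mult h W \<in> syz (gb s)" using fcar_row_mult by (auto simp: syz_iff)
    then obtain c where c: "row_mult h W = row_mult c (syzs s)" using out(10) by blast
    let ?A = "row_mult (row_mult h W) (vrows s)"
    let ?S1 = "map (\<lambda>z. row_mult z (vrows s)) (syzs s)"
    let ?S2 = "map (\<lambda>k. row_mult (W ! k) (vrows s) - single k 1) [0..<?n]"
    have "?A = row_mult c ?S1" by (simp add: c row_mult_assoc)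
    moreover have rows: "syzygy_rows s W = ?S1 @ ?S2" by (simp add: syzygy_rows_def)
    have "row_space ?S1 \<subseteq> ?R" "row_space ?S2 \<subseteq> ?R"
      unfolding rows using row_space_member[of _ "?S1 @ ?S2"] by (intro row_space_subset; auto)+
    ultimately have A: "?A \<in> ?R" and S2: "row_mult h ?S2 \<in> ?R" by (metis (no_types, lifting) rangeI subsetD)+
    have "row_mult h ?S2 = ?A - h"
    proof -
      have "row_mult h ?S2 = (\<Sum>k<?n. lmul (h k) (row_mult (W ! k) (vrows s))) - (\<Sum>k<?n. single k (h k))"
        by (simp add: row_mult_def[of h] lmul_simps sum_subtractf)
      also have "(\<Sum>k<?n. single k (h k)) = h" using fcar_expansion[OF _ hf] by simp
      also have "(\<Sum>k<?n. lmul (h k) (row_mult (W ! k) (vrows s))) = ?A"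
        by (subst row_mult_assoc) (simp add: row_mult_def[of h] lW)
      finally show ?thesis .
    qed
    then have "h = ?A - row_mult h ?S2" by simp
    then show "h \<in> ?R" using closed_submoduleD(4)[OF closed A S2] by simp
  qed
qed

lemma syz_umin_posv: "syz (umin s) \<subseteq> posv"
proof -
  obtain W where W: "division_matrix P r s W" using division_matrix_exists by blast
  have "set (syzygy_rows s W) \<subseteq> posv"
    using syzygy_rows_props[OF W] homogeneous_syzygy_posv by blast
  then have "row_space (syzygy_rows s W) \<subseteq> posv"
    using closed_submodule_row_mult[OF closed_submodule_posv] by blast
  then show ?thesis using syzygy_rows_span[OF W] by simp
qed

text \<open>A proper subset of the generators omits some \<open>\<xi>\<^sub>k\<close> and spans only combinations without a constant term in
  the \<open>k\<close>-th coefficient; were \<open>\<xi>\<^sub>k\<close> among these, a syzygy would have a constant term \<open>1\<close>.\<close>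

lemma umin_minimal:
  assumes "T \<subset> set (umin s)"
  shows "lspan (free_mod P E b) T \<noteq> row_space U"
proof
  assume eq: "lspan (free_mod P E b) T = row_space U"
  obtain k where k: "k < length (umin s)" "umin s ! k \<notin> T"
    using assms by (metis in_set_conv_nth psubset_imp_ex_mem DiffE)
  let ?H = "{row_mult h (umin s) |h. coef P (h k) 0 = 0}"
  have umE: "set (umin s) \<subseteq> fcar E" using umin_props(1) by (auto simp: in_set_conv_nth)
  have "closed_submodule ?H"
    unfolding closed_submodule_def
  proof (intro conjI ballI allI)
    show "0 \<in> ?H" by (simp, rule exI[of _ 0]) (simp add: vec_apply)
    fix x y assume "x \<in> ?H" "y \<in> ?H"
    then obtain h h' where "x = row_mult h (umin s)" "y = row_mult h' (umin s)" "coef P (h k) 0 = 0" "coef P (h' k) 0 = 0"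
      by blast
    then show "x + y \<in> ?H" by (simp, intro exI[of _ "h + h'"]) (simp add: row_mult_add vec_apply)
  next
    fix c x assume "x \<in> ?H"
    then obtain h where "x = row_mult h (umin s)" "coef P (h k) 0 = 0" by blast
    then show "lmul c x \<in> ?H"
      by (simp, intro exI[of _ "lmul c h"]) (simp add: row_mult_lmul lmul_apply coef_mult_0)
  qed
  moreover have "T \<subseteq> ?H"
  proof
    fix t assume "t \<in> T"
    then obtain l where l: "l < length (umin s)" "t = umin s ! l" "l \<noteq> k"
      using assms k by (metis in_set_conv_nth psubsetD)
    then have "t = row_mult (single l 1) (umin s)" by (simp add: row_mult_single lmul_simps)
    moreover have "coef P (single l 1 k) 0 = 0" using l by (simp add: single_def)
    ultimately show "t \<in> ?H" by blast
  qed
  moreover have "?H \<subseteq> fcar E" using fcar_row_mult[OF umE] by blast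
  ultimately have "lspan (free_mod P E b) T \<subseteq> ?H"
    by (intro hull_minimal) (simp_all add: left_submodule_free_mod_iff)
  moreover have "umin s ! k \<in> row_space U"
    by (rule row_space_member[OF subsetD[OF out(3) nth_mem[OF k(1)]]])
  ultimately obtain h where h: "umin s ! k = row_mult h (umin s)" "coef P (h k) 0 = 0"
    using eq by blast
  let ?z = "single k 1 - trunc (length (umin s)) h"
  have "?z \<in> syz (umin s)"
    using k(1) h(1) by (simp add: syz_iff fcar_single row_mult_diff row_mult_single lmul_simps)
  then have "coef P (?z k) 0 = 0" using syz_umin_posv by (auto simp: posv_def)
  then show False using h(2) k(1) by (simp add: minus_apply trunc_def coef_1)
qed

end

end

section \<open>Presentations of graded modules\<close>

lemma coset_free_mod: "N +>\<^bsub>free_mod P E b\<^esub> x = {n + x |n. n \<in> N}"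
  by (auto simp: a_r_coset_def')

lemma quot_mod_simps:
  "carrier (quot_mod L N) = a_rcosets\<^bsub>L\<^esub> N" "C \<oplus>\<^bsub>quot_mod L N\<^esub> D = C <+>\<^bsub>L\<^esub> D"
  "r \<odot>\<^bsub>quot_mod L N\<^esub> C = (\<Union>x\<in>C. N +>\<^bsub>L\<^esub> (r \<odot>\<^bsub>L\<^esub> x))"
  "grade (quot_mod L N) q = (\<lambda>x. N +>\<^bsub>L\<^esub> x) ` grade L q"
  by (simp_all add: quot_mod_def)

lemma coset_free_mod_eq_iff:
  assumes "closed_submodule N"
  shows "N +>\<^bsub>free_mod P E b\<^esub> x = N +>\<^bsub>free_mod P E b\<^esub> y \<longleftrightarrow> x - y \<in> N"
proof
  assume "N +>\<^bsub>free_mod P E b\<^esub> x = N +>\<^bsub>free_mod P E b\<^esub> y"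
  moreover have "x \<in> N +>\<^bsub>free_mod P E b\<^esub> x"
    using closed_submoduleD(1)[OF assms] by (force simp: coset_free_mod)
  ultimately obtain n where "n \<in> N" "x = n + y" by (auto simp: coset_free_mod)
  then show "x - y \<in> N" by simp
next
  have sub: "N +>\<^bsub>free_mod P E b\<^esub> x \<subseteq> N +>\<^bsub>free_mod P E b\<^esub> y" if "x - y \<in> N" for x y
  proof
    fix z assume "z \<in> N +>\<^bsub>free_mod P E b\<^esub> x"
    then obtain n where n: "n \<in> N" "z = n + x" by (auto simp: coset_free_mod)
    then have "z = (n + (x - y)) + y" by simp
    moreover have "n + (x - y) \<in> N" using closed_submoduleD(2)[OF assms n(1) that] .
    ultimately show "z \<in> N +>\<^bsub>free_mod P E b\<^esub> y" unfolding coset_free_mod by blast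
  qed
  assume xy: "x - y \<in> N"
  have "0 - (x - y) \<in> N" by (rule closed_submoduleD(4)[OF assms closed_submoduleD(1)[OF assms] xy])
  then have "y - x \<in> N" by simp
  then show "N +>\<^bsub>free_mod P E b\<^esub> x = N +>\<^bsub>free_mod P E b\<^esub> y" using sub xy by blast
qed

lemma coset_free_mod_add:
  assumes "closed_submodule N"
  shows "(N +>\<^bsub>free_mod P E b\<^esub> x) <+>\<^bsub>free_mod P E b\<^esub> (N +>\<^bsub>free_mod P E b\<^esub> y) = N +>\<^bsub>free_mod P E b\<^esub> (x + y)"
proof
  show "(N +>\<^bsub>free_mod P E b\<^esub> x) <+>\<^bsub>free_mod P E b\<^esub> (N +>\<^bsub>free_mod P E b\<^esub> y) \<subseteq> N +>\<^bsub>free_mod P E b\<^esub> (x + y)"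
  proof
    fix z assume "z \<in> (N +>\<^bsub>free_mod P E b\<^esub> x) <+>\<^bsub>free_mod P E b\<^esub> (N +>\<^bsub>free_mod P E b\<^esub> y)"
    then obtain n m where "n \<in> N" "m \<in> N" "z = (n + x) + (m + y)"
      by (auto simp: set_add_def' coset_free_mod)
    then have "z = (n + m) + (x + y)" "n + m \<in> N" using closed_submoduleD(2)[OF assms] by (simp_all add: ac_simps)
    then show "z \<in> N +>\<^bsub>free_mod P E b\<^esub> (x + y)" unfolding coset_free_mod by blast
  qed
  show "N +>\<^bsub>free_mod P E b\<^esub> (x + y) \<subseteq> (N +>\<^bsub>free_mod P E b\<^esub> x) <+>\<^bsub>free_mod P E b\<^esub> (N +>\<^bsub>free_mod P E b\<^esub> y)"
  proof
    fix z assume "z \<in> N +>\<^bsub>free_mod P E b\<^esub> (x + y)"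
    then obtain n where n: "n \<in> N" "z = n + (x + y)" by (auto simp: coset_free_mod)
    then have "z = (n + x) + (0 + y)" by (simp add: ac_simps)
    moreover have "0 \<in> N" by (rule closed_submoduleD(1)[OF assms])
    ultimately show "z \<in> (N +>\<^bsub>free_mod P E b\<^esub> x) <+>\<^bsub>free_mod P E b\<^esub> (N +>\<^bsub>free_mod P E b\<^esub> y)"
      using n(1) unfolding set_add_def' coset_free_mod by auto
  qed
qed

lemma coset_free_mod_smult:
  assumes "closed_submodule N"
  shows "r \<odot>\<^bsub>quot_mod (free_mod P E b) N\<^esub> (N +>\<^bsub>free_mod P E b\<^esub> x) = N +>\<^bsub>free_mod P E b\<^esub> (lmul r x)"
proof -
  have "N +>\<^bsub>free_mod P E b\<^esub> (lmul r y) = N +>\<^bsub>free_mod P E b\<^esub> (lmul r x)"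
    if y: "y \<in> N +>\<^bsub>free_mod P E b\<^esub> x" for y
  proof -
    obtain n where "n \<in> N" "y = n + x" using y by (auto simp: coset_free_mod)
    then have "lmul r y - lmul r x \<in> N"
      using closed_submoduleD(3)[OF assms] by (simp add: lmul_simps)
    then show ?thesis using coset_free_mod_eq_iff[OF assms] by blast
  qed
  moreover have "x \<in> N +>\<^bsub>free_mod P E b\<^esub> x"
    using closed_submoduleD(1)[OF assms] by (force simp: coset_free_mod)
  ultimately show ?thesis unfolding quot_mod_simps smult_free_mod by blast
qed

context weighted_solvable
begin

text \<open>\<open>\<pi>\<close> is a graded epimorphism onto \<open>M\<close> with kernel \<open>N\<close>.\<close>

definition presentation ::
    "('a, 'm) graded_module \<Rightarrow> nat set \<Rightarrow> (nat \<Rightarrow> nat) \<Rightarrow> 'a vec set \<Rightarrow> ('a vec \<Rightarrow> 'm) \<Rightarrow> bool" where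
  "presentation M E b N \<pi> \<longleftrightarrow>
     (\<forall>x\<in>fcar E. \<forall>y\<in>fcar E. \<pi> (x + y) = \<pi> x \<oplus>\<^bsub>M\<^esub> \<pi> y) \<and>
     (\<forall>r. \<forall>x\<in>fcar E. \<pi> (lmul r x) = r \<odot>\<^bsub>M\<^esub> \<pi> x) \<and>
     (\<forall>q. \<pi> ` {x \<in> fcar E. homv b q x} = grade M q) \<and>
     \<pi> ` fcar E = carrier M \<and>
     (\<forall>x\<in>fcar E. \<pi> x = \<zero>\<^bsub>M\<^esub> \<longleftrightarrow> x \<in> N)"

lemma presentationD:
  assumes "presentation M E b N \<pi>"
  shows "x \<in> fcar E \<Longrightarrow> y \<in> fcar E \<Longrightarrow> \<pi> (x + y) = \<pi> x \<oplus>\<^bsub>M\<^esub> \<pi> y"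
    "x \<in> fcar E \<Longrightarrow> \<pi> (lmul r x) = r \<odot>\<^bsub>M\<^esub> \<pi> x"
    "\<pi> ` {x \<in> fcar E. homv b q x} = grade M q" "\<pi> ` fcar E = carrier M"
    "x \<in> fcar E \<Longrightarrow> \<pi> x = \<zero>\<^bsub>M\<^esub> \<longleftrightarrow> x \<in> N" "x \<in> fcar E \<Longrightarrow> \<pi> x \<in> carrier M"
  using assms unfolding presentation_def by blast+

lemma abelian_group_graded: "graded_left_module P M \<Longrightarrow> abelian_group M"
  by (simp add: graded_left_module_def left_module_def)

lemma presentation_zero:
  assumes M: "graded_left_module P M" and p: "presentation M E b N \<pi>"
  shows "\<pi> 0 = \<zero>\<^bsub>M\<^esub>"
proof -
  interpret M: abelian_group M by (rule abelian_group_graded[OF M])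
  have c0: "\<pi> 0 \<in> carrier M" by (rule presentationD(6)[OF p]) simp
  have "\<pi> (0 + 0) = \<pi> 0 \<oplus>\<^bsub>M\<^esub> \<pi> 0" by (rule presentationD(1)[OF p]) simp_all
  then show ?thesis
    unfolding add_0_left by (rule M.add.l_cancel_one'[OF c0 c0, THEN iffD1])
qed

lemma presentation_eq_iff:
  assumes M: "graded_left_module P M" and p: "presentation M E b N \<pi>"
    and x: "x \<in> fcar E" and y: "y \<in> fcar E"
  shows "\<pi> x = \<pi> y \<longleftrightarrow> x - y \<in> N"
proof -
  interpret M: abelian_group M by (rule abelian_group_graded[OF M])
  note D = presentationD[OF p]
  have xy: "x - y \<in> fcar E" using x y by simp
  have split: "\<pi> x = \<pi> (x - y) \<oplus>\<^bsub>M\<^esub> \<pi> y" using D(1)[OF xy y] by simp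
  have "\<pi> x = \<pi> y \<longleftrightarrow> \<pi> y = \<pi> (x - y) \<oplus>\<^bsub>M\<^esub> \<pi> y"
    by (subst split) (rule eq_commute)
  also have "\<dots> \<longleftrightarrow> \<pi> (x - y) = \<zero>\<^bsub>M\<^esub>"
    by (rule M.add.r_cancel_one'[OF D(6)[OF y] D(6)[OF xy]])
  also have "\<dots> \<longleftrightarrow> x - y \<in> N" by (rule D(5)[OF xy])
  finally show ?thesis .
qed

lemma presentation_of_quotient:
  assumes M: "graded_left_module P M" and E: "finite E" and N: "closed_submodule N" "N \<subseteq> fcar E"
    and \<psi>: "graded_iso (quot_mod (free_mod P E b) N) M \<psi>"
  shows "presentation M E b N (\<lambda>x. \<psi> (N +>\<^bsub>free_mod P E b\<^esub> x))"
proof -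
  let ?c = "\<lambda>x. N +>\<^bsub>free_mod P E b\<^esub> x"
  let ?Q = "quot_mod (free_mod P E b) N"
  interpret M: abelian_group M by (rule abelian_group_graded[OF M])
  have carQ: "carrier ?Q = ?c ` fcar E" by (auto simp: quot_mod_simps A_RCOSETS_def')
  have gradeQ: "grade ?Q q = ?c ` {x \<in> fcar E. homv b q x}" for q
    by (simp add: quot_mod_simps grade_free_mod[OF E])
  have hom: "\<And>x y. x \<in> fcar E \<Longrightarrow> y \<in> fcar E \<Longrightarrow> \<psi> (?c x \<oplus>\<^bsub>?Q\<^esub> ?c y) = \<psi> (?c x) \<oplus>\<^bsub>M\<^esub> \<psi> (?c y)"
    "\<And>r x. x \<in> fcar E \<Longrightarrow> \<psi> (r \<odot>\<^bsub>?Q\<^esub> ?c x) = r \<odot>\<^bsub>M\<^esub> \<psi> (?c x)"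
    "\<And>q. \<psi> ` grade ?Q q = grade M q" "bij_betw \<psi> (carrier ?Q) (carrier M)"
  proof -
    have gh: "graded_hom ?Q M \<psi>" using \<psi> by (simp add: graded_iso_def)
    have cx: "?c x \<in> carrier ?Q" if "x \<in> fcar E" for x using that unfolding carQ by (rule imageI)
    show "\<psi> (?c x \<oplus>\<^bsub>?Q\<^esub> ?c y) = \<psi> (?c x) \<oplus>\<^bsub>M\<^esub> \<psi> (?c y)" if "x \<in> fcar E" "y \<in> fcar E" for x y
      using gh cx[OF that(1)] cx[OF that(2)] unfolding graded_hom_def by blast
    show "\<psi> (r \<odot>\<^bsub>?Q\<^esub> ?c x) = r \<odot>\<^bsub>M\<^esub> \<psi> (?c x)" if "x \<in> fcar E" for r x
      using gh cx[OF that] unfolding graded_hom_def by blast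
    show "\<psi> ` grade ?Q q = grade M q" for q using \<psi> by (simp add: graded_iso_def)
    show "bij_betw \<psi> (carrier ?Q) (carrier M)" using \<psi> by (simp add: graded_iso_def)
  qed
  have add: "\<psi> (?c (x + y)) = \<psi> (?c x) \<oplus>\<^bsub>M\<^esub> \<psi> (?c y)" if "x \<in> fcar E" "y \<in> fcar E" for x y
    using hom(1)[OF that] coset_free_mod_add[OF N(1), of P E b x y] by (simp add: quot_mod_simps)
  have car: "\<psi> (?c x) \<in> carrier M" if "x \<in> fcar E" for x
    using hom(4) that carQ by (auto dest: bij_betw_apply)
  have c0: "\<psi> (?c 0) \<in> carrier M" by (rule car) simp
  have "\<psi> (?c (0 + 0)) = \<psi> (?c 0) \<oplus>\<^bsub>M\<^esub> \<psi> (?c 0)" by (rule add) simp_all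
  then have zero: "\<psi> (?c 0) = \<zero>\<^bsub>M\<^esub>"
    unfolding add_0_left by (rule M.add.l_cancel_one'[OF c0 c0, THEN iffD1])
  have ker: "\<psi> (?c x) = \<zero>\<^bsub>M\<^esub> \<longleftrightarrow> x \<in> N" if x: "x \<in> fcar E" for x
  proof -
    have "\<psi> (?c x) = \<psi> (?c 0) \<longleftrightarrow> ?c x = ?c 0"
      using bij_betw_imp_inj_on[OF hom(4)] x carQ by (intro inj_on_eq_iff[of \<psi> "carrier ?Q"]) auto
    then show ?thesis using coset_free_mod_eq_iff[OF N(1), of P E b x 0] zero by simp
  qed
  have sm: "\<psi> (?c (lmul r x)) = r \<odot>\<^bsub>M\<^esub> \<psi> (?c x)" if "x \<in> fcar E" for r x
    using hom(2)[OF that, of r] by (simp add: coset_free_mod_smult[OF N(1)])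
  have gr: "(\<lambda>x. \<psi> (?c x)) ` {x \<in> fcar E. homv b q x} = grade M q" for q
    using hom(3)[of q] unfolding gradeQ image_image .
  have im: "(\<lambda>x. \<psi> (?c x)) ` fcar E = carrier M"
    using bij_betw_imp_surj_on[OF hom(4)] unfolding carQ image_image .
  show ?thesis unfolding presentation_def using add sm gr im ker by blast
qed

text \<open>A class is sent to the value of \<open>\<pi>\<close> at any representative.\<close>

lemma presentation_iso:
  assumes M: "graded_left_module P M" and E: "finite E" and N: "closed_submodule N" "N \<subseteq> fcar E"
    and p: "presentation M E b N \<pi>"
  shows "\<exists>\<theta>. graded_iso (quot_mod (free_mod P E b) N) M \<theta>"
proof -
  let ?c = "\<lambda>x. N +>\<^bsub>free_mod P E b\<^esub> x"
  let ?Q = "quot_mod (free_mod P E b) N"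
  note D = presentationD[OF p] and eq = presentation_eq_iff[OF M p]
  have carQ: "carrier ?Q = ?c ` fcar E" by (auto simp: quot_mod_simps A_RCOSETS_def')
  have gradeQ: "grade ?Q q = ?c ` {x \<in> fcar E. homv b q x}" for q
    by (simp add: quot_mod_simps grade_free_mod[OF E])
  define \<theta> where "\<theta> = (\<lambda>C. \<pi> (SOME x. x \<in> C))"
  have \<theta>: "\<theta> (?c x) = \<pi> x" if x: "x \<in> fcar E" for x
  proof -
    have "x \<in> ?c x" using closed_submoduleD(1)[OF N(1)] by (force simp: coset_free_mod)
    then have "(SOME y. y \<in> ?c x) \<in> ?c x" by (rule someI[of "\<lambda>y. y \<in> ?c x"])
    then obtain n where n: "n \<in> N" "(SOME y. y \<in> ?c x) = n + x" by (auto simp: coset_free_mod)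
    then have "n + x \<in> fcar E" using N(2) x by auto
    then show ?thesis using eq[of "n + x" x] n x by (simp add: \<theta>_def)
  qed
  have inj: "inj_on \<theta> (carrier ?Q)"
  proof (rule inj_onI)
    fix C C' assume "C \<in> carrier ?Q" "C' \<in> carrier ?Q" "\<theta> C = \<theta> C'"
    then obtain x y where "C = ?c x" "C' = ?c y" "x \<in> fcar E" "y \<in> fcar E" unfolding carQ by blast
    then show "C = C'" using \<open>\<theta> C = \<theta> C'\<close> \<theta> eq coset_free_mod_eq_iff[OF N(1)] by metis
  qed
  have img: "\<theta> ` ?c ` S = \<pi> ` S" if "S \<subseteq> fcar E" for S
    unfolding image_image using \<theta> that by (intro image_cong) auto
  have "graded_hom ?Q M \<theta>"
    unfolding graded_hom_def
  proof (intro conjI ballI allI)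
    fix C assume "C \<in> carrier ?Q"
    then obtain x where C: "C = ?c x" "x \<in> fcar E" unfolding carQ by blast
    then show "\<theta> C \<in> carrier M" using \<theta> D(6) by simp
    show "\<theta> (r \<odot>\<^bsub>?Q\<^esub> C) = r \<odot>\<^bsub>M\<^esub> \<theta> C" for r
      using C \<theta> D(2) by (simp add: coset_free_mod_smult[OF N(1)])
    fix C' assume "C' \<in> carrier ?Q"
    then obtain y where C': "C' = ?c y" "y \<in> fcar E" unfolding carQ by blast
    then show "\<theta> (C \<oplus>\<^bsub>?Q\<^esub> C') = \<theta> C \<oplus>\<^bsub>M\<^esub> \<theta> C'"
      using C \<theta> D(1) coset_free_mod_add[OF N(1), of P E b x y] by (simp add: quot_mod_simps)
  next
    fix q C assume "C \<in> grade ?Q q"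
    then show "\<theta> C \<in> grade M q" using img[of "{x \<in> fcar E. homv b q x}"] D(3)[of q] unfolding gradeQ by blast
  qed
  moreover have "\<theta> ` grade ?Q q = grade M q" for q
    using img[of "{x \<in> fcar E. homv b q x}"] D(3)[of q] unfolding gradeQ by simp
  moreover have "bij_betw \<theta> (carrier ?Q) (carrier M)"
    unfolding bij_betw_def using inj img[of "fcar E"] D(4) carQ by simp
  ultimately show ?thesis unfolding graded_iso_def by blast
qed

lemma presentation_graded_hom:
  assumes "finite E" "presentation M E b N \<pi>"
  shows "graded_hom (free_mod P E b) M \<pi>"
  unfolding graded_hom_def
proof (intro conjI ballI allI)
  fix q x assume "x \<in> grade (free_mod P E b) q"
  then have "x \<in> {x \<in> fcar E. homv b q x}" by (simp add: grade_free_mod[OF assms(1)])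
  then show "\<pi> x \<in> grade M q" using presentationD(3)[OF assms(2), of q] by blast
qed (simp_all add: presentationD[OF assms(2)])

lemma presentation_submodule:
  assumes M: "graded_left_module P M" and p: "presentation M E b N \<pi>"
    and K: "closed_submodule K" "K \<subseteq> fcar E"
  shows "left_submodule M (\<pi> ` K)"
proof -
  interpret M: abelian_group M by (rule abelian_group_graded[OF M])
  note D = presentationD[OF p]
  have K': "x \<in> fcar E" if "x \<in> K" for x using that K(2) by blast
  have zero: "\<pi> 0 = \<zero>\<^bsub>M\<^esub>" by (rule presentation_zero[OF M p])
  have "subgroup (\<pi> ` K) (add_monoid M)"
  proof
    show "\<pi> ` K \<subseteq> carrier (add_monoid M)" using D(6) K' by auto
    show "\<one>\<^bsub>add_monoid M\<^esub> \<in> \<pi> ` K"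
      using zero closed_submoduleD(1)[OF K(1)] by (auto intro: image_eqI[of _ _ 0])
    fix u assume "u \<in> \<pi> ` K"
    then obtain x where x: "x \<in> K" "u = \<pi> x" by blast
    have nx: "- x \<in> K" using closed_submoduleD(4)[OF K(1) closed_submoduleD(1)[OF K(1)] x(1)] by simp
    have "\<pi> (- x) \<oplus>\<^bsub>M\<^esub> \<pi> x = \<zero>\<^bsub>M\<^esub>" using D(1)[OF K'[OF nx] K'[OF x(1)]] zero by simp
    then have "\<ominus>\<^bsub>M\<^esub> u = \<pi> (- x)"
      using D(6) K' nx x by (intro M.minus_equality) auto
    then show "inv\<^bsub>add_monoid M\<^esub> u \<in> \<pi> ` K" using nx by (simp add: a_inv_def)
    fix v assume "v \<in> \<pi> ` K"
    then obtain y where y: "y \<in> K" "v = \<pi> y" by blast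
    then show "u \<otimes>\<^bsub>add_monoid M\<^esub> v \<in> \<pi> ` K"
      using D(1)[of x y] x K' closed_submoduleD(2)[OF K(1) x(1) y(1)]
      by (auto intro: image_eqI[of _ _ "x + y"])
  qed
  moreover have "r \<odot>\<^bsub>M\<^esub> u \<in> \<pi> ` K" if "u \<in> \<pi> ` K" for r u
  proof -
    obtain x where "x \<in> K" "u = \<pi> x" using \<open>u \<in> \<pi> ` K\<close> by blast
    then show ?thesis
      using D(2)[of x r] K' closed_submoduleD(3)[OF K(1)] by (auto intro: image_eqI[of _ _ "lmul r x"])
  qed
  ultimately show ?thesis by (simp add: left_submodule_def additive_subgroup_def)
qed

text \<open>Generators other than \<open>\<pi> e\<^sub>i\<close> lie in the image of the vectors whose \<open>i\<close>-th entry has no constant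
  term, and \<open>\<pi> e\<^sub>i\<close> does not, since a relation would have the constant term \<open>1\<close> there.\<close>

lemma presentation_minimal:
  assumes M: "graded_left_module P M" and p: "presentation M E b N \<pi>" and E: "finite E"
    and N: "N \<subseteq> posv"
  shows "inj_on (\<lambda>i. \<pi> (single i 1)) E" "min_hom_gens M (carrier M) (basis_images E \<pi>)"
proof -
  note D = presentationD[OF p] and eq = presentation_eq_iff[OF M p]
  have e: "single i (1::'a) \<in> fcar E" if "i \<in> E" for i using that by (rule fcar_single)
  show "inj_on (\<lambda>i. \<pi> (single i 1)) E"
  proof (rule inj_onI, rule ccontr)
    fix i j assume *: "i \<in> E" "j \<in> E" "\<pi> (single i 1) = \<pi> (single j 1)" "i \<noteq> j"
    then have "single i 1 - single j (1::'a) \<in> N" using eq e by blast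
    then have "coef P ((single i 1 - single j (1::'a)) i) 0 = 0" using N by (auto simp: posv_def)
    then show False using *(4) by (simp add: minus_apply single_def coef_1)
  qed
  show "min_hom_gens M (carrier M) (basis_images E \<pi>)"
    unfolding min_hom_gens_def
  proof (intro conjI ballI allI impI)
    fix x assume "x \<in> basis_images E \<pi>"
    then obtain i where i: "i \<in> E" "x = \<pi> (single i 1)" by (auto simp: basis_images_def)
    have "homv b (b i) (single i 1)" by (simp add: homv_single supp_1)
    then have "x \<in> grade M (b i)" using D(3)[of "b i"] e[OF i(1)] i(2) by blast
    then show "homogeneous M x" unfolding homogeneous_def by blast
  next
    have sub: "basis_images E \<pi> \<subseteq> carrier M" using D(6) e by (auto simp: basis_images_def)
    have lc: "left_submodule M (carrier M)"
      using presentation_submodule[OF M p closed_submodule_fcar subset_refl] D(4) by simp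
    have "carrier M \<subseteq> H" if H: "left_submodule M H" "basis_images E \<pi> \<subseteq> H" for H
    proof -
      have Hs: "additive_subgroup H M" "\<And>r u. u \<in> H \<Longrightarrow> r \<odot>\<^bsub>M\<^esub> u \<in> H"
        using H(1) by (auto simp: left_submodule_def)
      have "\<pi> (\<Sum>i\<in>F. lmul (x i) (single i 1)) \<in> H" if "finite F" "F \<subseteq> E" for F x
        using that
      proof (induction F)
        case empty
        show ?case
          using additive_subgroup.zero_closed[OF Hs(1)] presentation_zero[OF M p] by simp
      next
        case (insert i F)
        have i: "lmul (x i) (single i 1) \<in> fcar E" using e insert by simp
        have F: "(\<Sum>i\<in>F. lmul (x i) (single i 1)) \<in> fcar E"
          using insert e by (intro closed_submodule_sum[OF closed_submodule_fcar]) auto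
        have "\<pi> (lmul (x i) (single i 1)) \<in> H"
          using D(2) e insert H(2) Hs(2) by (auto simp: basis_images_def)
        then show ?case
          using insert D(1)[OF i F] additive_subgroup.a_closed[OF Hs(1)] by simp
      qed
      note sums = this[OF E subset_refl]
      have "\<pi> x \<in> H" if "x \<in> fcar E" for x
      proof -
        have eq: "x = (\<Sum>i\<in>E. lmul (x i) (single i 1))" by (rule alin_expansion[OF alin_id E that])
        show ?thesis using sums[of x] by (simp only: eq[symmetric])
      qed
      then show ?thesis unfolding D(4)[symmetric] by blast
    qed
    then show "lspan M (basis_images E \<pi>) = carrier M"
      using sub lc by (intro hull_unique) auto
  next
    fix T assume T: "T \<subset> basis_images E \<pi>"
    then obtain i where i: "i \<in> E" "\<pi> (single i 1) \<notin> T" by (auto simp: basis_images_def)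
    let ?K = "{x \<in> fcar E. coef P (x i) 0 = 0}"
    have K: "closed_submodule ?K"
      by (auto simp: closed_submodule_def vec_apply lmul_apply coef_mult_0)
    have "T \<subseteq> \<pi> ` ?K"
    proof
      fix t assume t: "t \<in> T"
      then obtain j where j: "j \<in> E" "t = \<pi> (single j 1)" using T by (auto simp: basis_images_def)
      then have "j \<noteq> i" using i(2) t by auto
      then show "t \<in> \<pi> ` ?K" using j e by (auto simp: single_def)
    qed
    moreover have "left_submodule M (\<pi> ` ?K)" by (rule presentation_submodule[OF M p K]) auto
    ultimately have sub: "lspan M T \<subseteq> \<pi> ` ?K" by (rule hull_minimal)
    show "lspan M T \<noteq> carrier M"
    proof
      assume "lspan M T = carrier M"
      then have "\<pi> (single i 1) \<in> \<pi> ` ?K" using sub D(6)[OF e[OF i(1)]] by blast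
      then obtain x where x: "x \<in> fcar E" "coef P (x i) 0 = 0" "\<pi> (single i 1) = \<pi> x" by blast
      then have "single i 1 - x \<in> N" using eq e i(1) by blast
      then have "coef P ((single i 1 - x) i) 0 = 0" using N by (auto simp: posv_def)
      then show False using x(2) by (simp add: minus_apply coef_1)
    qed
  qed
qed


section \<open>Algorithm MinQuot\<close>

text \<open>The map \<open>\<pi>\<close> stays the same throughout: it presents \<open>M\<close> on fewer and fewer of the generators.\<close>

definition minquot_inv ::
    "('a, 'm) graded_module \<Rightarrow> (nat \<Rightarrow> nat) \<Rightarrow> ('a vec \<Rightarrow> 'm) \<Rightarrow> nat set \<Rightarrow> 'a vec list \<Rightarrow>
     nat set \<times> 'a vec list \<Rightarrow> bool" where
  "minquot_inv M b \<pi> E U = (\<lambda>(E', V). E' \<subseteq> E \<and> set V \<subseteq> fcar E' \<and>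
     set V \<subseteq> row_space U \<and> (\<forall>v\<in>set V. v \<noteq> 0 \<and> (\<exists>q. homv b q v)) \<and>
     presentation M E' b (row_space V) \<pi>)"

text \<open>Eliminating the generator \<open>e\<^sub>i\<close> by means of \<open>v\<close> is the linear map
  \<open>x \<mapsto> x - (x\<^sub>i / c) v\<close>: it changes \<open>x\<close> modulo the relations only, preserves degrees, and its image is
  supported away from \<open>i\<close>.\<close>

lemma minquot_inv_step:
  assumes M: "graded_left_module P M" and E: "finite E"
    and inv: "minquot_inv M b \<pi> E U (E1, V)" and step: "minquot_step P (E1, V) (E2, V')"
  shows "minquot_inv M b \<pi> E U (E2, V')" "length V' < length V"
proof -
  from inv have E1: "E1 \<subseteq> E" and VE: "set V \<subseteq> fcar E1" and VU: "set V \<subseteq> row_space U"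
    and hom: "\<And>v. v \<in> set V \<Longrightarrow> v \<noteq> 0 \<and> (\<exists>q. homv b q v)"
    and p: "presentation M E1 b (row_space V) \<pi>"
    by (auto simp: minquot_inv_def)
  from step obtain j c where j: "j < length V" "\<exists>i. (V ! j) i \<in> units_K P" and c: "c \<noteq> 0"
    "(V ! j) (LEAST i. (V ! j) i \<in> units_K P) = smulK P c 1"
    "E2 = E1 - {LEAST i. (V ! j) i \<in> units_K P}"
    "V' = filter (\<lambda>x. x \<noteq> 0) (map (\<lambda>x. x - lmul (smulK P (1 / c) (x (LEAST i. (V ! j) i \<in> units_K P))) (V ! j))
      (take j V @ drop (Suc j) V))"
    unfolding minquot_step_def Let_def by auto
  define v where "v = V ! j"
  define i where "i = (LEAST i. v i \<in> units_K P)"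
  define red where "red = (\<lambda>x. x - lmul (smulK P (1 / c) (x i)) v)"
  have vi: "v i = smulK P c 1" and E2: "E2 = E1 - {i}"
    and V': "V' = filter (\<lambda>x. x \<noteq> 0) (map red (take j V @ drop (Suc j) V))"
    using c by (simp_all add: v_def i_def red_def)
  show "length V' < length V"
    unfolding V' using j(1) by (intro le_less_trans[OF length_filter_le]) simp
  have vV: "v \<in> set V" using j(1) by (simp add: v_def)
  have vE: "v \<in> fcar E1" using vV VE by blast
  have v0: "coef P (v i) 0 = c" unfolding vi by (simp add: coef_1)
  have i: "i \<in> E1" using v0 c(1) fcarD[OF vE, of i] by (cases "i \<in> E1") auto
  have homv_v: "homv b (b i) v"
  proof -
    obtain q where q: "homv b q v" using hom[OF vV] by blast
    have "(0, i) \<in> vsupp v" using v0 c(1) by (simp add: vsupp_def)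
    then show ?thesis using homvD[OF q] q by force
  qed
  have red_i: "red x i = 0" for x
    using c(1) by (simp add: red_def minus_apply lmul_apply vi mult_smulK_right)
  have red_lin: "alin red"
    by (auto simp: alin_def red_def lmul_simps vec_apply lmul_apply
        mult_smulK_right algebra_simps)
  have redE: "red x \<in> fcar E2" if "x \<in> fcar E1" for x
  proof -
    have "red x \<in> fcar E1" using that vE by (simp add: red_def)
    then show ?thesis using red_i[of x] by (auto simp: fcar_def E2)
  qed
  have red_hom: "homv b q (red x)" if x: "homv b q x" for q x
    unfolding red_def
  proof (rule homv_diff[OF x], rule homv_lmul[OF _ homv_v])
    fix \<alpha> assume "\<alpha> \<in> supp (smulK P (1 / c) (x i))"
    then have "(\<alpha>, i) \<in> vsupp x" using supp_smulK_subset by (auto simp: vsupp_iff)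
    then show "deg P \<alpha> + b i = q" using homvD[OF x] by blast
  qed
  let ?N = "row_space V" let ?N' = "row_space V'"
  note cN = closed_submodule_row_space[of V] and cN' = closed_submodule_row_space[of V']
  have diffN: "x - red x \<in> ?N" for x
    using closed_submoduleD(3)[OF cN row_space_member[OF vV]] by (simp add: red_def)
  have VN: "w \<in> ?N" if "w \<in> set V" for w by (rule row_space_member[OF that])
  have rest: "set (take j V @ drop (Suc j) V) \<subseteq> set V"
    using set_take_subset[of j V] set_drop_subset[of "Suc j" V] by auto
  have V'_elem: "\<exists>w\<in>set V. x = red w \<and> x \<noteq> 0" if "x \<in> set V'" for x
    using that rest unfolding V' by auto
  have redN: "red w \<in> ?N" if "w \<in> ?N" for w
    using closed_submoduleD(4)[OF cN that diffN[of w]] by simp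
  have N'N: "?N' \<subseteq> ?N"
    by (rule row_space_subset) (use V'_elem redN VN in blast)
  have red_v: "red v = 0"
    using c(1) by (simp add: red_def vi lmul_simps)
  have redN': "red x \<in> ?N'" if "x \<in> ?N" for x
  proof -
    obtain h where "x = row_mult h V" using \<open>x \<in> ?N\<close> by blast
    then have "red x = row_mult h (map red V)" using alin_row_mult_eq[OF red_lin] by simp
    moreover have "set (map red V) \<subseteq> ?N'"
    proof
      fix y assume "y \<in> set (map red V)"
      then obtain w where w: "w \<in> set V" "y = red w" by auto
      have "set V = insert v (set (take j V @ drop (Suc j) V))"
        using arg_cong[OF id_take_nth_drop[OF j(1)], of set] by (simp add: v_def)
      then have "w = v \<or> w \<in> set (take j V @ drop (Suc j) V)" using w(1) by blast
      then show "y \<in> ?N'"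
      proof
        assume "w = v"
        then show ?thesis using w(2) red_v closed_submoduleD(1)[OF cN'] by simp
      next
        assume "w \<in> set (take j V @ drop (Suc j) V)"
        then have "y = 0 \<or> y \<in> set V'" using w(2) unfolding V' by auto
        then show ?thesis using closed_submoduleD(1)[OF cN'] row_space_member[of y V'] by blast
      qed
    qed
    ultimately show ?thesis using closed_submodule_row_mult[OF cN'] by simp
  qed
  have sub: "fcar E2 \<subseteq> (fcar E1 :: 'a vec set)" unfolding E2 by (rule fcar_mono) blast
  have kernel: "x \<in> ?N \<longleftrightarrow> x \<in> ?N'" if x: "x \<in> fcar E2" for x
  proof
    assume "x \<in> ?N"
    moreover have "red x = x" using fcarD[OF x, of i] by (simp add: red_def E2 lmul_simps)
    ultimately show "x \<in> ?N'" using redN'[of x] by simp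
  qed (use N'N in blast)
  note D = presentationD[OF p]
  have \<pi>red: "\<pi> (red x) = \<pi> x" if "x \<in> fcar E1" for x
    using presentation_eq_iff[OF M p that, of "red x"] diffN redE[OF that] sub by auto
  have p': "presentation M E2 b ?N' \<pi>"
    unfolding presentation_def
  proof (intro conjI ballI allI)
    show "\<pi> (x + y) = \<pi> x \<oplus>\<^bsub>M\<^esub> \<pi> y" if "x \<in> fcar E2" "y \<in> fcar E2" for x y
      using D(1) that sub by blast
    show "\<pi> (lmul r x) = r \<odot>\<^bsub>M\<^esub> \<pi> x" if "x \<in> fcar E2" for r x
      using D(2) that sub by blast
    show "\<pi> x = \<zero>\<^bsub>M\<^esub> \<longleftrightarrow> x \<in> ?N'" if "x \<in> fcar E2" for x
      using D(5) kernel[OF that] that sub by blast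
    show "\<pi> ` fcar E2 = carrier M"
    proof
      show "\<pi> ` fcar E2 \<subseteq> carrier M" using D(4) sub by blast
      show "carrier M \<subseteq> \<pi> ` fcar E2"
        unfolding D(4)[symmetric] using \<pi>red redE by (metis image_eqI image_subsetI)
    qed
    show "\<pi> ` {x \<in> fcar E2. homv b q x} = grade M q" for q
    proof
      show "\<pi> ` {x \<in> fcar E2. homv b q x} \<subseteq> grade M q" unfolding D(3)[of q, symmetric] using sub by blast
      show "grade M q \<subseteq> \<pi> ` {x \<in> fcar E2. homv b q x}"
      proof
        fix u assume "u \<in> grade M q"
        then obtain x where "x \<in> fcar E1" "homv b q x" "u = \<pi> x" unfolding D(3)[of q, symmetric] by blast
        then show "u \<in> \<pi> ` {x \<in> fcar E2. homv b q x}"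
          using \<pi>red[of x] redE[of x] red_hom by (intro image_eqI[of _ _ "red x"]) auto
      qed
    qed
  qed
  have V'E: "set V' \<subseteq> fcar E2" using V'_elem VE redE by blast
  have V'U: "set V' \<subseteq> row_space U"
  proof
    fix x assume "x \<in> set V'"
    then obtain w where "w \<in> set V" "x = red w" using V'_elem by blast
    then have "x \<in> ?N" using redN VN by blast
    then show "x \<in> row_space U" by (rule subsetD[OF row_space_subset[OF VU]])
  qed
  have V'h: "\<forall>v\<in>set V'. v \<noteq> 0 \<and> (\<exists>q. homv b q v)"
  proof
    fix x assume "x \<in> set V'"
    then obtain w where w: "w \<in> set V" "x = red w" "x \<noteq> 0" using V'_elem by blast
    then obtain q where "homv b q w" using hom by blast
    then show "x \<noteq> 0 \<and> (\<exists>q. homv b q x)" using w(2,3) red_hom by blast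
  qed
  show "minquot_inv M b \<pi> E U (E2, V')"
    unfolding minquot_inv_def prod.case using E1 E2 V'E V'U V'h p' by blast
qed

lemma minquot_inv_reachable:
  assumes "graded_left_module P M" "finite E" "minquot_inv M b \<pi> E U s"
    "(minquot_step P)\<^sup>*\<^sup>* s t"
  shows "minquot_inv M b \<pi> E U t"
  using assms(4)
proof (induction rule: rtranclp_induct)
  case (step t u)
  then show ?case
    using minquot_inv_step(1)[OF assms(1,2), of b \<pi> U "fst t" "snd t" "fst u" "snd u"] by simp
qed (fact assms(3))

lemma minquot_halts: "halts (minquot_step P) (minquot_final P) s"
  unfolding halts_def
proof (intro conjI allI impI)
  have dec: "length V' < length V" if "minquot_step P (E1, V) (E2, V')" for E1 E2 V V'
  proof -
    from that obtain j f where j: "j < length V"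
      and V': "V' = filter (\<lambda>x. x \<noteq> 0) (map f (take j V @ drop (Suc j) V))"
      unfolding minquot_step_def Let_def by auto
    have "length V' \<le> length (map f (take j V @ drop (Suc j) V))"
      unfolding V' by (rule length_filter_le)
    then show ?thesis using j by simp
  qed
  show "\<not> (\<exists>f. f 0 = s \<and> (\<forall>k. minquot_step P (f k) (f (Suc k))))"
  proof
    assume "\<exists>f. f 0 = s \<and> (\<forall>k. minquot_step P (f k) (f (Suc k)))"
    then obtain f where f: "\<And>k. minquot_step P (f k) (f (Suc k))" by blast
    have "length (snd (f (Suc k))) < length (snd (f k))" for k
      using dec[of "fst (f k)" "snd (f k)" "fst (f (Suc k))" "snd (f (Suc k))"] f[of k] by simp
    then have "\<forall>k. (length (snd (f (Suc k))), length (snd (f k))) \<in> less_than" by simp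
    then have "\<exists>g. \<forall>k. (g (Suc k), g k) \<in> less_than"
      by (intro exI[of _ "\<lambda>k. length (snd (f k))"])
    moreover have "wf less_than" by (rule wf_less_than)
    ultimately show False unfolding wf_iff_no_infinite_down_chain by blast
  qed
  fix t :: "nat set \<times> 'a vec list"
  obtain E1 V where t: "t = (E1, V)" by (cases t)
  show "minquot_final P t \<or> (\<exists>u. minquot_step P t u)"
  proof (cases "minquot_final P t")
    case False
    then obtain v i0 where "v \<in> set V" "v i0 \<in> units_K P" by (auto simp: minquot_final_def t)
    then obtain j where j: "j < length V" "(V ! j) i0 \<in> units_K P" by (metis in_set_conv_nth)
    let ?i = "LEAST i. (V ! j) i \<in> units_K P"
    have "(V ! j) ?i \<in> units_K P" using LeastI[of "\<lambda>i. (V ! j) i \<in> units_K P" i0] j(2) by simp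
    then obtain c where "(V ! j) ?i = smulK P c 1" "c \<noteq> 0" by (auto simp: units_K_def)
    then have "\<exists>u. minquot_step P (E1, V) u"
      unfolding minquot_step_def Let_def using j by auto
    then show ?thesis by (simp add: t)
  qed simp
qed

text \<open>A homogeneous vector with a constant term in the \<open>i\<close>-th entry has a constant there, that is, a
  unit; when MinQuot stops there are none.\<close>

lemma minquot_final_posv:
  assumes "minquot_inv M b \<pi> E U (E', V)" "minquot_final P (E', V)"
  shows "row_space V \<subseteq> posv"
proof -
  have "v \<in> posv" if v: "v \<in> set V" for v
  proof (rule ccontr)
    assume "v \<notin> posv"
    then obtain i where i: "coef P (v i) 0 \<noteq> 0" by (auto simp: posv_def)
    obtain q where q: "homv b q v" using assms(1) v by (auto simp: minquot_inv_def)
    have "(0, i) \<in> vsupp v" using i by (simp add: vsupp_def)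
    then have "q = b i" using homvD[OF q] by force
    then have "supp (v i) \<subseteq> {0}"
      using homvD[OF q, of _ i] deg_eq_0 suppD(1) by (force simp: vsupp_iff)
    then have "v i \<in> units_K P" using i by (auto simp: in_units_K_iff supp_def)
    then show False using assms(2) v by (auto simp: minquot_final_def)
  qed
  then show ?thesis using closed_submodule_row_mult[OF closed_submodule_posv] by blast
qed

end

section \<open>The rounds of the construction\<close>

lemma row_space_set_eq:
  "set V = set W \<Longrightarrow> row_space V = row_space W"
  by (intro equalityI row_space_subset) (metis row_space_member subsetI)+

lemma row_space_filter_nonzero:
  "row_space (filter (\<lambda>x. x \<noteq> 0) V) = row_space V"
proof (intro equalityI row_space_subset subsetI)
  fix x assume "x \<in> set (filter (\<lambda>x. x \<noteq> 0) V)"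
  then show "x \<in> row_space V" using row_space_member[of x V] by simp
next
  fix x assume "x \<in> set V"
  then show "x \<in> row_space (filter (\<lambda>x. x \<noteq> 0) V)"
    using closed_submoduleD(1)[OF closed_submodule_row_space] row_space_member[of x "filter (\<lambda>x. x \<noteq> 0) V"]
    by (cases "x = 0") simp_all
qed

context weighted_solvable
begin

definition stage_ok :: "'a stage \<Rightarrow> bool" where
  "stage_ok X \<longleftrightarrow> finite (idx X) \<and>
     (\<forall>x\<in>set (gens X). x \<in> fcar (idx X) \<and> x \<noteq> 0 \<and> (\<exists>q. homv (bdeg X) q x))"

lemma stageN_eq: "stage_ok X \<Longrightarrow> stageN P X = row_space (gens X)"
  unfolding stageN_def stageL_def by (rule lspan_free_mod) (auto simp: stage_ok_def)

lemma minsub_problem_stage: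
  assumes "stage_ok X" "left_monomial_ordering P (idx X) ord" "minsub_input P X inp"
  shows "minsub_problem P (idx X) ord (bdeg X) inp"
proof unfold_locales
  have "set inp = set (gens X)" using assms(3) by (metis minsub_input_def mset_eq_setD)
  then show "x \<in> fcar (idx X) \<and> x \<noteq> 0 \<and> (\<exists>q. homv (bdeg X) q x)" if "x \<in> set inp" for x
    using assms(1) that by (simp add: stage_ok_def)
qed (use assms in \<open>simp_all add: stage_ok_def\<close>)

lemma minsub_input_exists: "\<exists>inp. minsub_input P X inp"
  by (rule exI[of _ "sort_key (hdeg (stageL P X)) (gens X)"]) (simp add: minsub_input_def)

context
  fixes X :: "'a stage" and ord inp out
  assumes ok: "stage_ok X" and ord: "left_monomial_ordering P (idx X) ord"
    and inp: "minsub_input P X inp" and out: "minsub_output P X ord inp out"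
begin

interpretation ms: minsub_problem P "idx X" ord "bdeg X" inp
  by (rule minsub_problem_stage[OF ok ord inp])

abbreviation (input) "deg_umin \<equiv> (\<lambda>k. hdeg (stageL P X) (umin out ! k))"

lemma output_reachable: "(minsub_step P (idx X) (bdeg X) ord inp)\<^sup>*\<^sup>* (minsub_init inp) out"
  and output_final: "minsub_final out"
  using out by (simp_all add: minsub_output_def)

lemmas ms_out = ms.minsub_output_props[OF output_reachable output_final]

lemma stageN_inp: "stageN P X = row_space inp"
  unfolding stageN_eq[OF ok] using inp by (intro row_space_set_eq) (metis minsub_input_def mset_eq_setD)

lemma stageN_umin: "stageN P X = row_space (umin out)"
  using ms_out(4) stageN_inp by simp

lemma umin_fcar: "set (umin out) \<subseteq> fcar (idx X)"
  using ms.umin_props(1)[OF output_reachable output_final] by (auto simp: in_set_conv_nth)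

lemma round_minimal: "min_hom_gens (stageL P X) (stageN P X) (set (umin out))"
  unfolding min_hom_gens_def stageN_inp stageL_def
proof (intro conjI ballI allI impI)
  fix x assume "x \<in> set (umin out)"
  then obtain k where "k < length (umin out)" "x = umin out ! k" by (metis in_set_conv_nth)
  then show "homogeneous (free_mod P (idx X) (bdeg X)) x"
    using ms.umin_props[OF output_reachable output_final, of k] by (auto simp: homogeneous_free_mod[OF ms.finite_E])
next
  show "lspan (free_mod P (idx X) (bdeg X)) (set (umin out)) = row_space inp"
    unfolding lspan_free_mod[OF umin_fcar] using ms_out(4) .
qed (rule ms.umin_minimal[OF output_reachable output_final])

lemma round_graded_hom:
  "graded_hom (free_mod P {..<length (umin out)} deg_umin) (stageL P X) (\<lambda>h. row_mult h (umin out))"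
  unfolding graded_hom_def stageL_def
  using ms.umin_props[OF output_reachable output_final]
  by (auto simp: fcar_row_mult[OF umin_fcar] row_mult_add row_mult_lmul
      grade_free_mod[OF finite_lessThan] grade_free_mod[OF ms.finite_E] intro: homv_row_mult)

lemma round_image: "(\<lambda>h. row_mult h (umin out)) ` fcar {..<length (umin out)} = stageN P X"
proof
  show "stageN P X \<subseteq> (\<lambda>h. row_mult h (umin out)) ` fcar {..<length (umin out)}"
    unfolding stageN_umin using trunc_fcar row_mult_trunc by (metis image_eqI image_subsetI)
qed (use stageN_umin in blast)

lemma round_kernel: "{h \<in> fcar {..<length (umin out)}. row_mult h (umin out) = 0} = syz (umin out)"
  by (auto simp: syz_iff)

lemma next_stage_ok:
  assumes W: "division_matrix P ord out W"
  shows "stage_ok (next_stage P X out W)" "stageN P (next_stage P X out W) = syz (umin out)"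
proof -
  show ok': "stage_ok (next_stage P X out W)"
    using ms.syzygy_rows_props[OF output_reachable output_final W]
    by (auto simp: stage_ok_def next_stage_def syz_iff stageL_def)
  have "stageN P (next_stage P X out W) = row_space (syzygy_rows out W)"
    unfolding stageN_eq[OF ok'] by (simp add: next_stage_def row_space_filter_nonzero)
  then show "stageN P (next_stage P X out W) = syz (umin out)"
    using ms.syzygy_rows_span[OF output_reachable output_final W] by simp
qed

lemmas round_distinct = ms.distinct_umin[OF output_reachable output_final]
lemmas round_posv = ms.syz_umin_posv[OF output_reachable output_final]
lemmas round_division_matrix = ms.division_matrix_exists[OF output_reachable output_final]

lemma round_output:
  "let L = stageL P X;
       G = gb out; s\<^sub>1 = length (umin out);
       AG = free_mod P {..<length G} (\<lambda>k. hdeg L (G ! k));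
       b\<^sub>1 = (\<lambda>k. hdeg L (umin out ! k));
       L\<^sub>1 = free_mod P {..<s\<^sub>1} b\<^sub>1;
       N\<^sub>1 = syz (umin out);
       \<phi>\<^sub>1 = (\<lambda>h. row_mult h (umin out))
   in set (umin out) \<subseteq> set inp \<and> distinct (umin out) \<and>
      min_hom_gens L (stageN P X) (set (umin out)) \<and>
      left_groebner_basis P ord (stageN P X) (set G) \<and>
      set (syzs out) \<subseteq> syz G \<and> lspan AG (set (syzs out)) = syz G \<and>
      length (vrows out) = length G \<and>
      (\<forall>k<length G. vrows out ! k \<in> carrier L\<^sub>1 \<and>
         G ! k = row_mult (vrows out ! k) (umin out)) \<and>
      (\<forall>Wm. division_matrix P ord out Wm \<longrightarrow>
         (\<forall>k<s\<^sub>1. Wm ! k \<in> carrier AG \<and> umin out ! k = row_mult (Wm ! k) G) \<and>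
         (\<forall>h\<in>set (syzygy_rows out Wm). homogeneous L\<^sub>1 h) \<and>
         lspan L\<^sub>1 (set (syzygy_rows out Wm)) = N\<^sub>1 \<and>
         stageL P (next_stage P X out Wm) = L\<^sub>1 \<and>
         stageN P (next_stage P X out Wm) = N\<^sub>1) \<and>
      graded_hom L\<^sub>1 L \<phi>\<^sub>1 \<and> (\<forall>k<s\<^sub>1. \<phi>\<^sub>1 (single k 1) = umin out ! k) \<and>
      {h \<in> carrier L\<^sub>1. \<phi>\<^sub>1 h = 0} = N\<^sub>1 \<and>
      \<phi>\<^sub>1 ` carrier L\<^sub>1 = stageN P X"
proof -
  let ?G = "gb out" let ?L = "stageL P X"
  have syzs: "set (syzs out) \<subseteq> syz ?G"
    using ms_out(10) row_space_member[of _ "syzs out"] by blast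
  then have syzs_fcar: "set (syzs out) \<subseteq> fcar {..<length ?G}" by (auto simp: syz_iff)
  have R: "length (vrows out) = length ?G"
    "\<And>k. k < length ?G \<Longrightarrow> vrows out ! k \<in> fcar {..<length (umin out)} \<and> ?G ! k = row_mult (vrows out ! k) (umin out)"
    using ms_out(2) by (auto simp: ms.rows_ok_def)
  have gb: "left_groebner_basis P ord (stageN P X) (set ?G)"
    unfolding left_groebner_basis_def stageN_inp using ms_out(8,9) by blast
  have lAG: "lspan (free_mod P {..<length ?G} dv) (set (syzs out)) = syz ?G" for dv
    unfolding lspan_free_mod[OF syzs_fcar] by (rule ms_out(10))
  have WM: "Wm ! k \<in> fcar {..<length ?G} \<and> umin out ! k = row_mult (Wm ! k) ?G"
    if "division_matrix P ord out Wm" "k < length (umin out)" for Wm k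
    using ms.division_matrix_props[OF output_reachable output_final that] by simp
  have rows: "homogeneous (free_mod P {..<length (umin out)} deg_umin) h"
    if "division_matrix P ord out Wm" "h \<in> set (syzygy_rows out Wm)" for Wm h
    using ms.syzygy_rows_props[OF output_reachable output_final that]
    by (auto simp: homogeneous_free_mod[OF finite_lessThan] syz_iff stageL_def)
  have lsp: "lspan (free_mod P {..<length (umin out)} deg_umin) (set (syzygy_rows out Wm)) = syz (umin out)"
    if W: "division_matrix P ord out Wm" for Wm
  proof -
    have sub: "set (syzygy_rows out Wm) \<subseteq> fcar {..<length (umin out)}"
      using ms.syzygy_rows_props(1)[OF output_reachable output_final W] by (auto simp: syz_iff)
    show ?thesis
      unfolding lspan_free_mod[OF sub] by (rule ms.syzygy_rows_span[OF output_reachable output_final W])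
  qed
  have nL: "stageL P (next_stage P X out Wm) = free_mod P {..<length (umin out)} deg_umin" for Wm
    by (simp add: stageL_def next_stage_def)
  have e: "row_mult (single k 1) (umin out) = umin out ! k" if "k < length (umin out)" for k
    using that by (simp add: row_mult_single lmul_simps)
  show ?thesis
    unfolding Let_def carrier_free_mod
    using ms_out(3) round_distinct round_minimal gb syzs lAG R WM rows lsp nL next_stage_ok(2)
      round_graded_hom e round_kernel round_image
    by (intro conjI allI impI ballI) blast+
qed

end

lemma round_halts:
  assumes "stage_ok X" "left_monomial_ordering P (idx X) ord" "minsub_input P X inp"
  shows "halts (minsub_stage_step P X ord inp) minsub_final (minsub_init inp)"
    "(minsub_stage_step P X ord inp)\<^sup>*\<^sup>* (minsub_init inp) out \<Longrightarrow> x \<in> carrier (stageL P X) \<Longrightarrow>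
      halts (div_step P ord (gb out)) div_final (x, 0, 0)"
proof -
  interpret ms: minsub_problem P "idx X" ord "bdeg X" inp
    by (rule minsub_problem_stage[OF assms])
  show "halts (minsub_stage_step P X ord inp) minsub_final (minsub_init inp)"
    by (rule ms.minsub_halts)
  show "(minsub_stage_step P X ord inp)\<^sup>*\<^sup>* (minsub_init inp) out \<Longrightarrow> x \<in> carrier (stageL P X) \<Longrightarrow>
      halts (div_step P ord (gb out)) div_final (x, 0, 0)"
    using ms.minsub_division_halts by (simp add: stageL_def)
qed


section \<open>Runs of the procedures\<close>

context
  fixes X0 :: "'a stage"
  assumes X0: "stage_ok X0"
begin

lemma run_stages:
  assumes run: "procedures_run P X0 d X r Us st W"
  shows "i \<le> d \<Longrightarrow> stage_ok (X i)"
proof (induction i)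
  case 0
  then show ?case using run X0 by (simp add: procedures_run_def)
next
  case (Suc i)
  then have "i < d" "stage_ok (X i)" by simp_all
  then show ?case
    using run next_stage_ok(1) unfolding procedures_run_def by metis
qed

lemma run_round:
  assumes run: "procedures_run P X0 d X r Us st W" and i: "i < d"
  shows "stage_ok (X i)" "left_monomial_ordering P (idx (X i)) (r i)" "minsub_input P (X i) (Us i)"
    "minsub_output P (X i) (r i) (Us i) (st i)" "division_matrix P (r i) (st i) (W i)"
    "X (Suc i) = next_stage P (X i) (st i) (W i)" "stageN P (X i) \<noteq> {0}"
  using run i run_stages[OF run, of i] by (simp_all add: procedures_run_def)

lemma run_syz:
  assumes run: "procedures_run P X0 d X r Us st W" and i: "i < d"
  shows "stageN P (X i) = row_space (umin (st i))"
    "stageN P (X (Suc i)) = syz (umin (st i))" "syz (umin (st i)) \<subseteq> posv"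
proof -
  note R = run_round[OF run i]
  show "stageN P (X i) = row_space (umin (st i))" by (rule stageN_umin[OF R(1-4)])
  show "stageN P (X (Suc i)) = syz (umin (st i))"
    unfolding R(6) by (rule next_stage_ok(2)[OF R(1-5)])
  show "syz (umin (st i)) \<subseteq> posv" by (rule round_posv[OF R(1-4)])
qed

text \<open>A run of \<open>n + 1\<close> rounds yields a minimal chain in which the module reached after \<open>n\<close> rounds is not
  \<open>0\<close>.\<close>

lemma run_length:
  assumes run: "procedures_run P X0 d X r Us st W" and pos: "stageN P X0 \<subseteq> posv"
  shows "d \<le> nvars P"
proof (rule ccontr)
  assume "\<not> d \<le> nvars P"
  then have d: "nvars P < d" by simp
  have X00: "X 0 = X0" using run by (simp add: procedures_run_def)
  have "stageN P (X (nvars P)) = {0}"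
  proof (rule minimal_chain_length[where Ns = "\<lambda>i. stageN P (X i)" and E = "idx X0" and Fs = "\<lambda>i. umin (st i)"])
    show "closed_submodule (stageN P (X 0))"
      unfolding X00 stageN_eq[OF X0] by (rule closed_submodule_row_space)
    show "stageN P (X 0) \<subseteq> fcar (idx X0)"
      unfolding X00 stageN_eq[OF X0] using X0 by (auto simp: stage_ok_def intro!: fcar_row_mult)
    show "finite (idx X0)" using X0 by (simp add: stage_ok_def)
    show "stageN P (X i) = row_space (umin (st i))" if "i \<le> nvars P" for i
      using run_syz(1)[OF run, of i] that d by simp
    show "stageN P (X (Suc i)) = syz (umin (st i))" if "i < nvars P" for i
      using run_syz(2)[OF run, of i] that d by simp
    show "stageN P (X (nvars P)) \<subseteq> posv"
    proof (cases "nvars P")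
      case 0
      then show ?thesis using pos X00 by simp
    next
      case (Suc m)
      then show ?thesis using run_syz(2,3)[OF run, of m] d by simp
    qed
    show "syz (umin (st (nvars P))) \<subseteq> posv" by (rule run_syz(3)[OF run d])
  qed
  then show False using run_round(7)[OF run d] by simp
qed

lemma run_extends:
  assumes run: "procedures_run P X0 d X r Us st W" and nz: "stageN P (X d) \<noteq> {0}"
  shows "\<exists>X r Us st W. procedures_run P X0 (Suc d) X r Us st W"
proof -
  have ok: "stage_ok (X d)" by (rule run_stages[OF run]) simp
  obtain ord where ord: "left_monomial_ordering P (idx (X d)) ord"
    using left_monomial_ordering_exists by blast
  obtain inp where inp: "minsub_input P (X d) inp" using minsub_input_exists by blast
  obtain out where out: "minsub_output P (X d) ord inp out"
    using halts_reaches_final[OF round_halts(1)[OF ok ord inp]] unfolding minsub_output_def by blast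
  obtain Wm where W: "division_matrix P ord out Wm"
    using round_division_matrix[OF ok ord inp out] by blast
  have "procedures_run P X0 (Suc d) (X(Suc d := next_stage P (X d) out Wm)) (r(d := ord))
      (Us(d := inp)) (st(d := out)) (W(d := Wm))"
    using run nz ord inp out W unfolding procedures_run_def by (auto simp: less_Suc_eq)
  then show ?thesis by blast
qed

text \<open>A run that has not reached \<open>0\<close> can be continued, but not beyond \<open>n\<close> rounds.\<close>

lemma complete_run_exists:
  assumes pos: "stageN P X0 \<subseteq> posv"
  shows "\<exists>d X r Us st W. procedures_run P X0 d X r Us st W \<and> stageN P (X d) = {0}"
proof (rule ccontr)
  assume no: "\<not> ?thesis"
  have "\<exists>X r Us st W. procedures_run P X0 d X r Us st W" for d
  proof (induction d)
    case 0
    have "procedures_run P X0 0 (\<lambda>_. X0) r Us st W" for r Us st W by (simp add: procedures_run_def)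
    then show ?case by blast
  next
    case (Suc d)
    then show ?case using no run_extends by blast
  qed
  then obtain X r Us st W where "procedures_run P X0 (Suc (nvars P)) X r Us st W" by blast
  then show False using run_length[OF _ pos] by force
qed

text \<open>The kernels are the modules reached: for \<open>\<pi>\<close> by assumption, for the later maps because each stage
  presents the syzygies of the generators before.\<close>

lemma run_resolution:
  assumes M: "graded_left_module P M" and p: "presentation M (idx X0) (bdeg X0) (stageN P X0) \<pi>"
    and pos: "stageN P X0 \<subseteq> posv"
    and run: "procedures_run P X0 d X r Us st W" and zero: "stageN P (X d) = {0}"
  shows "min_graded_free_resolution P M d (\<lambda>i. idx (X i)) (\<lambda>i. bdeg (X i)) \<pi> (stage_map st)"
proof -
  have X00: "X 0 = X0" using run by (simp add: procedures_run_def)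
  have finE: "finite (idx X0)" using X0 by (simp add: stage_ok_def)
  define Ker where "Ker = (\<lambda>i. if i = 0 then {x \<in> fcar (idx (X 0)). \<pi> x = \<zero>\<^bsub>M\<^esub>}
                    else {x \<in> fcar (idx (X i)). stage_map st i x = 0})"
  have next_stage: "idx (X (Suc i)) = {..<length (umin (st i))}"
      "bdeg (X (Suc i)) = (\<lambda>k. hdeg (stageL P (X i)) (umin (st i) ! k))" if "i < d" for i
    unfolding run_round(6)[OF run that] by (simp_all add: next_stage_def)
  have Ker: "Ker i = stageN P (X i)" if "i \<le> d" for i
  proof (cases i)
    case 0
    have "stageN P X0 \<subseteq> fcar (idx X0)"
      unfolding stageN_eq[OF X0] using X0 by (auto simp: stage_ok_def intro!: fcar_row_mult)
    then show ?thesis using presentationD(5)[OF p] by (auto simp: Ker_def 0 X00)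
  next
    case (Suc j)
    then have j: "j < d" using that by simp
    show ?thesis
      using round_kernel[OF run_round(1-4)[OF run j]] run_syz(2)[OF run j]
      by (simp add: Ker_def Suc next_stage(1)[OF j] stage_map_def)
  qed
  have "graded_hom (free_mod P (idx (X i)) (bdeg (X i))) (free_mod P (idx (X (i - 1))) (bdeg (X (i - 1)))) (stage_map st i) \<and>
      stage_map st i ` fcar (idx (X i)) = Ker (i - 1) \<and>
      inj_on (\<lambda>k. stage_map st i (single k 1)) (idx (X i)) \<and>
      min_hom_gens (free_mod P (idx (X (i - 1))) (bdeg (X (i - 1)))) (Ker (i - 1))
        (basis_images (idx (X i)) (stage_map st i))" if i: "i \<in> {1..d}" for i
  proof -
    obtain j where j: "i = Suc j" "j < d" using i by (cases i) auto
    note R = run_round(1-4)[OF run j(2)]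
    have map: "stage_map st (Suc j) = (\<lambda>h. row_mult h (umin (st j)))"
      by (rule ext) (simp add: stage_map_def)
    have e: "stage_map st i (single k 1) = umin (st j) ! k" if "k \<in> idx (X i)" for k
      using that j by (simp add: stage_map_def next_stage(1) row_mult_single lmul_simps)
    have "inj_on (\<lambda>k. stage_map st i (single k 1)) (idx (X i))"
      using round_distinct[OF R] j e by (auto simp: inj_on_def next_stage(1) nth_eq_iff_index_eq)
    moreover have "basis_images (idx (X i)) (stage_map st i) = set (umin (st j))"
    proof -
      have "basis_images (idx (X i)) (stage_map st i) = (\<lambda>k. umin (st j) ! k) ` idx (X i)"
        unfolding basis_images_def using e by (intro image_cong) auto
      then show ?thesis using j by (auto simp: next_stage(1) in_set_conv_nth image_iff)
    qed
    moreover have "Ker (i - 1) = stageN P (X j)" using Ker[of j] j by simp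
    ultimately show ?thesis
      using round_graded_hom[OF R] round_image[OF R] round_minimal[OF R] j
      by (simp add: map next_stage[OF j(2)] stageL_def)
  qed
  moreover have "finite (idx (X i))" if "i \<le> d" for i
    using run_stages[OF run that] by (simp add: stage_ok_def)
  moreover have "idx (X d) \<noteq> {}" if "0 < d"
  proof -
    obtain j where j: "d = Suc j" using \<open>0 < d\<close> by (cases d) auto
    have "umin (st j) \<noteq> []"
    proof
      assume "umin (st j) = []"
      then have "stageN P (X j) = {0}" using run_syz(1)[OF run, of j] j by auto
      then show False using run_round(7)[OF run, of j] j by simp
    qed
    then show ?thesis using next_stage(1)[of j] j by (simp add: lessThan_empty_iff)
  qed
  moreover have "graded_hom (free_mod P (idx (X 0)) (bdeg (X 0))) M \<pi>" "\<pi> ` fcar (idx (X 0)) = carrier M"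
    "inj_on (\<lambda>i. \<pi> (single i 1)) (idx (X 0))" "min_hom_gens M (carrier M) (basis_images (idx (X 0)) \<pi>)"
    unfolding X00
    using presentation_graded_hom[OF finE p] presentationD(4)[OF p] presentation_minimal[OF M p finE pos]
    by blast+
  moreover have "Ker d = {0}" using Ker[of d] zero by simp
  ultimately show ?thesis
    unfolding min_graded_free_resolution_def Let_def carrier_free_mod Ker_def by blast
qed

end

end

theorem theorem5p4:
  fixes P :: "('k::field, 'a::ring_1) pbw_data"
    and M :: "('a, 'm) graded_module"
    and s :: nat and b :: "nat \<Rightarrow> nat" and U :: "'a vec list"
    and \<psi> :: "'a vec set \<Rightarrow> 'm"
  defines "L\<^sub>0 \<equiv> free_mod P {..<s} b"
  defines "N \<equiv> lspan L\<^sub>0 (set U)"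
  defines "\<pi> \<equiv> (\<lambda>x. \<psi> (N +>\<^bsub>L\<^sub>0\<^esub> x))"
  assumes A: "weighted_graded_solvable_algebra P"
    and U: "\<forall>\<xi>\<in>set U. \<xi> \<noteq> 0 \<and> homogeneous L\<^sub>0 \<xi>"
    and M: "graded_left_module P M"
    and \<psi>: "graded_iso (quot_mod L\<^sub>0 N) M \<psi>"
  shows
    "(\<comment> \<open>the procedures construct a minimal graded free resolution of length at most n\<close>
      \<exists>E' V d X r Us st W.
        minquot_output P {..<s} U E' V \<and>
        procedures_run P \<lparr>idx = E', bdeg = b, gens = V\<rparr> d X r Us st W \<and>
        stageN P (X d) = {0} \<and> d \<le> nvars P \<and>
        min_graded_free_resolution P M d (\<lambda>i. idx (X i)) (\<lambda>i. bdeg (X i)) \<pi> (stage_map st)) \<and>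
     \<comment> \<open>Procedure 1\<close>
     halts (minquot_step P) (minquot_final P) ({..<s}, U) \<and>
     (\<forall>E' V. minquot_output P {..<s} U E' V \<longrightarrow>
       (let L' = free_mod P E' b; N' = lspan L' (set V) in
        E' \<subseteq> {..<s} \<and> set V \<subseteq> N \<inter> carrier L' \<and>
        (\<forall>v\<in>set V. v \<noteq> 0 \<and> homogeneous L' v) \<and>
        (\<exists>\<theta>. graded_iso (quot_mod L' N') M \<theta>) \<and>
        inj_on (\<lambda>i. \<pi> (single i 1)) E' \<and>
        min_hom_gens M (carrier M) (basis_images E' \<pi>) \<and>
        graded_hom L' M \<pi> \<and> \<pi> ` carrier L' = carrier M \<and>
        {x \<in> carrier L'. \<pi> x = \<zero>\<^bsub>M\<^esub>} = N') \<and>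
       \<comment> \<open>any number of rounds of Procedures 2-4\<close>
       (\<forall>d X r Us st W. procedures_run P \<lparr>idx = E', bdeg = b, gens = V\<rparr> d X r Us st W \<longrightarrow>
         d \<le> nvars P \<and>
         (stageN P (X d) = {0} \<longrightarrow>
            min_graded_free_resolution P M d (\<lambda>i. idx (X i)) (\<lambda>i. bdeg (X i)) \<pi> (stage_map st)) \<and>
         (stageN P (X d) \<noteq> {0} \<longrightarrow>
            (\<exists>ord. left_monomial_ordering P (idx (X d)) ord) \<and>
            (\<forall>ord inp. left_monomial_ordering P (idx (X d)) ord \<longrightarrow> minsub_input P (X d) inp \<longrightarrow>
              \<comment> \<open>Procedure 2\<close>
              halts (minsub_stage_step P (X d) ord inp) minsub_final (minsub_init inp) \<and>
              (\<forall>out. (minsub_stage_step P (X d) ord inp)\<^sup>*\<^sup>* (minsub_init inp) out \<longrightarrow>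
                 (\<forall>x\<in>carrier (stageL P (X d)).
                    halts (div_step P ord (gb out)) div_final (x, 0, 0))) \<and>
              (\<forall>out. minsub_output P (X d) ord inp out \<longrightarrow>
                (let L = stageL P (X d);
                     G = gb out; s\<^sub>1 = length (umin out);
                     AG = free_mod P {..<length G} (\<lambda>k. hdeg L (G ! k));
                     b\<^sub>1 = (\<lambda>k. hdeg L (umin out ! k));
                     L\<^sub>1 = free_mod P {..<s\<^sub>1} b\<^sub>1;
                     N\<^sub>1 = syz (umin out);
                     \<phi>\<^sub>1 = (\<lambda>h. row_mult h (umin out))
                 in set (umin out) \<subseteq> set inp \<and> distinct (umin out) \<and>
                    min_hom_gens L (stageN P (X d)) (set (umin out)) \<and>
                    left_groebner_basis P ord (stageN P (X d)) (set G) \<and>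
                    set (syzs out) \<subseteq> syz G \<and> lspan AG (set (syzs out)) = syz G \<and>
                    length (vrows out) = length G \<and>
                    (\<forall>k<length G. vrows out ! k \<in> carrier L\<^sub>1 \<and>
                       G ! k = row_mult (vrows out ! k) (umin out)) \<and>
                    (\<forall>Wm. division_matrix P ord out Wm \<longrightarrow>
                       \<comment> \<open>Procedure 3\<close>
                       (\<forall>k<s\<^sub>1. Wm ! k \<in> carrier AG \<and> umin out ! k = row_mult (Wm ! k) G) \<and>
                       (\<forall>h\<in>set (syzygy_rows out Wm). homogeneous L\<^sub>1 h) \<and>
                       lspan L\<^sub>1 (set (syzygy_rows out Wm)) = N\<^sub>1 \<and>
                       \<comment> \<open>Procedure 4\<close>
                       stageL P (next_stage P (X d) out Wm) = L\<^sub>1 \<and>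
                       stageN P (next_stage P (X d) out Wm) = N\<^sub>1) \<and>
                    graded_hom L\<^sub>1 L \<phi>\<^sub>1 \<and> (\<forall>k<s\<^sub>1. \<phi>\<^sub>1 (single k 1) = umin out ! k) \<and>
                    {h \<in> carrier L\<^sub>1. \<phi>\<^sub>1 h = 0} = N\<^sub>1 \<and>
                    \<phi>\<^sub>1 ` carrier L\<^sub>1 = stageN P (X d)))))))"
proof -
  interpret weighted_solvable P by unfold_locales (rule A)
  let ?E = "{..<s}"
  have L: "L\<^sub>0 = free_mod P ?E b" by (simp add: L\<^sub>0_def)
  have Uf: "set U \<subseteq> fcar ?E" and Uh: "\<forall>v\<in>set U. v \<noteq> 0 \<and> (\<exists>q. homv b q v)"
    using U by (auto simp: L homogeneous_free_mod)
  have N: "N = row_space U"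
    unfolding N_def L by (rule lspan_free_mod[OF Uf])
  have Nc: "closed_submodule N" "N \<subseteq> fcar ?E"
    unfolding N using Uf by (auto intro: closed_submodule_row_space fcar_row_mult)
  have "presentation M ?E b N \<pi>"
    unfolding \<pi>_def L by (rule presentation_of_quotient[OF M _ Nc \<psi>[unfolded L]]) simp
  then have inv0: "minquot_inv M b \<pi> ?E U (?E, U)"
    using Uf Uh by (auto simp: minquot_inv_def N intro: row_space_member)
  \<comment> \<open>what is known about every output of MinQuot\<close>
  have out: "minquot_inv M b \<pi> ?E U (E', V)" "minquot_final P (E', V)"
    if "minquot_output P ?E U E' V" for E' V
    using that minquot_inv_reachable[OF M _ inv0] by (auto simp: minquot_output_def)
  have stage: "stage_ok \<lparr>idx = E', bdeg = b, gens = V\<rparr>"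
      "stageN P \<lparr>idx = E', bdeg = b, gens = V\<rparr> = row_space V"
      "row_space V \<subseteq> posv"
      "presentation M E' b (row_space V) \<pi>"
      "E' \<subseteq> ?E" "finite E'" "set V \<subseteq> N \<inter> fcar E'" "\<forall>v\<in>set V. v \<noteq> 0 \<and> (\<exists>q. homv b q v)"
    if V: "minquot_output P ?E U E' V" for E' V
  proof -
    note I = out(1)[OF V, unfolded minquot_inv_def prod.case]
    show E': "E' \<subseteq> ?E" using I by blast
    then show fin: "finite E'" by (rule finite_subset) simp
    show ok: "stage_ok \<lparr>idx = E', bdeg = b, gens = V\<rparr>"
      using I fin by (auto simp: stage_ok_def)
    then show "stageN P \<lparr>idx = E', bdeg = b, gens = V\<rparr> = row_space V"
      by (simp add: stageN_eq)
    show "row_space V \<subseteq> posv" by (rule minquot_final_posv[OF out[OF V]])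
    show "presentation M E' b (row_space V) \<pi>" using I by blast
    show "set V \<subseteq> N \<inter> fcar E'" "\<forall>v\<in>set V. v \<noteq> 0 \<and> (\<exists>q. homv b q v)"
      unfolding N using I by blast+
  qed
  note run_len = run_length[OF stage(1)]
  have resolution: "min_graded_free_resolution P M d (\<lambda>i. idx (X i)) (\<lambda>i. bdeg (X i)) \<pi> (stage_map st)"
    if V: "minquot_output P ?E U E' V" and run: "procedures_run P \<lparr>idx = E', bdeg = b, gens = V\<rparr> d X r Us st W"
      and zero: "stageN P (X d) = {0}" for E' V d X r Us st W
    by (rule run_resolution[OF stage(1)[OF V] M _ _ run zero]) (simp_all add: stage[OF V])
  have length_le: "d \<le> nvars P"
    if V: "minquot_output P ?E U E' V" and run: "procedures_run P \<lparr>idx = E', bdeg = b, gens = V\<rparr> d X r Us st W"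
    for E' V d X r Us st W
    by (rule run_length[OF stage(1)[OF V] run]) (simp add: stage[OF V])
  have part1: "\<exists>E' V d X r Us st W.
        minquot_output P ?E U E' V \<and>
        procedures_run P \<lparr>idx = E', bdeg = b, gens = V\<rparr> d X r Us st W \<and>
        stageN P (X d) = {0} \<and> d \<le> nvars P \<and>
        min_graded_free_resolution P M d (\<lambda>i. idx (X i)) (\<lambda>i. bdeg (X i)) \<pi> (stage_map st)"
  proof -
    obtain t where "(minquot_step P)\<^sup>*\<^sup>* (?E, U) t" "minquot_final P t"
      using halts_reaches_final[OF minquot_halts] by blast
    then obtain E' V where V: "minquot_output P ?E U E' V"
      unfolding minquot_output_def by (cases t) auto
    have "stageN P \<lparr>idx = E', bdeg = b, gens = V\<rparr> \<subseteq> posv" by (simp add: stage[OF V])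
    then obtain d X r Us st W where
      run: "procedures_run P \<lparr>idx = E', bdeg = b, gens = V\<rparr> d X r Us st W" "stageN P (X d) = {0}"
      using complete_run_exists[OF stage(1)[OF V]] by blast
    then show ?thesis using V length_le[OF V run(1)] resolution[OF V run] by blast
  qed
  have part2: "let L' = free_mod P E' b; N' = lspan L' (set V) in
        E' \<subseteq> ?E \<and> set V \<subseteq> N \<inter> carrier L' \<and>
        (\<forall>v\<in>set V. v \<noteq> 0 \<and> homogeneous L' v) \<and>
        (\<exists>\<theta>. graded_iso (quot_mod L' N') M \<theta>) \<and>
        inj_on (\<lambda>i. \<pi> (single i 1)) E' \<and>
        min_hom_gens M (carrier M) (basis_images E' \<pi>) \<and>
        graded_hom L' M \<pi> \<and> \<pi> ` carrier L' = carrier M \<and>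
        {x \<in> carrier L'. \<pi> x = \<zero>\<^bsub>M\<^esub>} = N'"
    if V: "minquot_output P ?E U E' V" for E' V
  proof -
    note S = stage[OF V]
    have VE: "set V \<subseteq> fcar E'" using S(7) by blast
    have N': "lspan (free_mod P E' b) (set V) = row_space V" by (rule lspan_free_mod[OF VE])
    have NE: "row_space V \<subseteq> fcar E'" using VE by (auto intro: fcar_row_mult)
    have iso: "\<exists>\<theta>. graded_iso (quot_mod (free_mod P E' b) (row_space V)) M \<theta>"
      by (rule presentation_iso[OF M S(6) closed_submodule_row_space NE S(4)])
    have hom: "\<forall>v\<in>set V. v \<noteq> 0 \<and> homogeneous (free_mod P E' b) v"
      using S(8) VE by (auto simp: homogeneous_free_mod[OF S(6)])
    have ker: "{x \<in> fcar E'. \<pi> x = \<zero>\<^bsub>M\<^esub>} = row_space V"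
      using presentationD(5)[OF S(4)] NE by blast
    show ?thesis
      unfolding Let_def carrier_free_mod N'
      using S(5,7) hom iso presentation_minimal[OF M S(4,6,3)] presentation_graded_hom[OF S(6,4)]
        presentationD(4)[OF S(4)] ker
      by blast
  qed
  show ?thesis
  proof (intro conjI allI impI)
    fix E' V assume V: "minquot_output P ?E U E' V"
    fix d X r Us st W
    assume run: "procedures_run P \<lparr>idx = E', bdeg = b, gens = V\<rparr> d X r Us st W"
    show "d \<le> nvars P" by (rule length_le[OF V run])
    have ok: "stage_ok (X d)" by (rule run_stages[OF stage(1)[OF V] run]) simp
    show "stageN P (X d) = {0} \<Longrightarrow>
        min_graded_free_resolution P M d (\<lambda>i. idx (X i)) (\<lambda>i. bdeg (X i)) \<pi> (stage_map st)"
      by (rule resolution[OF V run])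
    show "\<exists>ord. left_monomial_ordering P (idx (X d)) ord" by (rule left_monomial_ordering_exists)
    fix ord inp assume oi: "left_monomial_ordering P (idx (X d)) ord" "minsub_input P (X d) inp"
    show "halts (minsub_stage_step P (X d) ord inp) minsub_final (minsub_init inp)"
      by (rule round_halts(1)[OF ok oi])
    show "\<forall>x\<in>carrier (stageL P (X d)). halts (div_step P ord (gb out)) div_final (x, 0, 0)"
      if "(minsub_stage_step P (X d) ord inp)\<^sup>*\<^sup>* (minsub_init inp) out" for out
      using round_halts(2)[OF ok oi that] by blast
  qed (rule part1, rule minquot_halts, rule part2, assumption,
      rule round_output[OF run_stages[OF stage(1) _ le_refl]], assumption+)
qed

end
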